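(* Let $(M,X)$ be a dynamical system and $\Pi:M\to N$ a fibration. Suppose that, at some point $m\in M$, $$X(m)\notin\operatorname{Ker}\Pi_{\ast}.$$ Then there exist an open neighborhood $U$ of $m$, an $l$-dimensional manifold $\Lambda$, with $l=\dim M-\dim N$, and a complete solution $\Sigma:\Pi(U)\times\Lambda\rightarrow U$ of the $\Pi|_U$-HJE for $(U,X|_U)$.
   Context: All manifolds are smooth and finite-dimensional and all maps are smooth; $f_*$ denotes the tangent map of $f$. A fibration is a surjective submersion. A dynamical system $(M,X)$ is a manifold $M$ with a vector field $X$ on $M$. Given a fibration $\Pi:M\to N$, a section $\sigma:N\to M$ of $\Pi$ is a solution of the $\Pi$-Hamilton-Jacobi equation ($\Pi$-HJE) for $(M,X)$ if $\sigma_{\ast}\circ\Pi_{\ast}\circ X\circ\sigma=X\circ\sigma$. Let $\Lambda$ be a manifold of dimension $\dim M-\dim N$. A complete solution of the $\Pi$-HJE for $(M,X)$ is a surjective local diffeomorphism $\Sigma:N\times\Lambda\to M$ such that, for each $\lambda\in\Lambda$, the map $\sigma_\lambda:=\Sigma(\cdot,\lambda):N\to M$ is a section of $\Pi$ that is a solution of the $\Pi$-HJE for $(M,X)$. For $U\subset M$ open, $\Pi|_U:U\to\Pi(U)$ is the restricted fibration and $X|_U$ the restricted vector field; the definition of complete solution is applied to $(U,X|_U)$ and $\Pi|_U$. *)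

theory Defs
  imports "HOL-Analysis.Analysis"
begin

section \<open>Smooth maps between subsets of normed spaces\<close>

text \<open>
  The predicates are used for sets \<open>U\<close> that are relatively open in a linear subspace \<open>S\<close>. There
  the derivative within \<open>U\<close> is determined only along \<open>S\<close>; as it may be extended by \<open>0\<close> on a
  complement of \<open>S\<close>, quantifying over all directions \<open>v\<close> below amounts to quantifying over
  \<open>v \<in> S\<close>, and one obtains the usual class \<open>C^k\<close> for functions on the open subset \<open>U\<close> of \<open>S\<close>.
\<close>

primrec Ck_on ::
  "nat \<Rightarrow> 'e::real_normed_vector set \<Rightarrow> ('e \<Rightarrow> 'f::real_normed_vector) \<Rightarrow> bool" where
  "Ck_on 0 U f \<longleftrightarrow> continuous_on U f"
| "Ck_on (Suc k) U f \<longleftrightarrow>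
     (\<exists>D. (\<forall>x\<in>U. (f has_derivative D x) (at x within U)) \<and>
          (\<forall>v. Ck_on k U (\<lambda>x. D x v)))"

definition smooth_on ::
  "'e::real_normed_vector set \<Rightarrow> ('e \<Rightarrow> 'f::real_normed_vector) \<Rightarrow> bool" where
  "smooth_on U f \<longleftrightarrow> (\<forall>k. Ck_on k U f)"


section \<open>Smooth manifolds\<close>

text \<open>
  The model space of a manifold is a linear subspace \<open>model M\<close> of a Euclidean space, so that the
  dimension is a number (possibly \<open>0\<close>) rather than part of the type. A chart is a pair of its
  domain and the coordinate map, whose values off the domain are irrelevant.
\<close>

type_synonym ('a, 'e) chart = "'a set \<times> ('a \<Rightarrow> 'e)"

record ('a, 'e) manifold =
  mtop :: "'a topology"
  model :: "'e set"
  atlas :: "('a, 'e) chart set"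

abbreviation carrier_of :: "('a, 'e) manifold \<Rightarrow> 'a set" where
  "carrier_of M \<equiv> topspace (mtop M)"

definition second_countable_space :: "'a topology \<Rightarrow> bool" where
  "second_countable_space X \<longleftrightarrow>
     (\<exists>\<B>. countable \<B> \<and> (\<forall>B\<in>\<B>. openin X B) \<and>
          (\<forall>U x. openin X U \<and> x \<in> U \<longrightarrow> (\<exists>B\<in>\<B>. x \<in> B \<and> B \<subseteq> U)))"

definition is_chart :: "'a topology \<Rightarrow> 'e::euclidean_space set \<Rightarrow> ('a, 'e) chart \<Rightarrow> bool" where
  "is_chart X S c \<longleftrightarrow> (case c of (V, \<phi>) \<Rightarrow>
     openin X V \<and> openin (top_of_set S) (\<phi> ` V) \<and>
     homeomorphic_map (subtopology X V) (top_of_set (\<phi> ` V)) \<phi>)"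

text \<open>
  The atlas need not be maximal; it is only used through notions that do not change when
  compatible charts are added.
\<close>

definition smooth_manifold :: "('a, 'e::euclidean_space) manifold \<Rightarrow> bool" where
  "smooth_manifold M \<longleftrightarrow>
     Hausdorff_space (mtop M) \<and> second_countable_space (mtop M) \<and> subspace (model M) \<and>
     (\<forall>c\<in>atlas M. is_chart (mtop M) (model M) c) \<and>
     (\<Union>(V, \<phi>)\<in>atlas M. V) = carrier_of M \<and>
     (\<forall>(V, \<phi>)\<in>atlas M. \<forall>(W, \<psi>)\<in>atlas M. smooth_on (\<phi> ` (V \<inter> W)) (\<psi> \<circ> inv_into V \<phi>))"

definition mdim :: "('a, 'e::euclidean_space) manifold \<Rightarrow> nat" where
  "mdim M = dim (model M)"

definition open_submanifold ::
  "('a, 'e) manifold \<Rightarrow> 'a set \<Rightarrow> ('a, 'e) manifold" where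
  "open_submanifold M U =
     \<lparr> mtop = subtopology (mtop M) U, model = model M,
       atlas = (\<lambda>(V, \<phi>). (V \<inter> U, \<phi>)) ` atlas M \<rparr>"

definition product_manifold ::
  "('a, 'e) manifold \<Rightarrow> ('b, 'f) manifold \<Rightarrow> ('a \<times> 'b, 'e \<times> 'f) manifold" where
  "product_manifold M N =
     \<lparr> mtop = prod_topology (mtop M) (mtop N), model = model M \<times> model N,
       atlas = {(V \<times> W, map_prod \<phi> \<psi>) |V \<phi> W \<psi>. (V, \<phi>) \<in> atlas M \<and> (W, \<psi>) \<in> atlas N} \<rparr>"

definition smooth_map ::
  "('a, 'e::euclidean_space) manifold \<Rightarrow> ('b, 'f::euclidean_space) manifold \<Rightarrow> ('a \<Rightarrow> 'b) \<Rightarrow> bool"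
where
  "smooth_map M N f \<longleftrightarrow>
     continuous_map (mtop M) (mtop N) f \<and>
     (\<forall>(V, \<phi>)\<in>atlas M. \<forall>(W, \<psi>)\<in>atlas N.
        smooth_on (\<phi> ` (V \<inter> f -` W)) (\<psi> \<circ> f \<circ> inv_into V \<phi>))"

definition diffeomorphism ::
  "('a, 'e::euclidean_space) manifold \<Rightarrow> ('b, 'f::euclidean_space) manifold \<Rightarrow> ('a \<Rightarrow> 'b) \<Rightarrow> bool"
where
  "diffeomorphism M N f \<longleftrightarrow>
     smooth_map M N f \<and>
     (\<exists>g. smooth_map N M g \<and> (\<forall>x\<in>carrier_of M. g (f x) = x) \<and> (\<forall>y\<in>carrier_of N. f (g y) = y))"

definition local_diffeomorphism ::
  "('a, 'e::euclidean_space) manifold \<Rightarrow> ('b, 'f::euclidean_space) manifold \<Rightarrow> ('a \<Rightarrow> 'b) \<Rightarrow> bool"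
where
  "local_diffeomorphism M N f \<longleftrightarrow>
     (\<forall>p\<in>carrier_of M. \<exists>W. openin (mtop M) W \<and> p \<in> W \<and> openin (mtop N) (f ` W) \<and>
        diffeomorphism (open_submanifold M W) (open_submanifold N (f ` W)) f)"


section \<open>Tangent vectors, tangent maps and vector fields\<close>

text \<open>
  A tangent vector is an equivalence class of curves. Curves are functions on the whole real line
  of which only the germ at \<open>0\<close> matters; they are required to be differentiable at \<open>0\<close>. Hence
  \<open>T\<^sub>p U\<close> is literally \<open>T\<^sub>p M\<close> for an open submanifold \<open>U\<close> of \<open>M\<close> and \<open>p \<in> U\<close>, and tangent vectors
  at different points are different.
\<close>

type_synonym 'a tangent_vector = "(real \<Rightarrow> 'a) set"

definition curve_at ::
  "('a, 'e::euclidean_space) manifold \<Rightarrow> 'a \<Rightarrow> (real \<Rightarrow> 'a) \<Rightarrow> bool" where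
  "curve_at M p \<gamma> \<longleftrightarrow>
     p \<in> carrier_of M \<and> \<gamma> 0 = p \<and>
     (\<forall>(V, \<phi>)\<in>atlas M. p \<in> V \<longrightarrow>
        (\<forall>\<^sub>F t in at 0. \<gamma> t \<in> V) \<and> (\<phi> \<circ> \<gamma>) differentiable (at 0))"

definition velocity ::
  "('a, 'e::euclidean_space) manifold \<Rightarrow> (real \<Rightarrow> 'a) \<Rightarrow> 'a tangent_vector" where
  "velocity M \<gamma> =
     {\<delta>. curve_at M (\<gamma> 0) \<delta> \<and>
         (\<forall>(V, \<phi>)\<in>atlas M. \<gamma> 0 \<in> V \<longrightarrow>
            vector_derivative (\<phi> \<circ> \<delta>) (at 0) = vector_derivative (\<phi> \<circ> \<gamma>) (at 0))}"

definition tangent_space ::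
  "('a, 'e::euclidean_space) manifold \<Rightarrow> 'a \<Rightarrow> 'a tangent_vector set" where
  "tangent_space M p = {velocity M \<gamma> |\<gamma>. curve_at M p \<gamma>}"

definition zero_vector :: "('a, 'e::euclidean_space) manifold \<Rightarrow> 'a \<Rightarrow> 'a tangent_vector" where
  "zero_vector M p = velocity M (\<lambda>_. p)"

text \<open>
  If \<open>f\<close> is a smooth map into \<open>N\<close> and \<open>v\<close> a tangent vector of its source, all members of the union
  coincide: the tangent map sends the class of \<open>\<gamma>\<close> to the class of \<open>f \<circ> \<gamma>\<close>.
\<close>

definition tangent_map ::
  "('b, 'f::euclidean_space) manifold \<Rightarrow> ('a \<Rightarrow> 'b) \<Rightarrow> 'a tangent_vector \<Rightarrow> 'b tangent_vector" where
  "tangent_map N f v = (\<Union>\<gamma>\<in>v. velocity N (f \<circ> \<gamma>))"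

definition ker_tangent_map ::
  "('a, 'e::euclidean_space) manifold \<Rightarrow> ('b, 'f::euclidean_space) manifold \<Rightarrow> ('a \<Rightarrow> 'b) \<Rightarrow>
   'a tangent_vector set" where
  "ker_tangent_map M N f =
     (\<Union>p\<in>carrier_of M. {v \<in> tangent_space M p. tangent_map N f v = zero_vector N (f p)})"

definition coordinates :: "('a \<Rightarrow> 'e::euclidean_space) \<Rightarrow> 'a tangent_vector \<Rightarrow> 'e" where
  "coordinates \<phi> v = (THE w. \<forall>\<gamma>\<in>v. ((\<phi> \<circ> \<gamma>) has_vector_derivative w) (at 0))"

text \<open>
  Only the values of a vector field on the carrier matter. In particular the restriction of \<open>X\<close> to
  an open submanifold is represented by \<open>X\<close> itself, and likewise for restrictions of maps.
\<close>

definition vector_field ::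
  "('a, 'e::euclidean_space) manifold \<Rightarrow> ('a \<Rightarrow> 'a tangent_vector) \<Rightarrow> bool" where
  "vector_field M X \<longleftrightarrow>
     (\<forall>p\<in>carrier_of M. X p \<in> tangent_space M p) \<and>
     (\<forall>(V, \<phi>)\<in>atlas M. smooth_on (\<phi> ` V) (\<lambda>y. coordinates \<phi> (X (inv_into V \<phi> y))))"

definition dynamical_system ::
  "('a, 'e::euclidean_space) manifold \<Rightarrow> ('a \<Rightarrow> 'a tangent_vector) \<Rightarrow> bool" where
  "dynamical_system M X \<longleftrightarrow> smooth_manifold M \<and> vector_field M X"


section \<open>Fibrations and the Hamilton-Jacobi equation\<close>

definition submersion ::
  "('a, 'e::euclidean_space) manifold \<Rightarrow> ('b, 'f::euclidean_space) manifold \<Rightarrow> ('a \<Rightarrow> 'b) \<Rightarrow> bool"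
where
  "submersion M N f \<longleftrightarrow>
     smooth_map M N f \<and>
     (\<forall>p\<in>carrier_of M. tangent_map N f ` tangent_space M p = tangent_space N (f p))"

definition fibration ::
  "('a, 'e::euclidean_space) manifold \<Rightarrow> ('b, 'f::euclidean_space) manifold \<Rightarrow> ('a \<Rightarrow> 'b) \<Rightarrow> bool"
where
  "fibration M N \<pi> \<longleftrightarrow>
     smooth_manifold M \<and> smooth_manifold N \<and> submersion M N \<pi> \<and>
     \<pi> ` carrier_of M = carrier_of N"

definition is_section ::
  "('a, 'e::euclidean_space) manifold \<Rightarrow> ('b, 'f::euclidean_space) manifold \<Rightarrow> ('a \<Rightarrow> 'b) \<Rightarrow>
   ('b \<Rightarrow> 'a) \<Rightarrow> bool" where
  "is_section M N \<pi> \<sigma> \<longleftrightarrow> smooth_map N M \<sigma> \<and> (\<forall>q\<in>carrier_of N. \<pi> (\<sigma> q) = q)"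

definition HJE_solution ::
  "('a, 'e::euclidean_space) manifold \<Rightarrow> ('a \<Rightarrow> 'a tangent_vector) \<Rightarrow>
   ('b, 'f::euclidean_space) manifold \<Rightarrow> ('a \<Rightarrow> 'b) \<Rightarrow> ('b \<Rightarrow> 'a) \<Rightarrow> bool" where
  "HJE_solution M X N \<pi> \<sigma> \<longleftrightarrow>
     is_section M N \<pi> \<sigma> \<and>
     (\<forall>q\<in>carrier_of N. tangent_map M \<sigma> (tangent_map N \<pi> (X (\<sigma> q))) = X (\<sigma> q))"

definition complete_HJE_solution ::
  "('a, 'e::euclidean_space) manifold \<Rightarrow> ('a \<Rightarrow> 'a tangent_vector) \<Rightarrow>
   ('b, 'f::euclidean_space) manifold \<Rightarrow> ('a \<Rightarrow> 'b) \<Rightarrow>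
   ('c, 'g::euclidean_space) manifold \<Rightarrow> ('b \<times> 'c \<Rightarrow> 'a) \<Rightarrow> bool" where
  "complete_HJE_solution M X N \<pi> \<Lambda> \<Sigma> \<longleftrightarrow>
     dynamical_system M X \<and> fibration M N \<pi> \<and>
     smooth_manifold \<Lambda> \<and> mdim \<Lambda> = mdim M - mdim N \<and>
     local_diffeomorphism (product_manifold N \<Lambda>) M \<Sigma> \<and>
     \<Sigma> ` (carrier_of N \<times> carrier_of \<Lambda>) = carrier_of M \<and>
     (\<forall>l\<in>carrier_of \<Lambda>. HJE_solution M X N \<pi> (\<lambda>q. \<Sigma> (q, l)))"

end

theory Submission
  imports Defs
begin

text \<open>
  In charts around \<open>m\<close> and \<open>\<pi> m\<close>, the manifolds are open subsets of linear spaces \<open>S\<close> and \<open>T\<close>, and \<open>\<pi>\<close>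
  becomes a map with a surjective derivative \<open>A\<close> at \<open>m\<close>. Suppose that there is a local
  diffeomorphism \<open>F\<close> of \<open>S\<close> with two properties: it turns \<open>\<pi>\<close> into the linear map \<open>A\<close>, and it makes
  the field \<open>X\<close> horizontal, that is, tangent to the range of a right inverse \<open>R\<close> of \<open>A\<close>. Then each
  translate of the range of \<open>R\<close> is the image of a section of \<open>A\<close>, and \<open>X\<close> is tangent to it; but
  tangency to the image of a section is exactly what the Hamilton-Jacobi equation says. So the maps
  \<open>q \<mapsto> R q + l\<close>, where \<open>l\<close> runs through a small open subset \<open>\<Lambda>\<close> of the kernel of \<open>A\<close>, form a complete
  solution. Over a product of two small open sets it is even a diffeomorphism onto \<open>U\<close>.

  To find \<open>F\<close>, straighten \<open>X\<close> first (\<open>flow_box\<close>): as \<open>X\<close> does not vanish at \<open>m\<close>, there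
  are coordinates \<open>G\<close>, agreeing with the given ones to first order, in which \<open>X\<close> is constant. Since
  \<open>X\<close> is not vertical at \<open>m\<close>, the right inverse \<open>R\<close> can be chosen with this constant vector in its
  range. Then \<open>F = G + R (\<pi> - A G)\<close> has the identity as derivative at the point,
  satisfies \<open>A F = \<pi>\<close>, and sends \<open>X\<close> into the range of \<open>R\<close> (\<open>transversal_normal_form\<close>).

  The analytic content is that the flow of a smooth field is smooth. The same
  argument covers inverse functions, linear differential equations and flows: the difference
  quotient of a solution with respect to a parameter solves a linear equation of the same kind. The
  data of that equation extend continuously to the value \<open>h = 0\<close> of the increment
  (\<open>Hadamard_quotient\<close>), solutions depend continuously on the data, and so the
  derivative exists and solves the limiting equation. Induction on the order of differentiability
  then gives smoothness.
\<close>

section \<open>Calculus of \<open>C^k\<close> maps\<close>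

lemma Ck_on_SucI_pointwise:
  "\<forall>x\<in>U. (f has_derivative D x) (at x within U) \<Longrightarrow> \<forall>v. Ck_on k U (\<lambda>x. D x v) \<Longrightarrow> Ck_on (Suc k) U f"
  unfolding Ck_on.simps(2) by blast

declare Ck_on.simps(2) [simp del]

lemma Ck_on_cong:
  fixes f g :: "'a::real_normed_vector \<Rightarrow> 'b::real_normed_vector"
  assumes "\<And>x. x \<in> U \<Longrightarrow> f x = g x"
  shows "Ck_on k U f \<longleftrightarrow> Ck_on k U g"
proof -
  have *: "Ck_on k U g" if "Ck_on k U f" "\<And>x. x \<in> U \<Longrightarrow> f x = g x" for f g :: "'a \<Rightarrow> 'b"
  proof (cases k)
    case 0
    then show ?thesis using that by (simp cong: continuous_on_cong)
  next
    case (Suc j)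
    with that(1) obtain D where D: "\<forall>x\<in>U. (f has_derivative D x) (at x within U)" "\<forall>v. Ck_on j U (\<lambda>x. D x v)"
      unfolding Suc Ck_on.simps(2) by blast
    have "\<forall>x\<in>U. (g has_derivative D x) (at x within U)"
      using D(1) that(2) by (metis has_derivative_transform)
    then show ?thesis unfolding Suc using D(2) by (rule Ck_on_SucI_pointwise)
  qed
  show ?thesis using *[of f g] *[of g f] assms by auto
qed

lemma Ck_on_subset: "Ck_on k U f \<Longrightarrow> V \<subseteq> U \<Longrightarrow> Ck_on k V f"
proof (induction k arbitrary: f)
  case 0
  then show ?case using continuous_on_subset by auto
next
  case (Suc k)
  then obtain D where D: "\<forall>x\<in>U. (f has_derivative D x) (at x within U)" "\<forall>v. Ck_on k U (\<lambda>x. D x v)"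
    unfolding Ck_on.simps(2) by blast
  have "\<forall>x\<in>V. (f has_derivative D x) (at x within V)"
    using D(1) Suc.prems(2) has_derivative_subset by blast
  moreover have "\<forall>v. Ck_on k V (\<lambda>x. D x v)"
    using D(2) Suc.IH Suc.prems(2) by blast
  ultimately show ?case by (rule Ck_on_SucI_pointwise)
qed

lemma Ck_on_imp_continuous_on: "Ck_on k U f \<Longrightarrow> continuous_on U f"
  by (cases k) (auto intro: has_derivative_continuous_on simp del: Ck_on.simps(2) simp: Ck_on.simps)

lemma Ck_on_SucD: "Ck_on (Suc k) U f \<Longrightarrow> Ck_on k U f"
proof (induction k arbitrary: f)
  case 0
  then show ?case unfolding Ck_on.simps(1) using Ck_on_imp_continuous_on by blast
next
  case (Suc k)
  then obtain D where "\<forall>x\<in>U. (f has_derivative D x) (at x within U)" "\<forall>v. Ck_on (Suc k) U (\<lambda>x. D x v)"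
    by (subst (asm) Ck_on.simps(2)) blast
  then show ?case using Suc.IH unfolding Ck_on.simps(2)[of k U f] by blast
qed

lemma Ck_on_const: "Ck_on k U (\<lambda>x. c)"
proof (induction k arbitrary: c)
  case (Suc k)
  have "\<forall>x\<in>U. ((\<lambda>x. c) has_derivative (\<lambda>v. 0)) (at x within U)" by simp
  then show ?case by (rule Ck_on_SucI_pointwise) (use Suc in blast)
qed simp

lemma Ck_on_linear:
  assumes "bounded_linear f"
  shows "Ck_on k U f"
proof (cases k)
  case 0
  then show ?thesis using assms by (simp add: linear_continuous_on)
next
  case (Suc j)
  have "\<forall>x\<in>U. (f has_derivative f) (at x within U)"
    using assms by (simp add: bounded_linear_imp_has_derivative)
  then show ?thesis unfolding Suc by (rule Ck_on_SucI_pointwise) (simp add: Ck_on_const)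
qed

lemma Ck_on_ident: "Ck_on k U (\<lambda>x. x)"
  by (rule Ck_on_linear) (rule bounded_linear_ident)

lemma Ck_on_linear_compose:
  assumes "bounded_linear l"
  shows "Ck_on k U f \<Longrightarrow> Ck_on k U (\<lambda>x. l (f x))"
proof (induction k arbitrary: f)
  case 0
  then show ?case using bounded_linear.continuous_on[OF assms] by simp
next
  case (Suc k)
  then obtain D where D: "\<forall>x\<in>U. (f has_derivative D x) (at x within U)" "\<forall>v. Ck_on k U (\<lambda>x. D x v)"
    unfolding Ck_on.simps(2) by blast
  have "\<forall>x\<in>U. ((\<lambda>x. l (f x)) has_derivative (\<lambda>v. l (D x v))) (at x within U)"
    using D(1) bounded_linear.has_derivative[OF assms] by blast
  moreover have "\<forall>v. Ck_on k U (\<lambda>x. l (D x v))"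
    using D(2) Suc.IH by blast
  ultimately show ?case by (rule Ck_on_SucI_pointwise)
qed

lemma Ck_on_add: "Ck_on k U f \<Longrightarrow> Ck_on k U g \<Longrightarrow> Ck_on k U (\<lambda>x. f x + g x)"
proof (induction k arbitrary: f g)
  case 0
  then show ?case by (auto intro: continuous_on_add)
next
  case (Suc k)
  from Suc.prems obtain D E where *: "\<forall>x\<in>U. (f has_derivative D x) (at x within U)" "\<forall>v. Ck_on k U (\<lambda>x. D x v)"
    "\<forall>x\<in>U. (g has_derivative E x) (at x within U)" "\<forall>v. Ck_on k U (\<lambda>x. E x v)"
    unfolding Ck_on.simps(2) by blast
  have "\<forall>v. Ck_on k U (\<lambda>x. D x v + E x v)"
    using * Suc.IH by blast
  moreover have "\<forall>x\<in>U. ((\<lambda>x. f x + g x) has_derivative (\<lambda>v. D x v + E x v)) (at x within U)"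
    using * by (auto intro!: has_derivative_add)
  ultimately show ?case by (rule Ck_on_SucI_pointwise[rotated])
qed

lemma Ck_on_diff:
  assumes "Ck_on k U f" "Ck_on k U g"
  shows "Ck_on k U (\<lambda>x. f x - g x)"
proof -
  have "Ck_on k U (\<lambda>x. - g x)"
    by (rule Ck_on_linear_compose[OF bounded_linear_minus[OF bounded_linear_ident] assms(2)])
  from Ck_on_add[OF assms(1) this] show ?thesis by simp
qed

lemma Ck_on_sum: "(\<And>i. i \<in> I \<Longrightarrow> Ck_on k U (f i)) \<Longrightarrow> Ck_on k U (\<lambda>x. \<Sum>i\<in>I. f i x)"
proof (induction I rule: infinite_finite_induct)
  case (insert i I)
  have "Ck_on k U (\<lambda>x. f i x + (\<Sum>i\<in>I. f i x))"
    by (rule Ck_on_add) (use insert in simp_all)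
  then show ?case using insert by simp
qed (simp_all add: Ck_on_const)

lemma Ck_on_Pair:
  assumes "Ck_on k U f" "Ck_on k U g"
  shows "Ck_on k U (\<lambda>x. (f x, g x))"
proof -
  have "Ck_on k U (\<lambda>x. (f x, 0))"
    by (rule Ck_on_linear_compose[OF bounded_linear_Pair[OF bounded_linear_ident bounded_linear_zero] assms(1)])
  moreover have "Ck_on k U (\<lambda>x. (0, g x))"
    by (rule Ck_on_linear_compose[OF bounded_linear_Pair[OF bounded_linear_zero bounded_linear_ident] assms(2)])
  ultimately have "Ck_on k U (\<lambda>x. (f x, 0) + (0, g x))"
    by (rule Ck_on_add)
  then show ?thesis by simp
qed

lemma Ck_on_bilinear:
  assumes "bounded_bilinear mul"
  shows "Ck_on k U f \<Longrightarrow> Ck_on k U g \<Longrightarrow> Ck_on k U (\<lambda>x. mul (f x) (g x))"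
proof (induction k arbitrary: f g)
  case 0
  then show ?case by (simp add: bounded_bilinear.continuous_on[OF assms])
next
  case (Suc k)
  from Suc.prems obtain D E where *: "\<forall>x\<in>U. (f has_derivative D x) (at x within U)" "\<forall>v. Ck_on k U (\<lambda>x. D x v)"
    "\<forall>x\<in>U. (g has_derivative E x) (at x within U)" "\<forall>v. Ck_on k U (\<lambda>x. E x v)"
    unfolding Ck_on.simps(2) by blast
  have "Ck_on k U f" "Ck_on k U g" using Suc.prems Ck_on_SucD by blast+
  then have "\<forall>v. Ck_on k U (\<lambda>x. mul (f x) (E x v) + mul (D x v) (g x))"
    using * Suc.IH by (simp add: Ck_on_add)
  moreover have "\<forall>x\<in>U. ((\<lambda>x. mul (f x) (g x)) has_derivative (\<lambda>v. mul (f x) (E x v) + mul (D x v) (g x))) (at x within U)"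
    using * by (simp add: bounded_bilinear.FDERIV[OF assms])
  ultimately show ?case by (rule Ck_on_SucI_pointwise[rotated])
qed

lemmas Ck_on_scaleR = Ck_on_bilinear[OF bounded_bilinear_scaleR]
lemmas Ck_on_blinfun_apply = Ck_on_bilinear[OF bounded_bilinear_blinfun_apply]

text \<open>
  An operator on a Euclidean space is the sum of its values on a basis, multiplied by coordinate
  forms. Hence regularity tested on single vectors, as in the definition of \<open>Ck_on\<close>, is regularity
  with respect to the operator norm.
\<close>

lemma Ck_on_blinfunI:
  fixes F :: "'a::real_normed_vector \<Rightarrow> 'b::euclidean_space \<Rightarrow>\<^sub>L 'c::real_normed_vector"
  assumes "\<And>v. Ck_on k U (\<lambda>x. blinfun_apply (F x) v)"
  shows "Ck_on k U F"
proof -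
  have eq: "F x = (\<Sum>b\<in>Basis. blinfun_scaleR_left (F x b) o\<^sub>L blinfun_inner_left b)" for x
  proof (rule blinfun_eqI)
    fix v
    have "F x v = F x (\<Sum>b\<in>Basis. (v \<bullet> b) *\<^sub>R b)" by (simp add: euclidean_representation)
    then show "F x v = (\<Sum>b\<in>Basis. blinfun_scaleR_left (F x b) o\<^sub>L blinfun_inner_left b) v"
      by (simp add: blinfun.sum_right blinfun.sum_left blinfun.scaleR_right inner_commute
          )
  qed
  have "Ck_on k U (\<lambda>x. \<Sum>b\<in>Basis. blinfun_scaleR_left (F x b) o\<^sub>L blinfun_inner_left b)"
    by (intro Ck_on_sum Ck_on_bilinear[OF bounded_bilinear_blinfun_compose] Ck_on_const
        Ck_on_linear_compose[OF bounded_linear_blinfun_scaleR_left] assms)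
  then show ?thesis using eq by (simp flip: eq)
qed

text \<open>
  Over a Euclidean space, the derivative of a \<open>C^(k+1)\<close> map is a \<open>C^k\<close> map into the normed space
  of bounded operators, which turns the chain rule into a statement about bilinear products.
\<close>

lemma Ck_on_SucE:
  fixes f :: "'a::euclidean_space \<Rightarrow> 'b::real_normed_vector"
  assumes "Ck_on (Suc k) U f"
  obtains D :: "'a \<Rightarrow> 'a \<Rightarrow>\<^sub>L 'b" where
    "\<And>x. x \<in> U \<Longrightarrow> (f has_derivative blinfun_apply (D x)) (at x within U)" "Ck_on k U D"
proof -
  obtain D where D: "\<forall>x\<in>U. (f has_derivative D x) (at x within U)" "\<forall>v. Ck_on k U (\<lambda>x. D x v)"
    using assms unfolding Ck_on.simps(2) by blast
  have bl: "blinfun_apply (Blinfun (D x)) = D x" if "x \<in> U" for x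
    using D that by (intro bounded_linear_Blinfun_apply) (auto dest: has_derivative_bounded_linear)
  show ?thesis
  proof
    show "(f has_derivative blinfun_apply (Blinfun (D x))) (at x within U)" if "x \<in> U" for x
      using D bl that by simp
    show "Ck_on k U (\<lambda>x. Blinfun (D x))"
      by (rule Ck_on_blinfunI) (use D(2) bl in \<open>simp cong: Ck_on_cong\<close>)
  qed
qed

lemma Ck_on_compose:
  fixes f :: "'a::real_normed_vector \<Rightarrow> 'b::euclidean_space"
  shows "Ck_on k U f \<Longrightarrow> Ck_on k V g \<Longrightarrow> f ` U \<subseteq> V \<Longrightarrow> Ck_on k U (\<lambda>x. g (f x))"
proof (induction k arbitrary: g)
  case 0
  then show ?case using continuous_on_compose2 by auto
next
  case (Suc k)
  obtain E where E: "\<And>x. x \<in> V \<Longrightarrow> (g has_derivative blinfun_apply (E x)) (at x within V)" "Ck_on k V E"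
    using Ck_on_SucE[OF Suc.prems(2)] by blast
  obtain D where D: "\<forall>x\<in>U. (f has_derivative D x) (at x within U)" "\<forall>v. Ck_on k U (\<lambda>x. D x v)"
    using Suc.prems(1) unfolding Ck_on.simps(2) by blast
  have "Ck_on k U (\<lambda>x. E (f x))"
  proof (rule Ck_on_blinfunI)
    show "Ck_on k U (\<lambda>x. E (f x) v)" for v
      using Suc.IH[OF Ck_on_SucD[OF Suc.prems(1)] Ck_on_blinfun_apply[OF E(2) Ck_on_const] Suc.prems(3)] .
  qed
  then have "\<forall>v. Ck_on k U (\<lambda>x. E (f x) (D x v))"
    using D(2) Ck_on_blinfun_apply by blast
  moreover have "\<forall>x\<in>U. ((\<lambda>x. g (f x)) has_derivative (\<lambda>v. E (f x) (D x v))) (at x within U)"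
  proof
    fix x assume x: "x \<in> U"
    show "((\<lambda>x. g (f x)) has_derivative (\<lambda>v. E (f x) (D x v))) (at x within U)"
      by (rule has_derivative_in_compose2[OF E(1) Suc.prems(3) x]) (use D(1) x in auto)
  qed
  ultimately show ?case by (rule Ck_on_SucI_pointwise[rotated])
qed

text \<open>
  Continuous partial derivatives make a map differentiable: walk from \<open>x\<close> to \<open>x + w\<close> parallel to
  the axes and apply the mean value theorem on each leg.
\<close>

lemma has_derivative_from_partials:
  fixes f :: "'a::euclidean_space \<Rightarrow> 'b::real_normed_vector"
  assumes "open U" "x \<in> U"
    and cont: "\<And>b. b \<in> Basis \<Longrightarrow> continuous_on U (g b)"
    and der: "\<And>b y. b \<in> Basis \<Longrightarrow> y \<in> U \<Longrightarrow> ((\<lambda>h. f (y + h *\<^sub>R b)) has_vector_derivative g b y) (at 0)"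
  shows "(f has_derivative (\<lambda>v. \<Sum>b\<in>Basis. (v \<bullet> b) *\<^sub>R g b x)) (at x)"
proof -
  have main: "\<exists>d>0. \<forall>w. norm w < d \<longrightarrow>
      norm (f (x + w) - f x - (\<Sum>b\<in>Basis. (w \<bullet> b) *\<^sub>R g b x)) \<le> e * norm w" if "e > 0" for e
  proof -
    define \<eta> where "\<eta> = e / (DIM('a) + 1)"
    have \<eta>: "\<eta> > 0" "DIM('a) * \<eta> \<le> e"
      using that by (auto simp: \<eta>_def field_simps)
    have "\<exists>d>0. \<forall>y. dist y x < d \<longrightarrow> y \<in> U \<and> dist (g b y) (g b x) < \<eta>" if "b \<in> Basis" for b
    proof -
      obtain d1 where "d1 > 0" "\<forall>y. dist y x < d1 \<longrightarrow> y \<in> U"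
        using assms(1,2) open_dist by metis
      moreover obtain d2 where "d2 > 0" "\<forall>y\<in>U. dist y x < d2 \<longrightarrow> dist (g b y) (g b x) < \<eta>"
        using cont[OF \<open>b \<in> Basis\<close>] \<eta>(1) assms(2) unfolding continuous_on_iff by metis
      ultimately show ?thesis by (intro exI[of _ "min d1 d2"]) auto
    qed
    then obtain d where d: "\<And>b. b \<in> Basis \<Longrightarrow> d b > 0"
      "\<And>b y. b \<in> Basis \<Longrightarrow> dist y x < d b \<Longrightarrow> y \<in> U \<and> dist (g b y) (g b x) < \<eta>"
      by metis
    define d0 where "d0 = Min (d ` Basis) / DIM('a)"
    have Mpos: "Min (d ` Basis) > 0" using d(1) by (subst Min_gr_iff) auto
    then have d0: "d0 > 0" by (simp add: d0_def)
    have dle: "d0 * DIM('a) \<le> d b" if "b \<in> Basis" for b using that by (simp add: d0_def)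
    have partial: "norm (f (x + (\<Sum>b\<in>B. (w \<bullet> b) *\<^sub>R b)) - f x - (\<Sum>b\<in>B. (w \<bullet> b) *\<^sub>R g b x)) \<le> card B * (\<eta> * norm w)"
      if "norm w < d0" "B \<subseteq> Basis" for w B
    proof -
      have "finite B" using that(2) finite_Basis finite_subset by blast
      then show ?thesis using that(2)
      proof (induction B rule: finite_induct)
        case empty
        then show ?case by simp
      next
        case (insert c B)
        define y where "y = x + (\<Sum>b\<in>B. (w \<bullet> b) *\<^sub>R b)"
        have c: "c \<in> Basis" using insert by auto
        have near: "dist (y + (s * (w \<bullet> c)) *\<^sub>R c) x < d c" if "s \<in> {0..1}" for s
        proof -
          have "dist (y + (s * (w \<bullet> c)) *\<^sub>R c) x = norm ((\<Sum>b\<in>B. (w \<bullet> b) *\<^sub>R b) + (s * (w \<bullet> c)) *\<^sub>R c)"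
            by (simp add: y_def dist_norm)
          also have "\<dots> \<le> (\<Sum>b\<in>B. norm ((w \<bullet> b) *\<^sub>R b)) + norm ((s * (w \<bullet> c)) *\<^sub>R c)"
            by (rule norm_triangle_le, rule add_right_mono, rule norm_sum)
          also have "\<dots> \<le> (\<Sum>b\<in>B. norm w) + norm w"
          proof (intro add_mono sum_mono)
            show "norm ((w \<bullet> b) *\<^sub>R b) \<le> norm w" if "b \<in> B" for b
              using that insert.prems Basis_le_norm[of b w] by (auto simp: subset_iff)
            have "s * \<bar>w \<bullet> c\<bar> \<le> \<bar>w \<bullet> c\<bar>" using that by (intro mult_left_le_one_le) auto
            then show "norm ((s * (w \<bullet> c)) *\<^sub>R c) \<le> norm w"
              using that c Basis_le_norm[of c w] by (auto simp: abs_mult)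
          qed
          also have "\<dots> = card (insert c B) * norm w" using insert by (simp add: algebra_simps)
          also have "\<dots> \<le> DIM('a) * norm w"
            by (intro mult_right_mono of_nat_mono card_mono insert.prems) auto
          also have "\<dots> < DIM('a) * d0" using \<open>norm w < d0\<close> by simp
          also have "\<dots> \<le> d c" using dle[OF c] by (simp add: mult.commute)
          finally show ?thesis .
        qed
        define \<phi> where "\<phi> = (\<lambda>s::real. f (y + (s * (w \<bullet> c)) *\<^sub>R c) - (s * (w \<bullet> c)) *\<^sub>R g c x)"
        have der\<phi>: "(\<phi> has_derivative (\<lambda>r. r *\<^sub>R ((w \<bullet> c) *\<^sub>R (g c (y + (s * (w \<bullet> c)) *\<^sub>R c) - g c x)))) (at s within {0..1})"
          if "s \<in> {0..1}" for s
        proof -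
          let ?y = "y + (s * (w \<bullet> c)) *\<^sub>R c"
          have yU: "?y \<in> U" using near[OF that] d(2)[OF c] by blast
          have "((\<lambda>h. f (?y + h *\<^sub>R c)) has_vector_derivative g c ?y) (at ((\<lambda>r. (r - s) * (w \<bullet> c)) s))"
            using der[OF c yU] by simp
          moreover have "((\<lambda>r. (r - s) * (w \<bullet> c)) has_vector_derivative (w \<bullet> c)) (at s)"
            by (auto intro!: derivative_eq_intros)
          ultimately have "((\<lambda>h. f (?y + h *\<^sub>R c)) \<circ> (\<lambda>r. (r - s) * (w \<bullet> c)) has_vector_derivative (w \<bullet> c) *\<^sub>R g c ?y) (at s)"
            by (intro vector_diff_chain_at) auto
          then have "((\<lambda>r. f (y + (r * (w \<bullet> c)) *\<^sub>R c)) has_vector_derivative (w \<bullet> c) *\<^sub>R g c ?y) (at s)"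
            by (simp add: o_def algebra_simps flip: scaleR_add_left)
          then have "(\<phi> has_vector_derivative (w \<bullet> c) *\<^sub>R g c ?y - (w \<bullet> c) *\<^sub>R g c x) (at s)"
            unfolding \<phi>_def by (auto intro!: derivative_eq_intros has_vector_derivative_diff)
          then show ?thesis
            by (auto simp: has_vector_derivative_def scaleR_diff_right intro: has_derivative_at_withinI)
        qed
        have "norm (\<phi> 1 - \<phi> 0) \<le> (\<eta> * norm w) * norm (1 - 0::real)"
        proof (rule differentiable_bound[of "{0..1}"])
          show "onorm (\<lambda>r. r *\<^sub>R ((w \<bullet> c) *\<^sub>R (g c (y + (s * (w \<bullet> c)) *\<^sub>R c) - g c x))) \<le> \<eta> * norm w"
            if "s \<in> {0..1}" for s
          proof (rule onorm_le)
            fix r :: real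
            have "norm (g c (y + (s * (w \<bullet> c)) *\<^sub>R c) - g c x) \<le> \<eta>"
              using d(2)[OF c near[OF that]] by (simp add: dist_norm)
            then have "\<bar>w \<bullet> c\<bar> * norm (g c (y + (s * (w \<bullet> c)) *\<^sub>R c) - g c x) \<le> norm w * \<eta>"
              using Basis_le_norm[OF c] by (intro mult_mono) auto
            from mult_left_mono[OF this, of "\<bar>r\<bar>"]
            show "norm (r *\<^sub>R ((w \<bullet> c) *\<^sub>R (g c (y + (s * (w \<bullet> c)) *\<^sub>R c) - g c x))) \<le> \<eta> * norm w * norm r"
              by (simp add: abs_mult mult_ac)
          qed
        qed (use der\<phi> in auto)
        then have leg: "norm (f (y + (w \<bullet> c) *\<^sub>R c) - (w \<bullet> c) *\<^sub>R g c x - f y) \<le> \<eta> * norm w"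
          by (simp add: \<phi>_def)
        have IH: "norm (f y - f x - (\<Sum>b\<in>B. (w \<bullet> b) *\<^sub>R g b x)) \<le> card B * (\<eta> * norm w)"
          using insert unfolding y_def by auto
        have split: "f (x + (\<Sum>b\<in>insert c B. (w \<bullet> b) *\<^sub>R b)) - f x - (\<Sum>b\<in>insert c B. (w \<bullet> b) *\<^sub>R g b x)
           = (f (y + (w \<bullet> c) *\<^sub>R c) - (w \<bullet> c) *\<^sub>R g c x - f y) + (f y - f x - (\<Sum>b\<in>B. (w \<bullet> b) *\<^sub>R g b x))"
        proof -
          have 1: "x + (\<Sum>b\<in>insert c B. (w \<bullet> b) *\<^sub>R b) = y + (w \<bullet> c) *\<^sub>R c"
            using insert.hyps by (simp add: y_def)
          have 2: "(\<Sum>b\<in>insert c B. (w \<bullet> b) *\<^sub>R g b x) = (w \<bullet> c) *\<^sub>R g c x + (\<Sum>b\<in>B. (w \<bullet> b) *\<^sub>R g b x)"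
            using insert.hyps by simp
          show ?thesis unfolding 1 2 by simp
        qed
        have "norm (f (x + (\<Sum>b\<in>insert c B. (w \<bullet> b) *\<^sub>R b)) - f x - (\<Sum>b\<in>insert c B. (w \<bullet> b) *\<^sub>R g b x))
            \<le> \<eta> * norm w + card B * (\<eta> * norm w)"
          unfolding split by (rule norm_triangle_le[OF add_mono[OF leg IH]])
        also have "\<dots> = card (insert c B) * (\<eta> * norm w)" using insert by (simp add: algebra_simps)
        finally show ?case .
      qed
    qed
    have "norm (f (x + w) - f x - (\<Sum>b\<in>Basis. (w \<bullet> b) *\<^sub>R g b x)) \<le> e * norm w" if "norm w < d0" for w
    proof -
      have "norm (f (x + w) - f x - (\<Sum>b\<in>Basis. (w \<bullet> b) *\<^sub>R g b x)) \<le> DIM('a) * \<eta> * norm w"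
        using partial[OF that order_refl] by (simp add: euclidean_representation)
      also have "\<dots> \<le> e * norm w" by (intro mult_right_mono \<eta>) auto
      finally show ?thesis .
    qed
    then show ?thesis using d0 by blast
  qed
  show ?thesis
    unfolding has_derivative_at_alt
  proof (intro conjI allI impI)
    show "bounded_linear (\<lambda>v. \<Sum>b\<in>Basis. (v \<bullet> b) *\<^sub>R g b x)"
      by (intro bounded_linear_sum bounded_linear_scaleR_const bounded_linear_inner_left)
    fix e :: real assume "e > 0"
    from main[OF this] obtain d where "d > 0" and d: "\<And>w. norm w < d \<Longrightarrow>
      norm (f (x + w) - f x - (\<Sum>b\<in>Basis. (w \<bullet> b) *\<^sub>R g b x)) \<le> e * norm w" by blast
    then show "\<exists>d>0. \<forall>y. norm (y - x) < d \<longrightarrow> norm (f y - f x - (\<Sum>b\<in>Basis. ((y - x) \<bullet> b) *\<^sub>R g b x)) \<le> e * norm (y - x)"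
      by (intro exI[of _ d]) (metis add_diff_cancel_left' add.commute diff_add_cancel)
  qed
qed

lemma Ck_on_from_partials:
  fixes f :: "'a::euclidean_space \<Rightarrow> 'b::real_normed_vector"
  assumes "open U"
    and C: "\<And>b. b \<in> Basis \<Longrightarrow> Ck_on k U (g b)"
    and der: "\<And>b y. b \<in> Basis \<Longrightarrow> y \<in> U \<Longrightarrow> ((\<lambda>h. f (y + h *\<^sub>R b)) has_vector_derivative g b y) (at 0)"
  shows "Ck_on (Suc k) U f"
proof -
  have "\<forall>x\<in>U. (f has_derivative (\<lambda>v. \<Sum>b\<in>Basis. (v \<bullet> b) *\<^sub>R g b x)) (at x within U)"
  proof
    fix x assume "x \<in> U"
    show "(f has_derivative (\<lambda>v. \<Sum>b\<in>Basis. (v \<bullet> b) *\<^sub>R g b x)) (at x within U)"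
      by (rule has_derivative_at_withinI, rule has_derivative_from_partials[OF assms(1) \<open>x \<in> U\<close>])
        (simp_all add: Ck_on_imp_continuous_on[OF C] der)
  qed
  moreover have "\<forall>v. Ck_on k U (\<lambda>x. \<Sum>b\<in>Basis. (v \<bullet> b) *\<^sub>R g b x)"
    by (intro allI Ck_on_sum Ck_on_linear_compose[OF bounded_linear_scaleR_right] C)
  ultimately show ?thesis by (rule Ck_on_SucI_pointwise)
qed

text \<open>
  Hadamard's lemma: difference quotients of a \<open>C^1\<close> family extend continuously to \<open>h = 0\<close>. It lets
  one differentiate the solution of an equation by observing that its difference quotient solves an
  equation of the same type, whose data depend continuously on \<open>h\<close> up to \<open>h = 0\<close>.
\<close>

lemma Hadamard_quotient:
  fixes g g' :: "'t::topological_space \<Rightarrow> real \<Rightarrow> 'b::euclidean_space"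
  assumes der: "\<forall>t\<in>K. \<forall>h\<in>{-\<delta><..<\<delta>}. ((\<lambda>h. g t h) has_vector_derivative g' t h) (at h)"
    and cont: "continuous_on (K \<times> {-\<delta><..<\<delta>}) (\<lambda>(t, h). g' t h)"
  defines "q \<equiv> \<lambda>t h. integral (cbox 0 1) (\<lambda>\<theta>. g' t (\<theta> * h))"
  shows "continuous_on (K \<times> {-\<delta><..<\<delta>}) (\<lambda>(t, h). q t h)"
    and "\<And>t h. t \<in> K \<Longrightarrow> \<bar>h\<bar> < \<delta> \<Longrightarrow> g t h - g t 0 = h *\<^sub>R q t h"
    and "\<And>t. q t 0 = g' t 0"
proof -
  have small: "\<bar>\<theta> * h\<bar> < \<delta>" if "\<bar>h\<bar> < \<delta>" "\<theta> \<in> {0..1}" for \<theta> h :: real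
  proof -
    have "\<bar>\<theta> * h\<bar> \<le> \<bar>h\<bar>" using that by (auto simp: abs_mult mult_left_le_one_le)
    then show ?thesis using that by linarith
  qed
  have "continuous_on ((K \<times> {-\<delta><..<\<delta>}) \<times> cbox 0 1) (\<lambda>(p, \<theta>). case p of (t, h) \<Rightarrow> g' t (\<theta> * h))"
  proof -
    have "continuous_on ((K \<times> {-\<delta><..<\<delta>}) \<times> cbox 0 (1::real)) ((\<lambda>(t, h). g' t h) \<circ> (\<lambda>p. (fst (fst p), snd p * snd (fst p))))"
      by (intro continuous_on_compose continuous_on_subset[OF cont] continuous_intros)
        (use small in \<open>fastforce simp: abs_less_iff\<close>)
    then show ?thesis by (simp add: o_def split_beta)
  qed
  from integral_continuous_on_param[of _ 0 "1::real" "\<lambda>p \<theta>. case p of (t, h) \<Rightarrow> g' t (\<theta> * h)", OF this]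
  show "continuous_on (K \<times> {-\<delta><..<\<delta>}) (\<lambda>(t, h). q t h)"
    by (simp add: q_def split_beta)
  show "g t h - g t 0 = h *\<^sub>R q t h" if "t \<in> K" "\<bar>h\<bar> < \<delta>" for t h
  proof -
    have c: "continuous_on {0..1} (\<lambda>\<theta>. g' t (\<theta> * h))"
    proof -
      have "continuous_on {0..1} ((\<lambda>(t, h). g' t h) \<circ> (\<lambda>\<theta>. (t, \<theta> * h)))"
        by (intro continuous_on_compose continuous_on_subset[OF cont] continuous_intros)
          (use small that in \<open>fastforce simp: abs_less_iff\<close>)
      then show ?thesis by (simp add: o_def)
    qed
    have "((\<lambda>\<theta>. h *\<^sub>R g' t (\<theta> * h)) has_integral g t (1 * h) - g t (0 * h)) {0..1}"
    proof (rule fundamental_theorem_of_calculus)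
      fix \<theta> :: real assume "\<theta> \<in> {0..1}"
      have "((\<lambda>h. g t h) \<circ> (\<lambda>\<theta>. \<theta> * h) has_vector_derivative h *\<^sub>R g' t (\<theta> * h)) (at \<theta>)"
      proof (rule vector_diff_chain_at)
        show "((\<lambda>\<theta>. \<theta> * h) has_vector_derivative h) (at \<theta>)"
          by (auto intro!: derivative_eq_intros)
        show "((\<lambda>h. g t h) has_vector_derivative g' t (\<theta> * h)) (at (\<theta> * h))"
          using der that small[OF that(2) \<open>\<theta> \<in> {0..1}\<close>] by (simp add: abs_less_iff)
      qed
      then show "((\<lambda>\<theta>. g t (\<theta> * h)) has_vector_derivative h *\<^sub>R g' t (\<theta> * h)) (at \<theta> within {0..1})"
        by (auto simp: o_def intro: has_vector_derivative_at_within)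
    qed simp
    from integral_unique[OF this]
    have "g t h - g t 0 = integral {0..1} (\<lambda>\<theta>. h *\<^sub>R g' t (\<theta> * h))"
      by simp
    also have "\<dots> = h *\<^sub>R q t h"
      unfolding q_def cbox_interval by (rule integral_cmul)
    finally show ?thesis .
  qed
  show "q t 0 = g' t 0" for t by (simp add: q_def)
qed

section \<open>Linear equations with parameters and the smooth inverse function theorem\<close>

text \<open>
  If \<open>z\<close> solves the equation, \<open>A p (z p - z p0)\<close> is expressed by differences of the data alone, and
  the uniform lower bound on \<open>A p\<close> turns its smallness into that of \<open>z p - z p0\<close>.
\<close>

lemma linear_equation_continuous:
  fixes A :: "'p::topological_space \<Rightarrow> 'e::real_normed_vector \<Rightarrow>\<^sub>L 'e"
  assumes A: "continuous_on P A" and b: "continuous_on P b" and "c > 0"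
    and bound: "\<And>p v. p \<in> P \<Longrightarrow> c * norm v \<le> norm (A p v)"
    and eq: "\<And>p. p \<in> P \<Longrightarrow> A p (z p) = b p"
  shows "continuous_on P z"
  unfolding continuous_on_def
proof
  fix p0 assume p0: "p0 \<in> P"
  let ?r = "\<lambda>p. b p - b p0 - (A p - A p0) (z p0)"
  have "(?r \<longlongrightarrow> b p0 - b p0 - (A p0 - A p0) (z p0)) (at p0 within P)"
    using A b p0 unfolding continuous_on_def
    by (intro tendsto_intros) auto
  then have lim: "((\<lambda>p. norm (?r p) / c) \<longlongrightarrow> 0) (at p0 within P)"
    by (intro tendsto_divide_zero tendsto_norm_zero) simp
  have "norm (z p - z p0) \<le> norm (?r p) / c" if "p \<in> P" for p
  proof -
    have "A p (z p - z p0) = ?r p"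
      using eq[OF that] eq[OF p0] by (simp add: blinfun.bilinear_simps)
    then have "c * norm (z p - z p0) \<le> norm (?r p)"
      using bound[OF that, of "z p - z p0"] by simp
    then show ?thesis using \<open>c > 0\<close> by (simp only: pos_le_divide_eq mult.commute)
  qed
  then have "((\<lambda>p. z p - z p0) \<longlongrightarrow> 0) (at p0 within P)"
    by (intro tendsto_0_le[OF lim, of _ 1])
      (use \<open>c > 0\<close> in \<open>auto simp: eventually_at_filter intro!: always_eventually\<close>)
  then show "(z \<longlongrightarrow> z p0) (at p0 within P)" by (simp add: LIM_zero_iff)
qed

lemma open_line_segment:
  fixes w :: "'a::real_normed_vector"
  assumes "open P" "p \<in> P"
  obtains \<delta> where "\<delta> > 0" "\<And>h. \<bar>h\<bar> < \<delta> \<Longrightarrow> p + h *\<^sub>R w \<in> P"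
proof -
  have "open ((\<lambda>h. p + h *\<^sub>R w) -` P)"
    by (intro open_vimage assms continuous_intros)
  moreover have "0 \<in> (\<lambda>h. p + h *\<^sub>R w) -` P" using assms by simp
  ultimately obtain \<delta> where "\<delta> > 0" "ball 0 \<delta> \<subseteq> (\<lambda>h. p + h *\<^sub>R w) -` P"
    using open_contains_ball by blast
  then show ?thesis by (intro that[of \<delta>]) (auto simp: subset_iff)
qed

lemma has_vector_derivative_directional:
  assumes "(f has_derivative D) (at (x + h *\<^sub>R w))"
  shows "((\<lambda>s. f (x + s *\<^sub>R w)) has_vector_derivative D w) (at h)"
proof -
  interpret bounded_linear D using assms by (rule has_derivative_bounded_linear)
  have "((\<lambda>s. x + s *\<^sub>R w) has_derivative (\<lambda>s. s *\<^sub>R w)) (at h)"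
    by (auto intro!: derivative_eq_intros)
  from has_derivative_compose[OF this assms] show ?thesis
    by (simp add: has_vector_derivative_def scaleR)
qed

lemma has_vector_derivative_at_0_from_quotient:
  assumes "\<delta> > 0" and cont: "continuous_on {-\<delta><..<\<delta>} Q"
    and eq: "\<And>h. \<bar>h\<bar> < \<delta> \<Longrightarrow> z h - z 0 = h *\<^sub>R Q h"
  shows "(z has_vector_derivative Q 0) (at 0)"
proof -
  have "(Q \<longlongrightarrow> Q 0) (at 0)"
    using cont \<open>\<delta> > 0\<close> by (auto simp: continuous_on_eq_continuous_at isCont_def)
  moreover have "\<forall>\<^sub>F h in at 0. Q h = (z h - z 0) /\<^sub>R h"
    unfolding eventually_at using \<open>\<delta> > 0\<close> eq by (intro exI[of _ \<delta>]) auto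
  ultimately have "((\<lambda>h. (z h - z 0) /\<^sub>R h) \<longlongrightarrow> Q 0) (at 0)"
    by (rule Lim_transform_eventually)
  then have "((\<lambda>h. (z (0 + h) - z 0 - h *\<^sub>R Q 0) /\<^sub>R h) \<longlongrightarrow> 0) (at 0)"
  proof (rule Lim_transform_eventually[OF LIM_zero])
    show "\<forall>\<^sub>F h in at 0. (z h - z 0) /\<^sub>R h - Q 0 = (z (0 + h) - z 0 - h *\<^sub>R Q 0) /\<^sub>R h"
      by (auto simp: eventually_at_filter scaleR_diff_right)
  qed
  from tendsto_norm_zero[OF this]
  have "((\<lambda>h. norm (z (0 + h) - z 0 - h *\<^sub>R Q 0) / norm h) \<longlongrightarrow> 0) (at 0)"
    by (simp add: divide_inverse mult.commute)
  then show ?thesis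
    unfolding has_vector_derivative_def has_derivative_at
    by (auto intro: bounded_linear_scaleR_left)
qed

text \<open>
  The derivative of \<open>z\<close> in the direction \<open>w\<close> must solve the equation with the same \<open>A\<close> and the right
  hand side \<open>r w = b' w - (A' w) z\<close>. As only the right hand side changes, one can induct on the
  order of differentiability.
\<close>

lemma linear_equation_Ck:
  fixes A :: "'p::euclidean_space \<Rightarrow> 'e::euclidean_space \<Rightarrow>\<^sub>L 'e"
  assumes "open P" and "c > 0"
    and bound: "\<And>p v. p \<in> P \<Longrightarrow> c * norm v \<le> norm (A p v)"
    and "Ck_on k P A" "Ck_on k P b"
    and eq: "\<And>p. p \<in> P \<Longrightarrow> A p (z p) = b p"
  shows "Ck_on k P z"
  using assms(4-6)
proof (induction k arbitrary: b z)
  case 0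
  then show ?case
    using linear_equation_continuous[of P A b c z] bound \<open>c > 0\<close> by simp
next
  case (Suc k)
  obtain A' where A': "\<And>p. p \<in> P \<Longrightarrow> (A has_derivative blinfun_apply (A' p)) (at p)" "Ck_on k P A'"
    using Ck_on_SucE[OF Suc.prems(1)] by (metis at_within_open[OF _ \<open>open P\<close>])
  obtain b' where b': "\<And>p. p \<in> P \<Longrightarrow> (b has_derivative blinfun_apply (b' p)) (at p)" "Ck_on k P b'"
    using Ck_on_SucE[OF Suc.prems(2)] by (metis at_within_open[OF _ \<open>open P\<close>])
  have Ck: "Ck_on k P A" "Ck_on k P b" using Suc.prems Ck_on_SucD by blast+
  have z: "Ck_on k P z" using Suc.IH Ck Suc.prems(3) by blast
  have contA: "continuous_on P A" and contA': "continuous_on P A'" and contb': "continuous_on P b'"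
    using Ck A'(2) b'(2) Ck_on_imp_continuous_on by blast+
  have surj: "\<exists>v. A p v = r" if "p \<in> P" for p r
  proof -
    have "inj (blinfun_apply (A p))"
      unfolding linear_injective_0[OF bounded_linear.linear[OF blinfun.bounded_linear_right]]
      using bound[OF that] \<open>c > 0\<close> by (metis mult_le_0_iff norm_le_zero_iff norm_zero not_le)
    then have "surj (blinfun_apply (A p))"
      by (rule linear_injective_imp_surjective[OF bounded_linear.linear[OF blinfun.bounded_linear_right]]) simp
    then show ?thesis by (metis surjD)
  qed
  define r where "r = (\<lambda>w p. b' p w - A' p w (z p))"
  define zw where "zw = (\<lambda>w p. SOME v. A p v = r w p)"
  have zw: "A p (zw w p) = r w p" if "p \<in> P" for w p
    unfolding zw_def using surj[OF that] by (rule someI_ex)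
  show ?case
  proof (rule Ck_on_from_partials[OF \<open>open P\<close>, where g = zw])
    show "Ck_on k P (zw w)" for w
    proof (rule Suc.IH[OF Ck(1) _ zw])
      show "Ck_on k P (r w)"
        unfolding r_def
        by (intro Ck_on_diff Ck_on_blinfun_apply z A' b' Ck_on_const)
    qed
    show "((\<lambda>h. z (p + h *\<^sub>R w)) has_vector_derivative zw w p) (at 0)" if "p \<in> P" for w p
    proof -
      obtain \<delta> where \<delta>: "\<delta> > 0" "\<And>h. \<bar>h\<bar> < \<delta> \<Longrightarrow> p + h *\<^sub>R w \<in> P"
        using open_line_segment[OF \<open>open P\<close> \<open>p \<in> P\<close>] by metis
      let ?J = "{-\<delta><..<\<delta>}"
      define g where "g = (\<lambda>(_::real) h. b (p + h *\<^sub>R w) - A (p + h *\<^sub>R w) (z p))"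
      define g' where "g' = (\<lambda>(_::real) h. b' (p + h *\<^sub>R w) w - A' (p + h *\<^sub>R w) w (z p))"
      have line: "continuous_on S (\<lambda>h. f (p + h *\<^sub>R w))"
        if "continuous_on P f" "S \<subseteq> ?J" for S and f :: "'p \<Rightarrow> 'x::topological_space"
        by (rule continuous_on_compose2[OF that(1)]) (use that(2) in \<open>auto intro!: continuous_intros \<delta>(2) simp: subset_iff abs_less_iff\<close>)
      have der: "\<forall>t\<in>UNIV. \<forall>h\<in>?J. ((\<lambda>h. g t h) has_vector_derivative g' t h) (at h)"
        unfolding g_def g'_def
        by (intro ballI has_vector_derivative_diff
            has_vector_derivative_directional[OF b'(1)] has_vector_derivative_directional[OF A'(1)]
            bounded_linear.has_vector_derivative[OF blinfun.bounded_linear_left] \<delta>(2)) auto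
      have cont: "continuous_on (UNIV \<times> ?J) (\<lambda>(t, h). g' t h)"
      proof -
        note app = bounded_bilinear.continuous_on[OF bounded_bilinear_blinfun_apply _ continuous_on_const]
        have "continuous_on ?J (\<lambda>h. b' (p + h *\<^sub>R w) w - A' (p + h *\<^sub>R w) w (z p))"
          by (intro continuous_on_diff app line[OF contb' order_refl] line[OF contA' order_refl])
        then show ?thesis
          unfolding g'_def split_beta
          by (rule continuous_on_compose2[OF _ continuous_on_snd[OF continuous_on_id]]) auto
      qed
      note H = Hadamard_quotient[of UNIV \<delta> g g', OF der cont]
      let ?q = "\<lambda>h. integral (cbox 0 1) (\<lambda>\<theta>. g' 0 (\<theta> * h))"
      define Q where "Q = (\<lambda>h. if h = 0 then zw w p else (z (p + h *\<^sub>R w) - z p) /\<^sub>R h)"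
      have "continuous_on ?J Q"
      proof (rule linear_equation_continuous[OF line[OF contA order_refl] _ \<open>c > 0\<close>])
        have "continuous_on ?J ((\<lambda>(t, h). integral (cbox 0 1) (\<lambda>\<theta>. g' t (\<theta> * h))) \<circ> (\<lambda>h. (0, h)))"
          by (intro continuous_on_compose continuous_on_subset[OF H(1)] continuous_intros) auto
        then show "continuous_on ?J ?q" by (simp add: o_def)
        show "c * norm v \<le> norm (A (p + h *\<^sub>R w) v)" if "h \<in> ?J" for h v
          using that by (intro bound \<delta>(2)) auto
        show "A (p + h *\<^sub>R w) (Q h) = ?q h" if "h \<in> ?J" for h
        proof -
          have h: "\<bar>h\<bar> < \<delta>" using that by auto
          show ?thesis
        proof (cases "h = 0")
          case True
          then show ?thesis using H(3)[of "0"] zw[OF \<open>p \<in> P\<close>, of w] by (simp add: Q_def r_def g'_def)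
        next
          case False
          have "h *\<^sub>R A (p + h *\<^sub>R w) (Q h) = A (p + h *\<^sub>R w) (z (p + h *\<^sub>R w)) - A (p + h *\<^sub>R w) (z p)"
            using False by (simp add: Q_def blinfun.bilinear_simps)
          also have "\<dots> = g 0 h - g 0 0"
            using Suc.prems(3)[OF \<delta>(2)[OF h]] Suc.prems(3)[OF \<open>p \<in> P\<close>] by (simp add: g_def)
          also have "\<dots> = h *\<^sub>R ?q h" using H(2)[OF UNIV_I h] .
          finally show ?thesis using False by simp
        qed
        qed
      qed
      then have "((\<lambda>h. z (p + h *\<^sub>R w)) has_vector_derivative Q 0) (at 0)"
        by (rule has_vector_derivative_at_0_from_quotient[OF \<delta>(1)]) (auto simp: Q_def)
      then show ?thesis by (simp add: Q_def)
    qed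
  qed
qed

lemma smooth_on_openE:
  fixes f :: "'a::euclidean_space \<Rightarrow> 'b::real_normed_vector"
  assumes "open U" "smooth_on U f"
  obtains F :: "'a \<Rightarrow> 'a \<Rightarrow>\<^sub>L 'b" where
    "\<And>x. x \<in> U \<Longrightarrow> (f has_derivative blinfun_apply (F x)) (at x)" "\<And>k. Ck_on k U F"
proof -
  have Ck: "Ck_on k U f" for k using assms(2) by (simp add: smooth_on_def)
  obtain F where F0: "\<And>x. x \<in> U \<Longrightarrow> (f has_derivative blinfun_apply (F x)) (at x within U)" "Ck_on 0 U F"
    using Ck_on_SucE[OF Ck[of "Suc 0"]] by blast
  have F: "(f has_derivative blinfun_apply (F x)) (at x)" if "x \<in> U" for x
    using F0(1)[OF that] at_within_open[OF that \<open>open U\<close>] by simp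
  have CkF: "Ck_on k U F" for k
  proof -
    obtain F' where F': "\<And>x. x \<in> U \<Longrightarrow> (f has_derivative blinfun_apply (F' x)) (at x within U)" "Ck_on k U F'"
      using Ck_on_SucE[OF Ck[of "Suc k"]] by blast
    have "F' x = F x" if "x \<in> U" for x
      using F'(1)[OF that] F[OF that] at_within_open[OF that \<open>open U\<close>]
      by (intro blinfun_eqI) (metis has_derivative_unique)
    then show ?thesis using F'(2) Ck_on_cong[of U F' F] by blast
  qed
  show ?thesis by (rule that[OF F CkF])
qed

text \<open>
  The value of the derivative of the inverse map \<open>g\<close> on a vector \<open>v\<close> solves the linear equation with
  operator \<open>F (g y)\<close> and right hand side \<open>v\<close>. So if \<open>g\<close> is \<open>C^k\<close>, its derivative is \<open>C^k\<close> too.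
\<close>

lemma smooth_inverse_function:
  fixes f :: "'e::euclidean_space \<Rightarrow> 'e"
  assumes "open U" "smooth_on U f" "x0 \<in> U" "(f has_derivative (\<lambda>v. v)) (at x0)"
  obtains U' V g where "open U'" "x0 \<in> U'" "U' \<subseteq> U" "open V" "f ` U' = V" "g ` V = U'"
    "\<And>x. x \<in> U' \<Longrightarrow> g (f x) = x" "\<And>y. y \<in> V \<Longrightarrow> f (g y) = y" "smooth_on V g"
proof -
  obtain F where F: "\<And>x. x \<in> U \<Longrightarrow> (f has_derivative blinfun_apply (F x)) (at x)" and CkF: "\<And>k. Ck_on k U F"
    by (rule smooth_on_openE[OF assms(1,2)], rule that)
  have contF: "continuous_on U F" by (rule Ck_on_imp_continuous_on[OF CkF[of 0]])
  have Fx0: "F x0 = id_blinfun"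
    using has_derivative_unique[OF F[OF assms(3)] assms(4)] by (intro blinfun_eqI) simp
  \<comment> \<open>close to \<open>x0\<close>, the derivative is so near the identity that it shrinks no vector by more than half\<close>
  define W where "W = {x\<in>U. norm (F x - id_blinfun) < 1 / 2}"
  have "open W"
  proof -
    have "W = U \<inter> (\<lambda>x. norm (F x - id_blinfun)) -` {..<1/2}" by (auto simp: W_def)
    moreover have "continuous_on U (\<lambda>x. norm (F x - id_blinfun))"
      using contF by (intro continuous_intros)
    ultimately show ?thesis
      using continuous_open_preimage[OF _ \<open>open U\<close> open_lessThan] by simp
  qed
  have "x0 \<in> W" using assms(3) by (simp add: W_def Fx0)
  have "W \<subseteq> U" by (auto simp: W_def)
  obtain U' V g g' where g: "open U'" "U' \<subseteq> W" "x0 \<in> U'" "open V" "f x0 \<in> V" "homeomorphism U' V f g"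
    "\<And>y. y \<in> V \<Longrightarrow> (g has_derivative (g' y)) (at y)"
    "\<And>y. y \<in> V \<Longrightarrow> g' y = inv (blinfun_apply (F (g y)))"
    "\<And>y. y \<in> V \<Longrightarrow> bij (blinfun_apply (F (g y)))"
  proof (rule inverse_function_theorem[OF \<open>open W\<close> _ continuous_on_subset[OF contF \<open>W \<subseteq> U\<close>] \<open>x0 \<in> W\<close>])
    show "(f has_derivative blinfun_apply (F x)) (at x)" if "x \<in> W" for x
      using that F \<open>W \<subseteq> U\<close> by blast
    show "id_blinfun o\<^sub>L F x0 = id_blinfun" by (simp add: Fx0 blinfun_eqI)
  qed (rule that)
  have gV: "g y \<in> W" "g y \<in> U" if "y \<in> V" for y
    using g(2,6) \<open>W \<subseteq> U\<close> that by (auto simp: homeomorphism_def)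
  have Ckg: "Ck_on k V g" for k
  proof (induction k)
    case 0
    then show ?case using g(6) by (simp add: homeomorphism_def)
  next
    case (Suc k)
    have "Ck_on k V (\<lambda>y. g' y v)" for v
    proof (rule linear_equation_Ck[where A = "\<lambda>y. F (g y)" and b = "\<lambda>_. v" and c = "1/2"])
      show "1 / 2 * norm w \<le> norm (F (g y) w)" if "y \<in> V" for y w
      proof -
        have "norm ((F (g y) - id_blinfun) w) \<le> norm (F (g y) - id_blinfun) * norm w"
          by (rule norm_blinfun)
        also have "\<dots> \<le> 1 / 2 * norm w"
          using gV(1)[OF that] by (intro mult_right_mono) (auto simp: W_def)
        finally have "norm (F (g y) w - w) \<le> 1 / 2 * norm w" by (simp add: blinfun.bilinear_simps)
        then show ?thesis using norm_triangle_ineq2[of w "F (g y) w"] norm_minus_commute[of w "F (g y) w"] by simp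
      qed
      show "Ck_on k V (\<lambda>y. F (g y))"
        by (rule Ck_on_compose[OF Suc.IH CkF]) (use gV in auto)
      show "F (g y) (g' y v) = v" if "y \<in> V" for y
        using g(8,9)[OF that] by (simp add: bij_is_surj surj_f_inv_f)
    qed (use g Ck_on_const in auto)
    moreover have "\<forall>y\<in>V. (g has_derivative g' y) (at y within V)"
      using g(7) has_derivative_at_withinI by blast
    ultimately show ?case by (intro Ck_on_SucI_pointwise[of _ _ g']) simp_all
  qed
  show ?thesis
  proof (rule that[OF g(1,3) _ g(4), of g])
    show "U' \<subseteq> U" using g(2) \<open>W \<subseteq> U\<close> by blast
    show "smooth_on V g" using Ckg by (simp add: smooth_on_def)
  qed (use g(6) in \<open>simp_all add: homeomorphism_def\<close>)
qed

section \<open>Smooth dependence of solutions of differential equations on initial values\<close>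

text \<open>
  All equations are considered on symmetric time intervals that are short with respect to the
  Lipschitz constant \<open>L\<close> of the right hand side: the product is at most \<open>1 / 2\<close>. Then Gronwall's
  inequality and the contraction property of the Picard operator both follow from the mean value
  inequality.
\<close>

lemma derivative_bound_symmetric_interval:
  fixes w :: "real \<Rightarrow> 'e::real_normed_vector"
  assumes der: "\<And>t. t \<in> {-\<tau>..\<tau>} \<Longrightarrow> (w has_vector_derivative w' t) (at t within {-\<tau>..\<tau>})"
    and B: "\<And>t. t \<in> {-\<tau>..\<tau>} \<Longrightarrow> norm (w' t) \<le> B"
    and t: "t \<in> {-\<tau>..\<tau>}"
  shows "norm (w t - w 0) \<le> \<tau> * B"
proof -
  have "0 \<in> {-\<tau>..\<tau>}" "0 \<le> B" using t B[OF t] norm_ge_zero order_trans by (auto, blast)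
  have "norm (w t - w 0) \<le> B * norm (t - 0)"
  proof (rule differentiable_bound[of "{-\<tau>..\<tau>}" w "\<lambda>s h. h *\<^sub>R w' s"])
    show "(w has_derivative (\<lambda>h. h *\<^sub>R w' s)) (at s within {-\<tau>..\<tau>})" if "s \<in> {-\<tau>..\<tau>}" for s
      using der[OF that] by (simp add: has_vector_derivative_def)
    show "onorm (\<lambda>h. h *\<^sub>R w' s) \<le> B" if "s \<in> {-\<tau>..\<tau>}" for s
      using B[OF that] by (intro onorm_le) (simp add: mult.commute[of B] mult_left_mono)
  qed (use t \<open>0 \<in> {-\<tau>..\<tau>}\<close> in auto)
  also have "\<dots> \<le> B * \<tau>" using t \<open>0 \<le> B\<close> by (intro mult_left_mono) auto
  finally show ?thesis by (simp add: mult.commute)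
qed

text \<open>
  At a point where \<open>norm (w s)\<close> is maximal, the mean value inequality bounds it by
  \<open>norm (w 0) + \<tau> * \<eta>\<close> and at most half of itself.
\<close>

lemma short_time_Gronwall:
  fixes w :: "real \<Rightarrow> 'e::real_normed_vector"
  assumes der: "\<And>t. t \<in> {-\<tau>..\<tau>} \<Longrightarrow> (w has_vector_derivative w' t) (at t within {-\<tau>..\<tau>})"
    and B: "\<And>t. t \<in> {-\<tau>..\<tau>} \<Longrightarrow> norm (w' t) \<le> L * norm (w t) + \<eta>"
    and "\<tau> * L \<le> 1 / 2" "0 \<le> L"
    and t: "t \<in> {-\<tau>..\<tau>}"
  shows "norm (w t) \<le> 2 * (norm (w 0) + \<tau> * \<eta>)"
proof -
  have "continuous_on {-\<tau>..\<tau>} w"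
    using der has_vector_derivative_continuous unfolding continuous_on_eq_continuous_within by blast
  then have "continuous_on {-\<tau>..\<tau>} (\<lambda>s. norm (w s))" by (rule continuous_on_norm)
  then obtain s where s: "s \<in> {-\<tau>..\<tau>}" "\<And>u. u \<in> {-\<tau>..\<tau>} \<Longrightarrow> norm (w u) \<le> norm (w s)"
    using continuous_attains_sup[of "{-\<tau>..\<tau>}" "\<lambda>s. norm (w s)"] t by (metis compact_Icc empty_iff)
  have "norm (w s - w 0) \<le> \<tau> * (L * norm (w s) + \<eta>)"
  proof (rule derivative_bound_symmetric_interval[OF der _ s(1)])
    show "norm (w' u) \<le> L * norm (w s) + \<eta>" if "u \<in> {-\<tau>..\<tau>}" for u
      using B[OF that] mult_left_mono[OF s(2)[OF that] \<open>0 \<le> L\<close>] by linarith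
  qed
  also have "\<dots> = (\<tau> * L) * norm (w s) + \<tau> * \<eta>" by (simp add: algebra_simps)
  also have "\<dots> \<le> 1 / 2 * norm (w s) + \<tau> * \<eta>"
    using assms(3) by (intro add_right_mono mult_right_mono) auto
  finally have "norm (w s) \<le> 2 * (norm (w 0) + \<tau> * \<eta>)"
    using norm_triangle_ineq2[of "w s" "w 0"] unfolding distrib_left by linarith
  then show ?thesis using s(2)[OF t] by linarith
qed

text \<open>
  Picard iteration. To work in the complete space of bounded continuous functions on the whole line,
  the integral curve is continued by constants beyond the ends of the interval.
\<close>

lemma ODE_exists:
  fixes F :: "real \<Rightarrow> 'e::euclidean_space \<Rightarrow> 'e"
  assumes "0 \<le> \<epsilon>" "\<epsilon> * L \<le> 1 / 2"
    and cont: "continuous_on ({-\<epsilon>..\<epsilon>} \<times> UNIV) (\<lambda>(t, y). F t y)"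
    and lip: "\<And>t y y'. t \<in> {-\<epsilon>..\<epsilon>} \<Longrightarrow> norm (F t y - F t y') \<le> L * norm (y - y')"
  shows "\<exists>y. y 0 = x \<and> (\<forall>t\<in>{-\<epsilon>..\<epsilon>}. (y has_vector_derivative F t (y t)) (at t within {-\<epsilon>..\<epsilon>}))"
proof -
  let ?K = "{-\<epsilon>..\<epsilon>}"
  \<comment> \<open>the integral from \<open>0\<close> to \<open>t\<close>, written so that it makes sense for both signs of \<open>t\<close>\<close>
  define I where "I = (\<lambda>(u :: real \<Rightarrow>\<^sub>C 'e) t. x + integral {-\<epsilon>..t} (\<lambda>s. F s (u s)) - integral {-\<epsilon>..0} (\<lambda>s. F s (u s)))"
  have L0: "0 \<le> L * norm (y - y')" for y y' :: 'e
    using order_trans[OF norm_ge_zero lip[of 0 y y']] \<open>0 \<le> \<epsilon>\<close> by simp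
  have contu: "continuous_on ?K (\<lambda>s. F s (u s))" for u :: "real \<Rightarrow>\<^sub>C 'e"
  proof -
    have "continuous_on ?K (\<lambda>s. case (s, u s) of (t, y) \<Rightarrow> F t y)"
      by (rule continuous_on_compose2[OF cont]) (auto intro!: continuous_intros)
    then show ?thesis by simp
  qed
  have derI: "(I u has_vector_derivative F t (u t)) (at t within ?K)" if "t \<in> ?K" for u t
    unfolding I_def
    by (rule has_vector_derivative_eq_rhs,
        rule has_vector_derivative_diff[OF has_vector_derivative_add[OF has_vector_derivative_const
            integral_has_vector_derivative[OF contu that]] has_vector_derivative_const]) simp
  have "\<exists>g :: real \<Rightarrow>\<^sub>C 'e. \<forall>t. g t = I u (clamp (-\<epsilon>) \<epsilon> t)" for u
  proof -
    have "continuous_on (cbox (-\<epsilon>) \<epsilon>) (I u)"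
      using derI has_vector_derivative_continuous
      unfolding cbox_interval continuous_on_eq_continuous_within by blast
    from continuous_on_cbox_bcontfunE[OF this] show ?thesis by metis
  qed
  then obtain T :: "(real \<Rightarrow>\<^sub>C 'e) \<Rightarrow> (real \<Rightarrow>\<^sub>C 'e)" where T: "\<And>u t. T u t = I u (clamp (-\<epsilon>) \<epsilon> t)"
    by metis
  have "dist (T u) (T v) \<le> 1 / 2 * dist u v" for u v
  proof (rule dist_bound)
    fix t
    let ?t = "clamp (-\<epsilon>) \<epsilon> t"
    have t: "?t \<in> ?K" using clamp_in_interval[of "-\<epsilon>" \<epsilon> t] \<open>0 \<le> \<epsilon>\<close> by simp
    have lip': "norm (F s (u s) - F s (v s)) \<le> L * dist u v" if "s \<in> ?K" for s
    proof (cases "u s = v s")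
      case True
      obtain a :: 'e where "norm a = 1" using vector_choose_size[of 1] by auto
      then have "0 \<le> L" using L0[of a 0] by simp
      then show ?thesis using True by simp
    next
      case False
      then have "0 \<le> L" using L0[of "u s" "v s"] by (simp add: zero_le_mult_iff)
      have "norm (F s (u s) - F s (v s)) \<le> L * norm (u s - v s)" by (rule lip[OF that])
      also have "\<dots> \<le> L * dist u v"
        using dist_bounded[of u s v] \<open>0 \<le> L\<close> by (intro mult_left_mono) (auto simp: dist_norm)
      finally show ?thesis .
    qed
    have "norm ((I u ?t - I v ?t) - (I u 0 - I v 0)) \<le> \<epsilon> * (L * dist u v)"
      by (rule derivative_bound_symmetric_interval[where w' = "\<lambda>s. F s (u s) - F s (v s)"])
        (use t lip' derI in \<open>auto intro!: has_vector_derivative_diff\<close>)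
    moreover have "I u 0 = x" for u by (simp add: I_def)
    ultimately have "norm (I u ?t - I v ?t) \<le> (\<epsilon> * L) * dist u v" by simp
    also have "\<dots> \<le> 1 / 2 * dist u v" using assms(2) by (intro mult_right_mono) auto
    finally show "dist (T u t) (T v t) \<le> 1 / 2 * dist u v" by (simp add: T dist_norm)
  qed
  then have "\<exists>!u. T u = u" by (intro banach_fix_type[of "1/2"]) auto
  then obtain u where u: "T u = u" by blast
  have uI: "u t = I u t" if "t \<in> ?K" for t
    using T[of u t] that by (simp add: u)
  have "(u has_vector_derivative F t (u t)) (at t within ?K)" if "t \<in> ?K" for t
    by (rule has_vector_derivative_transform[OF that _ derI[OF that, of u]]) (simp add: uI)
  moreover have "u 0 = x" using uI[of 0] \<open>0 \<le> \<epsilon>\<close> by (simp add: I_def)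
  ultimately show ?thesis by blast
qed

text \<open>
  The difference of the solutions for \<open>p\<close> and \<open>p0\<close> solves the equation for \<open>p\<close> with an inhomogeneity
  that, by compactness of the time interval, tends to \<open>0\<close> uniformly in time as \<open>p\<close> tends to \<open>p0\<close>.
  The parameter space is arbitrary because the increment of a difference quotient will be a
  parameter as well.
\<close>

lemma linear_ODE_continuous:
  fixes A :: "real \<times> 'p::topological_space \<Rightarrow> 'e::euclidean_space \<Rightarrow>\<^sub>L 'e"
  defines "K \<equiv> \<lambda>\<tau>::real. {-\<tau>..\<tau>}"
  assumes "0 \<le> \<tau>" "\<tau> * L \<le> 1 / 2" "0 \<le> L"
    and A: "continuous_on (K \<tau> \<times> P) A" and b: "continuous_on (K \<tau> \<times> P) b"
    and c: "continuous_on P (\<lambda>p. z (0, p))"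
    and bound: "\<And>t p. t \<in> K \<tau> \<Longrightarrow> p \<in> P \<Longrightarrow> norm (A (t, p)) \<le> L"
    and ode: "\<And>t p. t \<in> K \<tau> \<Longrightarrow> p \<in> P \<Longrightarrow>
      ((\<lambda>s. z (s, p)) has_vector_derivative A (t, p) (z (t, p)) + b (t, p)) (at t within K \<tau>)"
  shows "continuous_on (K \<tau> \<times> P) z"
  unfolding continuous_on_def
proof (intro ballI tendstoI)
  fix q0 :: "real \<times> 'p" and e :: real
  assume "q0 \<in> K \<tau> \<times> P" "0 < e"
  then obtain t0 p0 where q0: "q0 = (t0, p0)" "t0 \<in> K \<tau>" "p0 \<in> P" by auto
  have K0: "0 \<in> K \<tau>" using \<open>0 \<le> \<tau>\<close> by (simp add: K_def)
  have zp: "continuous_on (K \<tau>) (\<lambda>s. z (s, p0))"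
    using ode[OF _ \<open>p0 \<in> P\<close>] has_vector_derivative_continuous
    unfolding continuous_on_eq_continuous_within by blast
  define \<phi> where "\<phi> = (\<lambda>(p, t). A (t, p) (z (t, p0)) + b (t, p))"
  have swap: "continuous_on (P \<times> K \<tau>) (\<lambda>x. g (snd x, fst x))"
    if "continuous_on (K \<tau> \<times> P) g" for g :: "real \<times> 'p \<Rightarrow> 'x::topological_space"
    by (rule continuous_on_compose2[OF that]) (auto intro!: continuous_intros)
  have "continuous_on (P \<times> K \<tau>) (\<lambda>x. A (snd x, fst x) (z (snd x, p0)) + b (snd x, fst x))"
    by (intro continuous_on_add bounded_bilinear.continuous_on[OF bounded_bilinear_blinfun_apply] swap A b
        continuous_on_compose2[OF zp continuous_on_snd[OF continuous_on_id]]) auto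
  then have "continuous_on (P \<times> K \<tau>) \<phi>" by (simp add: \<phi>_def split_beta')
  moreover have "compact (K \<tau>)" by (simp add: K_def)
  define e' where "e' = e / 4 / (1 + \<tau>)"
  have "0 < 1 + \<tau>" using \<open>0 \<le> \<tau>\<close> by simp
  then have "e' * (1 + \<tau>) = e / 4" unfolding e'_def by (subst nonzero_eq_divide_eq[symmetric]) auto
  then have e': "0 < e'" "2 * (e' + \<tau> * e') \<le> e / 2"
    using \<open>0 < e\<close> \<open>0 < 1 + \<tau>\<close> by (simp add: e'_def, simp add: algebra_simps)
  ultimately obtain X where X: "p0 \<in> X" "open X" "\<forall>p\<in>X \<inter> P. \<forall>t\<in>K \<tau>. dist (\<phi> (p, t)) (\<phi> (p0, t)) \<le> e'"
    using continuous_on_prod_compactE[of P "K \<tau>" \<phi> p0 e'] \<open>compact (K \<tau>)\<close> \<open>p0 \<in> P\<close> by metis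
  let ?F = "at q0 within K \<tau> \<times> P"
  have "((\<lambda>q. z (0, snd q)) \<longlongrightarrow> z (0, snd q0)) ?F"
    using continuous_on_compose2[OF c continuous_on_snd[OF continuous_on_id], of "K \<tau> \<times> P"] q0
    unfolding continuous_on_def by auto
  then have E1: "\<forall>\<^sub>F q in ?F. dist (z (0, snd q)) (z (0, p0)) < e'"
    using tendstoD[OF _ \<open>0 < e'\<close>] q0 by fastforce
  have "((\<lambda>q. z (fst q, p0)) \<longlongrightarrow> z (fst q0, p0)) ?F"
    using continuous_on_compose2[OF zp continuous_on_fst[OF continuous_on_id], of "K \<tau> \<times> P"] q0
    unfolding continuous_on_def by auto
  then have E2: "\<forall>\<^sub>F q in ?F. dist (z (fst q, p0)) (z (t0, p0)) < e / 2"
    using tendstoD[of _ _ _ "e / 2"] q0 \<open>0 < e\<close> by fastforce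
  have E3: "\<forall>\<^sub>F q in ?F. snd q \<in> X"
    using topological_tendstoD[OF tendsto_snd[OF tendsto_ident_at], of X q0 "K \<tau> \<times> P"] X q0 by auto
  have E4: "\<forall>\<^sub>F q in ?F. q \<in> K \<tau> \<times> P"
    by (simp add: eventually_at_filter)
  show "\<forall>\<^sub>F q in ?F. dist (z q) (z q0) < e"
    using E1 E2 E3 E4
  proof eventually_elim
    case (elim q)
    obtain t p where q: "q = (t, p)" by fastforce
    with elim have t: "t \<in> K \<tau>" and p: "p \<in> P" "p \<in> X" by auto
    have "norm (z (t, p) - z (t, p0)) \<le> 2 * (norm (z (0, p) - z (0, p0)) + \<tau> * e')"
    proof (rule short_time_Gronwall[where w = "\<lambda>t. z (t, p) - z (t, p0)"
            and w' = "\<lambda>t. (A (t, p) (z (t, p)) + b (t, p)) - (A (t, p0) (z (t, p0)) + b (t, p0))"])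
      fix s assume "s \<in> {-\<tau>..\<tau>}"
      then have s: "s \<in> K \<tau>" by (simp add: K_def)
      show "((\<lambda>t. z (t, p) - z (t, p0)) has_vector_derivative
          (A (s, p) (z (s, p)) + b (s, p)) - (A (s, p0) (z (s, p0)) + b (s, p0))) (at s within {-\<tau>..\<tau>})"
        using has_vector_derivative_diff[OF ode[OF s p(1)] ode[OF s q0(3)]] by (simp add: K_def)
      have "(A (s, p) (z (s, p)) + b (s, p)) - (A (s, p0) (z (s, p0)) + b (s, p0))
          = A (s, p) (z (s, p) - z (s, p0)) + (\<phi> (p, s) - \<phi> (p0, s))"
        by (simp add: \<phi>_def blinfun.bilinear_simps)
      moreover have "norm (A (s, p) (z (s, p) - z (s, p0))) \<le> L * norm (z (s, p) - z (s, p0))"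
        by (rule order_trans[OF norm_blinfun mult_right_mono[OF bound[OF s p(1)]]]) simp
      moreover have "norm (\<phi> (p, s) - \<phi> (p0, s)) \<le> e'"
        using X(3) p s by (auto simp: dist_norm)
      ultimately show "norm ((A (s, p) (z (s, p)) + b (s, p)) - (A (s, p0) (z (s, p0)) + b (s, p0)))
          \<le> L * norm (z (s, p) - z (s, p0)) + e'"
        using norm_triangle_mono by metis
    qed (use assms(3,4) t in \<open>auto simp: K_def\<close>)
    also have "\<dots> \<le> 2 * (e' + \<tau> * e')"
      using elim(1) q by (simp add: dist_norm)
    also have "\<dots> \<le> e / 2" by (rule e')
    finally have "dist (z (t, p)) (z (t, p0)) \<le> e / 2" by (simp add: dist_norm)
    moreover have "dist (z (t, p0)) (z (t0, p0)) < e / 2" using elim(2) q by simp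
    ultimately show ?case
      using dist_triangle[of "z (t, p)" "z (t0, p0)" "z (t, p0)"] by (simp add: q q0)
  qed
qed

lemma Ck_on_from_time_and_space:
  fixes z :: "real \<times> 'p::euclidean_space \<Rightarrow> 'e::real_normed_vector"
  assumes "open P"
    and zt: "Ck_on k ({-\<tau><..<\<tau>} \<times> P) zt" and zw: "\<And>w. Ck_on k ({-\<tau><..<\<tau>} \<times> P) (zw w)"
    and der_t: "\<And>t p. \<bar>t\<bar> < \<tau> \<Longrightarrow> p \<in> P \<Longrightarrow> ((\<lambda>s. z (s, p)) has_vector_derivative zt (t, p)) (at t)"
    and der_w: "\<And>t p w. \<bar>t\<bar> < \<tau> \<Longrightarrow> p \<in> P \<Longrightarrow> ((\<lambda>h. z (t, p + h *\<^sub>R w)) has_vector_derivative zw w (t, p)) (at 0)"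
  shows "Ck_on (Suc k) ({-\<tau><..<\<tau>} \<times> P) z"
proof (rule Ck_on_from_partials[where g = "\<lambda>(a, w). if w = 0 then zt else zw w"])
  show "open ({-\<tau><..<\<tau>} \<times> P)" by (intro open_Times \<open>open P\<close>) auto
  fix v :: "real \<times> 'p" assume v: "v \<in> Basis"
  show "Ck_on k ({-\<tau><..<\<tau>} \<times> P) ((\<lambda>(a, w). if w = 0 then zt else zw w) v)"
    using zt zw by (simp add: split_beta)
  fix q assume "q \<in> {-\<tau><..<\<tau>} \<times> P"
  then obtain t p where q: "q = (t, p)" "\<bar>t\<bar> < \<tau>" "p \<in> P" by auto
  show "((\<lambda>h. z (q + h *\<^sub>R v)) has_vector_derivative (\<lambda>(a, w). if w = 0 then zt else zw w) v q) (at 0)"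
  proof (cases "snd v = 0")
    case True
    then have v1: "v = (1, 0)" using v by (auto simp: Basis_prod_def)
    have "((\<lambda>s. z (s, p)) \<circ> (\<lambda>h. t + h) has_vector_derivative 1 *\<^sub>R zt (t, p)) (at 0)"
    proof (rule vector_diff_chain_at)
      show "((\<lambda>h. t + h) has_vector_derivative 1) (at 0)" by (auto intro!: derivative_eq_intros)
      show "((\<lambda>s. z (s, p)) has_vector_derivative zt (t, p)) (at (t + 0))" using der_t[OF q(2,3)] by simp
    qed
    then have "((\<lambda>h. z ((t, p) + h *\<^sub>R (1, 0))) has_vector_derivative zt (t, p)) (at 0)"
      by (simp add: o_def)
    then show ?thesis unfolding v1 q(1) prod.case if_P[OF refl] .
  next
    case False
    define w where "w = snd v"
    have "fst v = 0" using v False by (auto simp: Basis_prod_def)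
    then have w: "v = (0, w)" "w \<noteq> 0" using False by (simp_all add: w_def prod_eq_iff)
    have "((\<lambda>h. z ((t, p) + h *\<^sub>R (0, w))) has_vector_derivative zw w (t, p)) (at 0)"
      using der_w[OF q(2,3), of w] by simp
    then show ?thesis unfolding w(1) q(1) prod.case if_not_P[OF w(2)] .
  qed
qed

lemma linear_ODE_exists:
  fixes A :: "real \<Rightarrow> 'e::euclidean_space \<Rightarrow>\<^sub>L 'e"
  assumes "0 \<le> \<epsilon>" "\<epsilon> * L \<le> 1 / 2"
    and A: "continuous_on {-\<epsilon>..\<epsilon>} A" and b: "continuous_on {-\<epsilon>..\<epsilon>} b"
    and bound: "\<And>t. t \<in> {-\<epsilon>..\<epsilon>} \<Longrightarrow> norm (A t) \<le> L"
  shows "\<exists>y. y 0 = x \<and> (\<forall>t\<in>{-\<epsilon>..\<epsilon>}. (y has_vector_derivative A t (y t) + b t) (at t within {-\<epsilon>..\<epsilon>}))"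
proof (rule ODE_exists[OF assms(1,2)])
  show "continuous_on ({-\<epsilon>..\<epsilon>} \<times> UNIV) (\<lambda>(t, y). A t y + b t)"
    unfolding split_beta
    by (intro continuous_on_add bounded_bilinear.continuous_on[OF bounded_bilinear_blinfun_apply]
        continuous_on_compose2[OF A continuous_on_fst[OF continuous_on_id]]
        continuous_on_compose2[OF b continuous_on_fst[OF continuous_on_id]]
        continuous_on_snd continuous_on_id) auto
  show "norm (A t y + b t - (A t y' + b t)) \<le> L * norm (y - y')" if "t \<in> {-\<epsilon>..\<epsilon>}" for t y y'
  proof -
    have "norm (A t (y - y')) \<le> L * norm (y - y')"
      by (rule order_trans[OF norm_blinfun mult_right_mono[OF bound[OF that]]]) simp
    then show ?thesis by (simp add: blinfun.bilinear_simps)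
  qed
qed

text \<open>
  The derivative of the solution in a parameter direction solves the equation with the same operator
  \<open>A\<close>, which keeps the induction on \<open>k\<close> within linear equations on the same space. The solution of
  that equation is constructed on compact time intervals, and so the time interval shrinks by an
  arbitrarily small amount at each step.
\<close>

lemma linear_ODE_Ck:
  fixes A :: "real \<times> 'p::euclidean_space \<Rightarrow> 'e::euclidean_space \<Rightarrow>\<^sub>L 'e"
  assumes "open P" "0 \<le> L"
  shows "\<epsilon> * L \<le> 1 / 2 \<Longrightarrow> 0 < \<tau> \<Longrightarrow> \<tau> < \<epsilon> \<Longrightarrow>
    (\<And>q. q \<in> {-\<epsilon><..<\<epsilon>} \<times> P \<Longrightarrow> norm (A q) \<le> L) \<Longrightarrow>
    Ck_on k ({-\<epsilon><..<\<epsilon>} \<times> P) A \<Longrightarrow> Ck_on k ({-\<epsilon><..<\<epsilon>} \<times> P) b \<Longrightarrow> Ck_on k P (\<lambda>p. z (0, p)) \<Longrightarrow>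
    (\<And>t p. \<bar>t\<bar> < \<epsilon> \<Longrightarrow> p \<in> P \<Longrightarrow>
      ((\<lambda>s. z (s, p)) has_vector_derivative A (t, p) (z (t, p)) + b (t, p)) (at t)) \<Longrightarrow>
    Ck_on k ({-\<tau><..<\<tau>} \<times> P) z"
proof (induction k arbitrary: b z \<epsilon> \<tau>)
  case (0 b z \<epsilon> \<tau>)
  have sub: "{-\<tau>..\<tau>} \<times> P \<subseteq> {-\<epsilon><..<\<epsilon>} \<times> P" using 0(3) by auto
  have "continuous_on ({-\<tau>..\<tau>} \<times> P) z"
  proof (rule linear_ODE_continuous[where A = A and b = b and L = L and z = z and P = P])
    show "\<tau> * L \<le> 1 / 2"
      by (rule order_trans[OF mult_right_mono 0(1)]) (use 0(3) \<open>0 \<le> L\<close> in simp_all)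
    show "((\<lambda>s. z (s, p)) has_vector_derivative A (t, p) (z (t, p)) + b (t, p)) (at t within {-\<tau>..\<tau>})"
      if "t \<in> {-\<tau>..\<tau>}" "p \<in> P" for t p
      by (rule has_vector_derivative_at_within, rule 0(8)) (use that 0(3) in auto)
    show "norm (A (t, p)) \<le> L" if "t \<in> {-\<tau>..\<tau>}" "p \<in> P" for t p
      by (rule 0(4)) (use that 0(3) in auto)
    show "continuous_on ({-\<tau>..\<tau>} \<times> P) A" "continuous_on ({-\<tau>..\<tau>} \<times> P) b"
      using 0(5,6) continuous_on_subset[OF _ sub] by auto
  qed (use 0(2,7) \<open>0 \<le> L\<close> in auto)
  then show ?case by (auto elim: continuous_on_subset)
next
  case (Suc k b z \<epsilon> \<tau>)
  obtain \<tau>' where \<tau>': "\<tau> < \<tau>'" "\<tau>' < \<epsilon>" using dense[OF Suc.prems(3)] by blast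
  obtain \<tau>'' where \<tau>'': "\<tau>' < \<tau>''" "\<tau>'' < \<epsilon>" using dense[OF \<tau>'(2)] by blast
  have \<tau>: "0 < \<tau>" "\<tau> < \<tau>'" "\<tau>' < \<tau>''" "\<tau>'' < \<epsilon>" "0 < \<tau>'" "0 < \<tau>''" "\<tau>' < \<epsilon>"
    using Suc.prems(2) \<tau>' \<tau>'' by auto
  let ?I = "\<lambda>\<epsilon>::real. {-\<epsilon><..<\<epsilon>}" and ?K = "{-\<tau>'..\<tau>'}"
  have oI: "open (?I \<epsilon> \<times> P)" for \<epsilon> by (intro open_Times \<open>open P\<close>) auto
  have Kin: "t \<in> ?I \<tau>''" "t \<in> ?I \<epsilon>" "\<bar>t\<bar> < \<epsilon>" if "t \<in> ?K" for t using that \<tau> by auto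
  have L': "\<tau>' * L \<le> 1 / 2"
    by (rule order_trans[OF mult_right_mono Suc.prems(1)]) (use \<tau> \<open>0 \<le> L\<close> in simp_all)
  note bound = Suc.prems(4) and ode = Suc.prems(8)
  have Ck: "Ck_on k (?I \<epsilon> \<times> P) A" "Ck_on k (?I \<epsilon> \<times> P) b" "Ck_on k P (\<lambda>p. z (0, p))"
    using Suc.prems(5-7) Ck_on_SucD by blast+
  have z: "Ck_on k (?I \<tau>'' \<times> P) z"
    by (rule Suc.IH[OF Suc.prems(1) \<tau>(6) \<tau>(4) bound Ck ode])
  obtain A' where A': "\<And>q. q \<in> ?I \<epsilon> \<times> P \<Longrightarrow> (A has_derivative blinfun_apply (A' q)) (at q)" "Ck_on k (?I \<epsilon> \<times> P) A'"
    using Ck_on_SucE[OF Suc.prems(5)] by (metis at_within_open[OF _ oI])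
  obtain b' where b': "\<And>q. q \<in> ?I \<epsilon> \<times> P \<Longrightarrow> (b has_derivative blinfun_apply (b' q)) (at q)" "Ck_on k (?I \<epsilon> \<times> P) b'"
    using Ck_on_SucE[OF Suc.prems(6)] by (metis at_within_open[OF _ oI])
  obtain c' where c': "\<And>p. p \<in> P \<Longrightarrow> ((\<lambda>p. z (0, p)) has_derivative blinfun_apply (c' p)) (at p)" "Ck_on k P c'"
    using Ck_on_SucE[OF Suc.prems(7)] by (metis at_within_open[OF _ \<open>open P\<close>])
  have sub'': "?I \<tau>'' \<times> P \<subseteq> ?I \<epsilon> \<times> P" "?I \<tau>' \<times> P \<subseteq> ?I \<tau>'' \<times> P" "?I \<tau>' \<times> P \<subseteq> ?I \<epsilon> \<times> P"
    "?I \<tau> \<times> P \<subseteq> ?I \<tau>'' \<times> P" "?I \<tau> \<times> P \<subseteq> ?I \<epsilon> \<times> P"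
    using \<tau> by auto
  \<comment> \<open>the inhomogeneity of the equation solved by the derivative of \<open>z\<close> in the direction \<open>w\<close>\<close>
  define r where "r = (\<lambda>w (t, p). A' (t, p) (0, w) (z (t, p)) + b' (t, p) (0, w))"
  have Ckr: "Ck_on k (?I \<tau>'' \<times> P) (r w)" for w
    unfolding r_def split_beta prod.collapse
    by (intro Ck_on_add Ck_on_blinfun_apply z Ck_on_const
        Ck_on_subset[OF A'(2) sub''(1)] Ck_on_subset[OF b'(2) sub''(1)])
  have slice: "continuous_on ?K (\<lambda>t. g (t, p))"
    if "continuous_on (?I \<tau>'' \<times> P) g" "p \<in> P" for p and g :: "real \<times> 'p \<Rightarrow> 'x::topological_space"
    by (rule continuous_on_compose2[OF that(1)]) (use that(2) Kin in \<open>auto intro!: continuous_intros\<close>)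
  have contA: "continuous_on (?I \<tau>'' \<times> P) A"
    using continuous_on_subset[OF Ck_on_imp_continuous_on[OF Ck(1)] sub''(1)] .
  have ex: "\<exists>y. y 0 = c' p w \<and> (\<forall>t\<in>?K. (y has_vector_derivative A (t, p) (y t) + r w (t, p)) (at t within ?K))"
    if "p \<in> P" for w p
  proof (rule linear_ODE_exists[where L = L])
    show "continuous_on ?K (\<lambda>t. A (t, p))" "continuous_on ?K (\<lambda>t. r w (t, p))"
      by (rule slice[OF contA that], rule slice[OF Ck_on_imp_continuous_on[OF Ckr] that])
    show "norm (A (t, p)) \<le> L" if "t \<in> ?K" for t
      using bound[of "(t, p)"] Kin[OF that] \<open>p \<in> P\<close> by simp
  qed (use \<tau> L' in auto)
  define y where "y = (\<lambda>w p. SOME y. y 0 = c' p w \<and>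
    (\<forall>t\<in>?K. (y has_vector_derivative A (t, p) (y t) + r w (t, p)) (at t within ?K)))"
  have y: "y w p 0 = c' p w"
    "t \<in> ?K \<Longrightarrow> (y w p has_vector_derivative A (t, p) (y w p t) + r w (t, p)) (at t within ?K)"
    if "p \<in> P" for w p t
    using someI_ex[OF ex[OF that, of w]] unfolding y_def by blast+
  define zw where "zw = (\<lambda>w (t, p). y w p t)"
  have Ckzw: "Ck_on k (?I \<tau> \<times> P) (zw w)" for w
  proof (rule Suc.IH[OF L' \<tau>(1,2)])
    show "norm (A q) \<le> L" if "q \<in> ?I \<tau>' \<times> P" for q using that sub'' by (intro bound) blast
    show "Ck_on k (?I \<tau>' \<times> P) A" "Ck_on k (?I \<tau>' \<times> P) (r w)"
      using Ck_on_subset[OF Ck(1) sub''(3)] Ck_on_subset[OF Ckr sub''(2)] by blast+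
    have "Ck_on k P (\<lambda>p. c' p w)" by (intro Ck_on_blinfun_apply c' Ck_on_const)
    then show "Ck_on k P (\<lambda>p. zw w (0, p))"
      by (subst Ck_on_cong[of P _ "\<lambda>p. c' p w"]) (simp_all add: zw_def y)
    show "((\<lambda>s. zw w (s, p)) has_vector_derivative A (t, p) (zw w (t, p)) + r w (t, p)) (at t)"
      if "\<bar>t\<bar> < \<tau>'" "p \<in> P" for t p
    proof -
      have "t \<in> interior ?K" using that by (auto simp: abs_less_iff)
      then have "at t within ?K = at t" by (rule at_within_interior)
      then show ?thesis using y(2)[OF that(2), of t w] that by (simp add: zw_def abs_less_iff)
    qed
  qed
  have der_w: "((\<lambda>h. z (t, p + h *\<^sub>R w)) has_vector_derivative zw w (t, p)) (at 0)"
    if t: "\<bar>t\<bar> < \<tau>" and p: "p \<in> P" for t p w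
  proof -
    obtain \<delta> where \<delta>: "\<delta> > 0" "\<And>h. \<bar>h\<bar> < \<delta> \<Longrightarrow> p + h *\<^sub>R w \<in> P"
      using open_line_segment[OF \<open>open P\<close> p] by metis
    let ?J = "{-\<delta><..<\<delta>}"
    have JP: "p + h *\<^sub>R w \<in> P" if "h \<in> ?J" for h using that by (intro \<delta>(2)) auto
    have line: "continuous_on (?K \<times> ?J) (\<lambda>x. g (fst x, p + snd x *\<^sub>R w))"
      if "continuous_on (?I \<epsilon> \<times> P) g" for g :: "real \<times> 'p \<Rightarrow> 'x::topological_space"
      by (rule continuous_on_compose2[OF that]) (use Kin JP in \<open>auto intro!: continuous_intros\<close>)
    define g where "g = (\<lambda>s h. A (s, p + h *\<^sub>R w) (z (s, p)) + b (s, p + h *\<^sub>R w))"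
    define g' where "g' = (\<lambda>s h. A' (s, p + h *\<^sub>R w) (0, w) (z (s, p)) + b' (s, p + h *\<^sub>R w) (0, w))"
    have "((\<lambda>h. g s h) has_vector_derivative g' s h) (at h)" if "s \<in> ?K" "h \<in> ?J" for s h
    proof -
      have q: "(s, p) + h *\<^sub>R (0, w) \<in> ?I \<epsilon> \<times> P" using that Kin JP by auto
      show ?thesis
        using has_vector_derivative_add[OF
            bounded_linear.has_vector_derivative[OF blinfun.bounded_linear_left
              has_vector_derivative_directional[OF A'(1)[OF q]]]
            has_vector_derivative_directional[OF b'(1)[OF q]]]
        by (simp add: g_def g'_def)
    qed
    then have derg: "\<forall>s\<in>?K. \<forall>h\<in>?J. ((\<lambda>h. g s h) has_vector_derivative g' s h) (at h)" by blast
    have "continuous_on (?K \<times> ?J) (\<lambda>(s, h). g' s h)"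
      unfolding g'_def split_beta
      by (intro continuous_on_add bounded_bilinear.continuous_on[OF bounded_bilinear_blinfun_apply]
          line[OF Ck_on_imp_continuous_on[OF A'(2)]] line[OF Ck_on_imp_continuous_on[OF b'(2)]] continuous_on_const
          continuous_on_compose2[OF slice[OF Ck_on_imp_continuous_on[OF z] p] continuous_on_fst[OF continuous_on_id]]) auto
    note H = Hadamard_quotient[OF derg this]
    have derc: "\<forall>s\<in>(UNIV::real set). \<forall>h\<in>?J. ((\<lambda>h. z (0, p + h *\<^sub>R w)) has_vector_derivative c' (p + h *\<^sub>R w) w) (at h)"
      by (intro ballI has_vector_derivative_directional[OF c'(1)] JP)
    have "continuous_on (UNIV \<times> ?J) (\<lambda>x. c' (p + snd x *\<^sub>R w) w)"
      by (intro bounded_bilinear.continuous_on[OF bounded_bilinear_blinfun_apply] continuous_on_const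
          continuous_on_compose2[OF Ck_on_imp_continuous_on[OF c'(2)]] continuous_intros)
        (use JP in auto)
    then have "continuous_on ((UNIV::real set) \<times> ?J) (\<lambda>(s, h). c' (p + h *\<^sub>R w) w)"
      by (simp add: split_beta')
    note Hc = Hadamard_quotient[OF derc this]
    let ?q = "\<lambda>s h. integral (cbox 0 1) (\<lambda>\<theta>. g' s (\<theta> * h))"
    let ?qc = "\<lambda>h. integral (cbox 0 1) (\<lambda>\<theta>. c' (p + (\<theta> * h) *\<^sub>R w) w)"
    define Q where "Q = (\<lambda>(s, h). if h = 0 then y w p s else (z (s, p + h *\<^sub>R w) - z (s, p)) /\<^sub>R h)"
    have "continuous_on (?K \<times> ?J) Q"
    proof (rule linear_ODE_continuous[where A = "\<lambda>x. A (fst x, p + snd x *\<^sub>R w)" and b = "\<lambda>(s, h). ?q s h" and z = Q and P = ?J and L = L])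
      show "continuous_on (?K \<times> ?J) (\<lambda>x. A (fst x, p + snd x *\<^sub>R w))"
        by (rule line[OF Ck_on_imp_continuous_on[OF Ck(1)]])
      show "continuous_on (?K \<times> ?J) (\<lambda>(s, h). ?q s h)" by (rule H(1))
      have Q0: "Q (0, h) = ?qc h" if "h \<in> ?J" for h
      proof (cases "h = 0")
        case True
        then show ?thesis using y(1)[OF p] Hc(3) by (simp add: Q_def)
      next
        case False
        then show ?thesis using Hc(2)[of 0 h] that by (simp add: Q_def abs_less_iff)
      qed
      have "continuous_on ?J ?qc"
      proof -
        have "continuous_on ?J (\<lambda>h. (0::real, h))" by (intro continuous_intros)
        from continuous_on_compose2[OF Hc(1) this] show ?thesis by auto
      qed
      then show "continuous_on ?J (\<lambda>h. Q (0, h))"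
        by (rule continuous_on_eq) (rule Q0[symmetric])
      show "norm (A (fst (s, h), p + snd (s, h) *\<^sub>R w)) \<le> L" if "s \<in> ?K" "h \<in> ?J" for s h
        using that Kin JP by (intro bound) auto
      show "((\<lambda>s. Q (s, h)) has_vector_derivative
          A (fst (s, h), p + snd (s, h) *\<^sub>R w) (Q (s, h)) + (case (s, h) of (s, h) \<Rightarrow> ?q s h)) (at s within ?K)"
        if "s \<in> ?K" "h \<in> ?J" for s h
      proof (cases "h = 0")
        case True
        have "?q s 0 = r w (s, p)" using H(3)[of s] by (simp add: g'_def r_def)
        then show ?thesis using True y(2)[OF p \<open>s \<in> ?K\<close>, of w] by (simp add: Q_def)
      next
        case False
        let ?p = "p + h *\<^sub>R w"
        let ?D = "(A (s, ?p) (z (s, ?p)) + b (s, ?p)) - (A (s, p) (z (s, p)) + b (s, p))"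
        have "h *\<^sub>R ?q s h = g s h - g s 0"
          using H(2)[of s h] that by (simp add: abs_less_iff)
        then have "h *\<^sub>R (A (s, ?p) (Q (s, h)) + ?q s h) = ?D"
          using False by (simp add: Q_def g_def blinfun.bilinear_simps scaleR_add_right)
        then have eq: "?D /\<^sub>R h = A (s, ?p) (Q (s, h)) + ?q s h"
          using False by (metis scaleR_left_imp_eq divideR_right)
        have "((\<lambda>s. (z (s, ?p) - z (s, p)) /\<^sub>R h) has_vector_derivative ?D /\<^sub>R h) (at s within ?K)"
          by (intro bounded_linear.has_vector_derivative[OF bounded_linear_scaleR_right]
              has_vector_derivative_diff has_vector_derivative_at_within[OF ode] Kin[OF that(1)] p JP[OF that(2)])
        then show ?thesis using False by (simp add: eq Q_def)
      qed
    qed (use \<tau> L' \<open>0 \<le> L\<close> in auto)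
    then have "continuous_on ?J (\<lambda>h. Q (t, h))"
      by (rule continuous_on_compose2) (use t \<tau> in \<open>auto intro!: continuous_intros\<close>)
    then have "((\<lambda>h. z (t, p + h *\<^sub>R w)) has_vector_derivative Q (t, 0)) (at 0)"
      by (rule has_vector_derivative_at_0_from_quotient[OF \<delta>(1)]) (simp add: Q_def)
    moreover have "Q (t, 0) = zw w (t, p)" by (simp add: Q_def zw_def)
    ultimately show ?thesis by simp
  qed
  show ?case
  proof (rule Ck_on_from_time_and_space[OF \<open>open P\<close> _ Ckzw _ der_w, where zt = "\<lambda>q. A q (z q) + b q"])
    show "Ck_on k (?I \<tau> \<times> P) (\<lambda>q. A q (z q) + b q)"
      by (intro Ck_on_add Ck_on_blinfun_apply Ck_on_subset[OF Ck(1) sub''(5)]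
          Ck_on_subset[OF Ck(2) sub''(5)] Ck_on_subset[OF z sub''(4)])
    show "((\<lambda>s. z (s, p)) has_vector_derivative A (t, p) (z (t, p)) + b (t, p)) (at t)"
      if "\<bar>t\<bar> < \<tau>" "p \<in> P" for t p
      by (rule ode) (use that \<tau> in auto)
  qed
qed

text \<open>
  The difference quotients of the flow solve a linear equation, whose coefficient is the mean of the
  derivative of the field over the segment between the two solutions. So the directional derivatives
  of the flow exist, and solve the linearised equation.
\<close>

lemma flow_Ck:
  fixes f :: "'e::euclidean_space \<Rightarrow> 'e"
  assumes "open P" "convex C" "open C" "0 \<le> L"
    and bound: "\<And>x. x \<in> C \<Longrightarrow> norm (F x) \<le> L"
    and F: "\<And>x. x \<in> C \<Longrightarrow> (f has_derivative blinfun_apply (F x)) (at x)"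
    and contF: "continuous_on C F"
    and eL: "\<epsilon> * L \<le> 1 / 2"
    and yC: "\<And>t p. \<bar>t\<bar> < \<epsilon> \<Longrightarrow> p \<in> P \<Longrightarrow> y (t, p) \<in> C"
    and y0: "\<And>p. p \<in> P \<Longrightarrow> y (0, p) = p"
    and ode: "\<And>t p. \<bar>t\<bar> < \<epsilon> \<Longrightarrow> p \<in> P \<Longrightarrow> ((\<lambda>s. y (s, p)) has_vector_derivative f (y (t, p))) (at t)"
  shows "Ck_on k C f \<Longrightarrow> Ck_on k C F \<Longrightarrow> 0 < \<tau> \<Longrightarrow> \<tau> < \<epsilon> \<Longrightarrow> Ck_on k ({-\<tau><..<\<tau>} \<times> P) y"
proof (induction k arbitrary: \<tau>)
  case (0 \<tau>)
  have lip: "norm (f a - f b) \<le> L * norm (a - b)" if "a \<in> C" "b \<in> C" for a b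
    by (rule differentiable_bound[OF \<open>convex C\<close> has_derivative_at_withinI[OF F] _ that])
      (use bound in \<open>auto simp: norm_blinfun.rep_eq\<close>)
  have "continuous_on ({-\<tau>..\<tau>} \<times> P) y"
    unfolding continuous_on_def
  proof (intro ballI)
    fix q0 assume "q0 \<in> {-\<tau>..\<tau>} \<times> P"
    then obtain t0 p0 where q0: "q0 = (t0, p0)" "t0 \<in> {-\<tau>..\<tau>}" "p0 \<in> P" by auto
    let ?F = "at q0 within {-\<tau>..\<tau>} \<times> P"
    have tl: "\<bar>t\<bar> < \<epsilon>" if "t \<in> {-\<tau>..\<tau>}" for t using that 0(4) by auto
    have "isCont (\<lambda>s. y (s, p0)) t0"
      by (rule has_vector_derivative_continuous[OF ode[OF tl[OF q0(2)] q0(3)]])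
    then have "((\<lambda>q. y (fst q, p0)) \<longlongrightarrow> y (t0, p0)) ?F"
      using isCont_tendsto_compose[OF _ tendsto_fst[OF tendsto_ident_at[of q0]]] q0(1) by fastforce
    then have lim1: "((\<lambda>q. y (fst q, p0) - y (t0, p0)) \<longlongrightarrow> 0) ?F" by (rule LIM_zero)
    have "((\<lambda>q. snd q) \<longlongrightarrow> p0) ?F"
      using tendsto_snd[OF tendsto_ident_at[of q0]] q0(1) by simp
    then have lim2: "((\<lambda>q. snd q - p0) \<longlongrightarrow> 0) ?F" by (rule LIM_zero)
    have lim3: "((\<lambda>q. y q - y (fst q, p0)) \<longlongrightarrow> 0) ?F"
    proof (rule tendsto_0_le[OF lim2])
      show "\<forall>\<^sub>F q in ?F. norm (y q - y (fst q, p0)) \<le> norm (snd q - p0) * 2"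
      proof -
        have "norm (y q - y (fst q, p0)) \<le> norm (snd q - p0) * 2" if q_in: "q \<in> {-\<tau>..\<tau>} \<times> P" for q
        proof -
          obtain t p where q: "q = (t, p)" "t \<in> {-\<tau>..\<tau>}" "p \<in> P" using q_in by auto
          have "norm (y (t, p) - y (t, p0)) \<le> 2 * (norm (y (0, p) - y (0, p0)) + \<tau> * 0)"
          proof (rule short_time_Gronwall[where w = "\<lambda>t. y (t, p) - y (t, p0)"
                and w' = "\<lambda>t. f (y (t, p)) - f (y (t, p0))" and L = L and \<tau> = \<tau> and \<eta> = 0])
            fix s assume s: "s \<in> {-\<tau>..\<tau>}"
            show "((\<lambda>t. y (t, p) - y (t, p0)) has_vector_derivative f (y (s, p)) - f (y (s, p0))) (at s within {-\<tau>..\<tau>})"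
              by (rule has_vector_derivative_at_within[OF has_vector_derivative_diff[OF
                    ode[OF tl[OF s] q(3)] ode[OF tl[OF s] q0(3)]]])
            show "norm (f (y (s, p)) - f (y (s, p0))) \<le> L * norm (y (s, p) - y (s, p0)) + 0"
              using lip[OF yC[OF tl[OF s] q(3)] yC[OF tl[OF s] q0(3)]] by simp
          next
            show "\<tau> * L \<le> 1 / 2"
              by (rule order_trans[OF mult_right_mono eL]) (use 0(4) \<open>0 \<le> L\<close> in simp_all)
          qed (use q \<open>0 \<le> L\<close> in simp_all)
          then show ?thesis using q y0[OF q(3)] y0[OF q0(3)] by simp
        qed
        then show ?thesis unfolding eventually_at_filter by (intro always_eventually) blast
      qed
    qed
    have "((\<lambda>q. y q - y q0) \<longlongrightarrow> 0) ?F"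
      using tendsto_add[OF lim3 lim1] q0(1) by simp
    then show "(y \<longlongrightarrow> y q0) ?F" by (simp add: LIM_zero_iff)
  qed
  then show ?case by (auto elim: continuous_on_subset)
next
  case (Suc k \<tau>)
  obtain \<tau>' where \<tau>': "\<tau> < \<tau>'" "\<tau>' < \<epsilon>" using dense[OF Suc.prems(4)] by blast
  obtain \<tau>'' where \<tau>'': "\<tau>' < \<tau>''" "\<tau>'' < \<epsilon>" using dense[OF \<tau>'(2)] by blast
  have \<tau>: "0 < \<tau>" "\<tau> < \<tau>'" "\<tau>' < \<tau>''" "\<tau>'' < \<epsilon>" "0 < \<tau>'" "0 < \<tau>''" "\<tau>' < \<epsilon>"
    using Suc.prems(3) \<tau>' \<tau>'' by auto
  let ?I = "\<lambda>\<epsilon>::real. {-\<epsilon><..<\<epsilon>}" and ?K = "{-\<tau>'..\<tau>'}"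
  have Kin: "t \<in> ?I \<tau>''" "\<bar>t\<bar> < \<epsilon>" if "t \<in> ?K" for t using that \<tau> by auto
  have I'': "\<bar>t\<bar> < \<epsilon>" if "t \<in> ?I \<tau>''" for t using that \<tau> by auto
  have L': "\<tau>' * L \<le> 1 / 2"
    by (rule order_trans[OF mult_right_mono eL]) (use \<tau> \<open>0 \<le> L\<close> in simp_all)
  have L'': "\<tau>'' * L \<le> 1 / 2"
    by (rule order_trans[OF mult_right_mono eL]) (use \<tau> \<open>0 \<le> L\<close> in simp_all)
  have Ckf: "Ck_on k C f" using Suc.prems(1) by (rule Ck_on_SucD)
  have CkF: "Ck_on k C F" using Suc.prems(2) by (rule Ck_on_SucD)
  have y: "Ck_on k (?I \<tau>'' \<times> P) y"
    by (rule Suc.IH[OF Ckf CkF \<tau>(6) \<tau>(4)])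
  have conty: "continuous_on (?I \<tau>'' \<times> P) y" by (rule Ck_on_imp_continuous_on[OF y])
  define A where "A = (\<lambda>q. F (y q))"
  have CkA: "Ck_on k (?I \<tau>'' \<times> P) A"
    unfolding A_def by (rule Ck_on_compose[OF y CkF]) (use yC I'' in auto)
  have contA: "continuous_on (?I \<tau>'' \<times> P) A" by (rule Ck_on_imp_continuous_on[OF CkA])
  have boundA: "norm (A (t, p)) \<le> L" if "\<bar>t\<bar> < \<epsilon>" "p \<in> P" for t p
    unfolding A_def by (rule bound[OF yC[OF that]])
  have ex: "\<exists>u. u 0 = w \<and> (\<forall>t\<in>?K. (u has_vector_derivative A (t, p) (u t)) (at t within ?K))"
    if "p \<in> P" for w p
  proof -
    have "continuous_on ?K (\<lambda>t. A (t, p))"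
      by (rule continuous_on_compose2[OF contA]) (use Kin that in \<open>auto intro!: continuous_intros\<close>)
    from linear_ODE_exists[OF _ L' this continuous_on_const[of _ 0], of w] show ?thesis
      using \<tau> boundA Kin that by simp
  qed
  define u where "u = (\<lambda>w (t, p). (SOME u. u 0 = w \<and>
    (\<forall>t\<in>?K. (u has_vector_derivative A (t, p) (u t)) (at t within ?K))) t)"
  have u: "u w (0, p) = w"
    "t \<in> ?K \<Longrightarrow> ((\<lambda>t. u w (t, p)) has_vector_derivative A (t, p) (u w (t, p))) (at t within ?K)"
    if "p \<in> P" for w p t
    using someI_ex[OF ex[OF that, of w]] unfolding u_def by auto
  have Cku: "Ck_on k (?I \<tau> \<times> P) (u w)" for w
  proof (rule linear_ODE_Ck[OF \<open>open P\<close> \<open>0 \<le> L\<close> L' \<tau>(1,2), where b = "\<lambda>_. 0"])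
    show "norm (A q) \<le> L" if "q \<in> ?I \<tau>' \<times> P" for q
      using boundA[of "fst q" "snd q"] that \<tau> by auto
    show "Ck_on k (?I \<tau>' \<times> P) A"
      by (rule Ck_on_subset[OF CkA]) (use \<tau> in auto)
    show "Ck_on k P (\<lambda>p. u w (0, p))"
      by (subst Ck_on_cong[of P _ "\<lambda>p. w"]) (simp_all add: u(1) Ck_on_const)
    show "((\<lambda>s. u w (s, p)) has_vector_derivative A (t, p) (u w (t, p)) + 0) (at t)"
      if "\<bar>t\<bar> < \<tau>'" "p \<in> P" for t p
    proof -
      have "t \<in> interior ?K" using that by (auto simp: abs_less_iff)
      then have "at t within ?K = at t" by (rule at_within_interior)
      then show ?thesis using u(2)[OF that(2), of t w] that by (simp add: abs_less_iff)
    qed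
  qed (rule Ck_on_const)
  have der_w: "((\<lambda>h. y (t, p + h *\<^sub>R w)) has_vector_derivative u w (t, p)) (at 0)"
    if t: "\<bar>t\<bar> < \<tau>" and p: "p \<in> P" for t p w
  proof -
    obtain \<delta> where \<delta>: "\<delta> > 0" "\<And>h. \<bar>h\<bar> < \<delta> \<Longrightarrow> p + h *\<^sub>R w \<in> P"
      using open_line_segment[OF \<open>open P\<close> p] by metis
    let ?J = "{-\<delta><..<\<delta>}"
    have JP: "p + h *\<^sub>R w \<in> P" if "h \<in> ?J" for h using that by (intro \<delta>(2)) auto
    define seg where "seg = (\<lambda>(s, h) \<theta>. y (s, p) + \<theta> *\<^sub>R (y (s, p + h *\<^sub>R w) - y (s, p)))"
    have segC: "seg (s, h) \<theta> \<in> C" if "s \<in> ?K" "h \<in> ?J" "\<theta> \<in> {0..1}" for s h \<theta>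
    proof -
      have "(1 - \<theta>) *\<^sub>R y (s, p) + \<theta> *\<^sub>R y (s, p + h *\<^sub>R w) \<in> C"
        using that by (intro convexD_alt[OF \<open>convex C\<close>] yC Kin p JP) auto
      then show ?thesis by (simp add: seg_def algebra_simps)
    qed
    have y1: "continuous_on ((?K \<times> ?J) \<times> cbox 0 (1::real)) (\<lambda>x. y (fst (fst x), p))"
      by (rule continuous_on_compose2[OF conty]) (use Kin p in \<open>auto intro!: continuous_intros\<close>)
    have y2: "continuous_on ((?K \<times> ?J) \<times> cbox 0 (1::real)) (\<lambda>x. y (fst (fst x), p + snd (fst x) *\<^sub>R w))"
      by (rule continuous_on_compose2[OF conty]) (use Kin JP in \<open>auto intro!: continuous_intros\<close>)
    have "continuous_on ((?K \<times> ?J) \<times> cbox 0 (1::real)) (\<lambda>(x, \<theta>). seg x \<theta>)"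
      unfolding seg_def split_beta
      by (intro continuous_on_add continuous_on_scaleR continuous_on_diff y1 y2 continuous_on_snd continuous_on_id)
    then have "continuous_on ((?K \<times> ?J) \<times> cbox 0 (1::real)) (\<lambda>x. F (case x of (x, \<theta>) \<Rightarrow> seg x \<theta>))"
      by (rule continuous_on_compose2[OF contF]) (use segC in auto)
    then have "continuous_on ((?K \<times> ?J) \<times> cbox 0 (1::real)) (\<lambda>(x, \<theta>). F (seg x \<theta>))"
      by (simp add: split_beta')
    note contint = integral_continuous_on_param[OF this]
    define B where "B = (\<lambda>x. integral (cbox 0 1) (\<lambda>\<theta>. F (seg x \<theta>)))"
    have Fseg: "continuous_on {0..1} (\<lambda>\<theta>. F (seg (s, h) \<theta>))" if "s \<in> ?K" "h \<in> ?J" for s h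
    proof (rule continuous_on_compose2[OF contF])
      show "continuous_on {0..1} (seg (s, h))" unfolding seg_def prod.case by (intro continuous_intros)
    qed (use segC that in auto)
    have Bint: "((\<lambda>\<theta>. F (seg (s, h) \<theta>)) has_integral B (s, h)) {0..1}" if "s \<in> ?K" "h \<in> ?J" for s h
      unfolding B_def cbox_interval
      by (rule integrable_integral[OF integrable_continuous_real[OF Fseg[OF that]]])
    have Bbound: "norm (B (s, h)) \<le> L" if "s \<in> ?K" "h \<in> ?J" for s h
    proof -
      have "norm (B (s, h)) \<le> L * (1 - 0)"
        unfolding B_def cbox_interval
        by (rule integral_bound[OF _ Fseg[OF that]]) (use bound segC that in auto)
      then show ?thesis by simp
    qed
    have Bdiff: "f (y (s, p + h *\<^sub>R w)) - f (y (s, p)) = B (s, h) (y (s, p + h *\<^sub>R w) - y (s, p))"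
      if "s \<in> ?K" "h \<in> ?J" for s h
    proof -
      let ?d = "y (s, p + h *\<^sub>R w) - y (s, p)"
      have "((\<lambda>\<theta>. F (seg (s, h) \<theta>) ?d) has_integral f (seg (s, h) 1) - f (seg (s, h) 0)) {0..1}"
      proof (rule fundamental_theorem_of_calculus)
        fix \<theta> :: real assume "\<theta> \<in> {0..1}"
        from has_vector_derivative_directional[of f _ "y (s, p)" \<theta> ?d] F[OF segC[OF that this]]
        show "((\<lambda>\<theta>. f (seg (s, h) \<theta>)) has_vector_derivative F (seg (s, h) \<theta>) ?d) (at \<theta> within {0..1})"
          unfolding seg_def prod.case by (blast intro: has_vector_derivative_at_within)
      qed simp
      moreover have "((\<lambda>\<theta>. F (seg (s, h) \<theta>) ?d) has_integral B (s, h) ?d) {0..1}"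
        using has_integral_linear[OF Bint[OF that] blinfun.bounded_linear_left[of ?d]] by (simp add: o_def)
      ultimately have "f (seg (s, h) 1) - f (seg (s, h) 0) = B (s, h) ?d" by (rule has_integral_unique)
      then show ?thesis by (simp add: seg_def)
    qed
    define Q where "Q = (\<lambda>(s, h). if h = 0 then u w (s, p) else (y (s, p + h *\<^sub>R w) - y (s, p)) /\<^sub>R h)"
    have "continuous_on (?K \<times> ?J) Q"
    proof (rule linear_ODE_continuous[where A = B and b = "\<lambda>_. 0" and z = Q and P = ?J and L = L])
      show "continuous_on (?K \<times> ?J) B" unfolding B_def by (rule contint)
      have "Q (0, h) = w" if "h \<in> ?J" for h
        using u(1)[OF p] y0[OF p] y0[OF JP[OF that]] by (simp add: Q_def)
      then show "continuous_on ?J (\<lambda>h. Q (0, h))"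
        by (intro continuous_on_eq[OF continuous_on_const[of _ w]]) simp
      show "norm (B (s, h)) \<le> L" if "s \<in> ?K" "h \<in> ?J" for s h by (rule Bbound[OF that])
      show "((\<lambda>s. Q (s, h)) has_vector_derivative B (s, h) (Q (s, h)) + 0) (at s within ?K)"
        if "s \<in> ?K" "h \<in> ?J" for s h
      proof (cases "h = 0")
        case True
        have "B (s, 0) = A (s, p)" by (simp add: B_def seg_def A_def)
        then show ?thesis using True u(2)[OF p \<open>s \<in> ?K\<close>, of w] by (simp add: Q_def)
      next
        case False
        have eq: "(f (y (s, p + h *\<^sub>R w)) - f (y (s, p))) /\<^sub>R h = B (s, h) (Q (s, h))"
          using False Bdiff[OF that] by (simp add: Q_def blinfun.bilinear_simps)
        have "((\<lambda>s. (y (s, p + h *\<^sub>R w) - y (s, p)) /\<^sub>R h) has_vector_derivative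
            (f (y (s, p + h *\<^sub>R w)) - f (y (s, p))) /\<^sub>R h) (at s within ?K)"
          by (intro bounded_linear.has_vector_derivative[OF bounded_linear_scaleR_right]
              has_vector_derivative_diff has_vector_derivative_at_within[OF ode] Kin[OF that(1)] p JP[OF that(2)])
        then show ?thesis using False unfolding eq by (simp add: Q_def)
      qed
    qed (use \<tau> L' \<open>0 \<le> L\<close> in auto)
    then have "continuous_on ?J (\<lambda>h. Q (t, h))"
      by (rule continuous_on_compose2) (use t \<tau> in \<open>auto intro!: continuous_intros\<close>)
    then have "((\<lambda>h. y (t, p + h *\<^sub>R w)) has_vector_derivative Q (t, 0)) (at 0)"
      by (rule has_vector_derivative_at_0_from_quotient[OF \<delta>(1)]) (simp add: Q_def)
    moreover have "Q (t, 0) = u w (t, p)" by (simp add: Q_def)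
    ultimately show ?thesis by simp
  qed
  show ?case
  proof (rule Ck_on_from_time_and_space[OF \<open>open P\<close> _ Cku _ der_w, where zt = "\<lambda>q. f (y q)"])
    show "Ck_on k (?I \<tau> \<times> P) (\<lambda>q. f (y q))"
      by (rule Ck_on_compose[OF Ck_on_subset[OF y] Ckf]) (use yC \<tau> in auto)
    show "((\<lambda>s. y (s, p)) has_vector_derivative f (y (t, p))) (at t)" if "\<bar>t\<bar> < \<tau>" "p \<in> P" for t p
      by (rule ode) (use that \<tau> in auto)
  qed
qed

text \<open>
  Solutions starting in the ball of radius \<open>r\<close> cannot leave the ball of twice that radius before
  time \<open>\<epsilon>\<close>. So they do not notice that the field has been replaced by a globally Lipschitz one.
\<close>

lemma local_flow:
  fixes f :: "'e::euclidean_space \<Rightarrow> 'e"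
  assumes "open W" "smooth_on W f" "x0 \<in> W"
  obtains \<epsilon> r \<Phi> where "\<epsilon> > 0" "r > 0"
    "\<And>x. x \<in> ball x0 r \<Longrightarrow> \<Phi> (0, x) = x"
    "\<And>t x. \<bar>t\<bar> < \<epsilon> \<Longrightarrow> x \<in> ball x0 r \<Longrightarrow> \<Phi> (t, x) \<in> W"
    "\<And>t x. \<bar>t\<bar> < \<epsilon> \<Longrightarrow> x \<in> ball x0 r \<Longrightarrow> ((\<lambda>s. \<Phi> (s, x)) has_vector_derivative f (\<Phi> (t, x))) (at t)"
    "smooth_on ({-\<epsilon><..<\<epsilon>} \<times> ball x0 r) \<Phi>"
proof -
  obtain F where F: "\<And>x. x \<in> W \<Longrightarrow> (f has_derivative blinfun_apply (F x)) (at x)" and CkF: "\<And>k. Ck_on k W F"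
    using smooth_on_openE[OF assms(1,2)] by metis
  have Ckf: "Ck_on k W f" for k using assms(2) by (simp add: smooth_on_def)
  have contf: "continuous_on W f" and contF: "continuous_on W F"
    using Ckf CkF Ck_on_imp_continuous_on by blast+
  obtain R where R: "R > 0" "cball x0 R \<subseteq> W"
    using open_contains_cball assms(1,3) by metis
  let ?C = "cball x0 R"
  obtain B where B: "B > 0" "\<And>x. x \<in> ?C \<Longrightarrow> norm (f x) \<le> B"
    using compact_imp_bounded[OF compact_continuous_image[OF continuous_on_subset[OF contf R(2)] compact_cball]]
    unfolding bounded_pos by blast
  obtain L where L: "L > 0" "\<And>x. x \<in> ?C \<Longrightarrow> norm (F x) \<le> L"
    using compact_imp_bounded[OF compact_continuous_image[OF continuous_on_subset[OF contF R(2)] compact_cball]]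
    unfolding bounded_pos by blast
  define r where "r = R / 2"
  define \<epsilon> where "\<epsilon> = min (r / B) (1 / (2 * L))"
  have r: "r > 0" using R by (simp add: r_def)
  have \<epsilon>: "\<epsilon> > 0" using r B(1) L(1) by (simp add: \<epsilon>_def)
  have "\<epsilon> * L \<le> 1 / (2 * L) * L" using L(1) by (intro mult_right_mono) (auto simp: \<epsilon>_def)
  then have eL: "\<epsilon> * L \<le> 1 / 2" using L(1) by simp
  have "\<epsilon> * B \<le> r / B * B" using B(1) by (intro mult_right_mono) (auto simp: \<epsilon>_def)
  then have eB: "\<epsilon> * B \<le> r" using B(1) by simp
  \<comment> \<open>composed with the nearest point map onto the ball, the field becomes globally Lipschitz\<close>
  define g where "g = (\<lambda>x. f (closest_point ?C x))"
  have cl: "closest_point ?C x \<in> ?C" for x by (rule closest_point_in_set) (use R in auto)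
  have lipf: "norm (f x - f y) \<le> L * norm (x - y)" if "x \<in> ?C" "y \<in> ?C" for x y
  proof (rule differentiable_bound[OF convex_cball _ _ that])
    show "(f has_derivative blinfun_apply (F x)) (at x within ?C)" if "x \<in> ?C" for x
      using F that R(2) by (blast intro: has_derivative_at_withinI)
    show "onorm (blinfun_apply (F x)) \<le> L" if "x \<in> ?C" for x
      using L(2)[OF that] by (simp add: norm_blinfun.rep_eq)
  qed
  have lipg: "norm (g x - g y) \<le> L * norm (x - y)" for x y
  proof -
    have "norm (closest_point ?C x - closest_point ?C y) \<le> norm (x - y)"
      using closest_point_lipschitz[of ?C x y] R(1) by (simp add: dist_norm)
    then have "L * norm (closest_point ?C x - closest_point ?C y) \<le> L * norm (x - y)"
      using L(1) by (intro mult_left_mono) auto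
    then show ?thesis unfolding g_def using lipf[OF cl cl, of x y] by linarith
  qed
  have contg: "continuous_on UNIV g"
    unfolding g_def
    by (rule continuous_on_compose2[OF continuous_on_subset[OF contf R(2)] continuous_on_closest_point])
      (use cl R in auto)
  have ex: "\<exists>y. y 0 = x \<and> (\<forall>t\<in>{-\<epsilon>..\<epsilon>}. (y has_vector_derivative g (y t)) (at t within {-\<epsilon>..\<epsilon>}))" for x
  proof (rule ODE_exists[where L = L])
    show "continuous_on ({-\<epsilon>..\<epsilon>} \<times> UNIV) (\<lambda>(t, y). g y)"
      unfolding split_beta by (rule continuous_on_compose2[OF contg]) (auto intro!: continuous_intros)
  qed (use \<epsilon> eL lipg in auto)
  define \<Phi> where "\<Phi> = (\<lambda>(t, x). (SOME y. y 0 = x \<and>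
    (\<forall>t\<in>{-\<epsilon>..\<epsilon>}. (y has_vector_derivative g (y t)) (at t within {-\<epsilon>..\<epsilon>}))) t)"
  have \<Phi>0: "\<Phi> (0, x) = x"
    and \<Phi>: "t \<in> {-\<epsilon>..\<epsilon>} \<Longrightarrow> ((\<lambda>t. \<Phi> (t, x)) has_vector_derivative g (\<Phi> (t, x))) (at t within {-\<epsilon>..\<epsilon>})" for t x
    using someI_ex[OF ex[of x]] unfolding \<Phi>_def by auto
  have \<Phi>C: "\<Phi> (t, x) \<in> ball x0 R" if "t \<in> {-\<epsilon>..\<epsilon>}" "x \<in> ball x0 r" for t x
  proof -
    have "norm (\<Phi> (t, x) - \<Phi> (0, x)) \<le> \<epsilon> * B"
      by (rule derivative_bound_symmetric_interval[OF \<Phi> _ that(1)]) (auto simp: g_def intro: B(2)[OF cl])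
    then have "dist x (\<Phi> (t, x)) \<le> r" using eB \<Phi>0[of x] by (simp add: dist_norm norm_minus_commute)
    moreover have "dist x0 x < r" using that by simp
    ultimately show ?thesis using dist_triangle[of x0 "\<Phi> (t, x)" x] by (simp add: r_def)
  qed
  have ode: "((\<lambda>s. \<Phi> (s, x)) has_vector_derivative f (\<Phi> (t, x))) (at t)" if "\<bar>t\<bar> < \<epsilon>" "x \<in> ball x0 r" for t x
  proof -
    have "t \<in> interior {-\<epsilon>..\<epsilon>}" using that by (auto simp: abs_less_iff)
    then have "at t within {-\<epsilon>..\<epsilon>} = at t" by (rule at_within_interior)
    moreover have t: "t \<in> {-\<epsilon>..\<epsilon>}" using that by (auto simp: abs_less_iff)
    have "\<Phi> (t, x) \<in> ?C" using \<Phi>C[OF t that(2)] by auto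
    then have "g (\<Phi> (t, x)) = f (\<Phi> (t, x))" by (simp add: g_def closest_point_self)
    ultimately show ?thesis using \<Phi>[OF t, of x] by simp
  qed
  have bR: "ball x0 R \<subseteq> W" using R(2) by auto
  have "Ck_on k ({-(\<epsilon>/2)<..<\<epsilon>/2} \<times> ball x0 r) \<Phi>" for k
  proof (rule flow_Ck[where C = "ball x0 R" and F = F and f = f and L = L and \<epsilon> = \<epsilon>])
    show "\<Phi> (t, x) \<in> ball x0 R" if "\<bar>t\<bar> < \<epsilon>" "x \<in> ball x0 r" for t x
      by (rule \<Phi>C) (use that in \<open>auto simp: abs_less_iff\<close>)
    show "Ck_on k (ball x0 R) f" "Ck_on k (ball x0 R) F"
      using Ck_on_subset[OF Ckf bR] Ck_on_subset[OF CkF bR] by blast+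
    show "continuous_on (ball x0 R) F" by (rule continuous_on_subset[OF contF bR])
    show "(f has_derivative blinfun_apply (F x)) (at x)" if "x \<in> ball x0 R" for x
      using F that bR by blast
    show "norm (F x) \<le> L" if "x \<in> ball x0 R" for x using L(2) that by auto
  qed (use \<epsilon> eL L \<Phi>0 ode in auto)
  then have smooth: "smooth_on ({-(\<epsilon>/2)<..<\<epsilon>/2} \<times> ball x0 r) \<Phi>" by (simp add: smooth_on_def)
  show ?thesis
  proof (rule that[OF _ r \<Phi>0 _ _ smooth])
    show "\<epsilon> / 2 > 0" using \<epsilon> by simp
    show "((\<lambda>s. \<Phi> (s, x)) has_vector_derivative f (\<Phi> (t, x))) (at t)" if "\<bar>t\<bar> < \<epsilon> / 2" "x \<in> ball x0 r" for t x
      by (rule ode) (use that in auto)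
    show "\<Phi> (t, x) \<in> W" if "\<bar>t\<bar> < \<epsilon> / 2" "x \<in> ball x0 r" for t x
    proof -
      have "t \<in> {-\<epsilon>..\<epsilon>}" using that(1) by auto
      then show ?thesis using \<Phi>C[OF _ that(2)] bR by blast
    qed
  qed
qed

text \<open>
  Manifolds are modelled on linear subspaces. A projection \<open>P\<close> onto the model subspace replaces maps
  on relatively open subsets by maps on open subsets of the ambient space, and the equation
  \<open>P v = v\<close> detects membership in the subspace.
\<close>

lemma subspace_linear_projection:
  fixes S :: "'e::euclidean_space set"
  assumes "subspace S"
  obtains P where "bounded_linear P" "\<And>v. P v \<in> S" "\<And>v. v \<in> S \<Longrightarrow> P v = v"
proof -
  have "inj_on (\<lambda>x::'e. x) S" by (simp add: inj_on_def)
  from linear_exists_left_inverse_on[OF linear_id[unfolded id_def] assms this]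
  obtain g :: "'e \<Rightarrow> 'e" where "range g \<subseteq> S" "linear g" "\<forall>v\<in>S. g v = v" by auto
  then show ?thesis by (intro that[of g]) (auto simp: linear_conv_bounded_linear)
qed

lemma derivative_in_subspace:
  fixes f :: "'a::real_normed_vector \<Rightarrow> 'e::euclidean_space"
  assumes "subspace S" "(f has_derivative D) (at x)" "open U" "x \<in> U" "\<And>y. y \<in> U \<Longrightarrow> f y \<in> S"
  shows "D v \<in> S"
proof -
  obtain P where P: "bounded_linear P" "\<And>v. P v \<in> S" "\<And>v. v \<in> S \<Longrightarrow> P v = v"
    using subspace_linear_projection[OF assms(1)] by metis
  have "((\<lambda>y. P (f y)) has_derivative (\<lambda>v. P (D v))) (at x)"
    by (rule bounded_linear.has_derivative[OF P(1) assms(2)])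
  then have "(f has_derivative (\<lambda>v. P (D v))) (at x)"
    by (rule has_derivative_transform_within_open[OF _ assms(3,4)]) (simp add: P(3) assms(5))
  then have "(\<lambda>v. P (D v)) = D" using assms(2) has_derivative_unique by blast
  then show ?thesis using P(2)[of "D v"] by metis
qed

section \<open>Local normal form of a field transversal to a submersion\<close>

text \<open>
  The inverse \<open>\<Psi>\<close> of \<open>G\<close> splits \<open>y\<close> into its component along \<open>f x0\<close>, measured by \<open>\<tau> y\<close>, and the point
  \<open>\<sigma> y\<close> of the hyperplane through \<open>x0\<close> perpendicular to \<open>f x0\<close>, and follows the flow from \<open>\<sigma> y\<close> for the
  time \<open>\<tau> y\<close>. Moving \<open>y\<close> in the direction \<open>f x0\<close> only prolongs that time, so that \<open>\<Psi>\<close> carries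
  the constant field \<open>f x0\<close> to \<open>f\<close>; the hyperplane itself is fixed, which makes the derivative at \<open>x0\<close>
  the identity. Along the flow one moves in directions of \<open>S\<close> only, hence \<open>G\<close> preserves the cosets
  of \<open>S\<close>.
\<close>

lemma flow_box:
  fixes f :: "'e::euclidean_space \<Rightarrow> 'e"
  assumes "open W" "smooth_on W f" "x0 \<in> W" and ne: "f x0 \<noteq> 0"
    and "subspace S" and fS: "\<And>x. x \<in> W \<Longrightarrow> f x \<in> S"
  obtains U G where "open U" "x0 \<in> U" "U \<subseteq> W" "smooth_on U G" "G x0 = x0"
    "(G has_derivative (\<lambda>v. v)) (at x0)"
    "\<And>x D. x \<in> U \<Longrightarrow> (G has_derivative D) (at x) \<Longrightarrow> D (f x) = f x0"
    "\<And>x. x \<in> U \<Longrightarrow> G x - x \<in> S"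
proof -
  obtain \<epsilon> r \<Phi> where "\<epsilon> > 0" "r > 0"
    and \<Phi>0: "\<And>x. x \<in> ball x0 r \<Longrightarrow> \<Phi> (0, x) = x"
    and \<Phi>W: "\<And>t x. \<bar>t\<bar> < \<epsilon> \<Longrightarrow> x \<in> ball x0 r \<Longrightarrow> \<Phi> (t, x) \<in> W"
    and ode: "\<And>t x. \<bar>t\<bar> < \<epsilon> \<Longrightarrow> x \<in> ball x0 r \<Longrightarrow> ((\<lambda>s. \<Phi> (s, x)) has_vector_derivative f (\<Phi> (t, x))) (at t)"
    and smooth: "smooth_on ({-\<epsilon><..<\<epsilon>} \<times> ball x0 r) \<Phi>"
    by (rule local_flow[OF assms(1-3)], rule that)
  obtain P where P: "bounded_linear P" "\<And>v. P v \<in> S" "\<And>v. v \<in> S \<Longrightarrow> P v = v"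
    using subspace_linear_projection[OF \<open>subspace S\<close>] by metis
  let ?X = "f x0"
  have XX: "?X \<bullet> ?X \<noteq> 0" using ne by simp
  define \<tau> where "\<tau> = (\<lambda>y. (y - x0) \<bullet> (?X /\<^sub>R (?X \<bullet> ?X)))"
  define \<sigma> where "\<sigma> = (\<lambda>y. y - \<tau> y *\<^sub>R ?X)"
  have \<tau>_shift: "\<tau> (y + h *\<^sub>R ?X) = \<tau> y + h" for y h
    using XX by (simp add: \<tau>_def inner_diff_left inner_add_left algebra_simps)
  have \<sigma>_shift: "\<sigma> (y + h *\<^sub>R ?X) = \<sigma> y" for y h
    by (simp add: \<sigma>_def \<tau>_shift algebra_simps)
  define \<Psi> where "\<Psi> = (\<lambda>y. \<Phi> (\<tau> y, \<sigma> y))"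
  define N where "N = (\<lambda>y. (\<tau> y, \<sigma> y)) -` ({-\<epsilon><..<\<epsilon>} \<times> ball x0 r)"
  have cont: "continuous_on UNIV (\<lambda>y. (\<tau> y, \<sigma> y))"
    unfolding \<sigma>_def \<tau>_def by (intro continuous_intros)
  have "open N" unfolding N_def by (intro open_vimage cont open_Times) auto
  have x0: "\<tau> x0 = 0" "\<sigma> x0 = x0" by (simp_all add: \<tau>_def \<sigma>_def)
  have "x0 \<in> N" using x0 \<open>\<epsilon> > 0\<close> \<open>r > 0\<close> by (simp add: N_def)
  have N: "\<bar>\<tau> y\<bar> < \<epsilon>" "\<sigma> y \<in> ball x0 r" if "y \<in> N" for y
    using that by (auto simp: N_def)
  have \<tau>C: "Ck_on k N \<tau>" for k
    unfolding \<tau>_def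
    by (rule Ck_on_linear_compose[OF bounded_linear_inner_left]) (intro Ck_on_diff Ck_on_ident Ck_on_const)
  have "smooth_on N \<Psi>"
    unfolding smooth_on_def
  proof
    fix k
    have "Ck_on k N (\<lambda>y. (\<tau> y, \<sigma> y))"
      unfolding \<sigma>_def
      by (intro Ck_on_Pair \<tau>C Ck_on_diff Ck_on_ident Ck_on_scaleR Ck_on_const)
    then show "Ck_on k N \<Psi>"
      unfolding \<Psi>_def
      by (rule Ck_on_compose) (use smooth in \<open>auto simp: smooth_on_def N_def\<close>)
  qed
  then obtain \<Psi>' where \<Psi>': "\<And>y. y \<in> N \<Longrightarrow> (\<Psi> has_derivative blinfun_apply (\<Psi>' y)) (at y)"
    using smooth_on_openE[OF \<open>open N\<close>] by metis
  have \<Psi>'X: "\<Psi>' y ?X = f (\<Psi> y)" if "y \<in> N" for y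
  proof -
    have "((\<lambda>s. \<Phi> (s, \<sigma> y)) \<circ> (\<lambda>h. \<tau> y + h) has_vector_derivative 1 *\<^sub>R f (\<Phi> (\<tau> y, \<sigma> y))) (at 0)"
    proof (rule vector_diff_chain_at)
      show "((\<lambda>h. \<tau> y + h) has_vector_derivative 1) (at 0)" by (auto intro!: derivative_eq_intros)
      show "((\<lambda>s. \<Phi> (s, \<sigma> y)) has_vector_derivative f (\<Phi> (\<tau> y, \<sigma> y))) (at (\<tau> y + 0))"
        using ode[OF N[OF that]] by simp
    qed
    then have "((\<lambda>h. \<Psi> (y + h *\<^sub>R ?X)) has_vector_derivative f (\<Psi> y)) (at 0)"
      by (simp add: \<Psi>_def \<tau>_shift \<sigma>_shift o_def)
    moreover have "((\<lambda>h. \<Psi> (y + h *\<^sub>R ?X)) has_vector_derivative \<Psi>' y ?X) (at 0)"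
      by (rule has_vector_derivative_directional) (use \<Psi>'[OF that] in simp)
    ultimately show ?thesis by (rule vector_derivative_unique_at[symmetric])
  qed
  have \<Psi>x0: "\<Psi> x0 = x0" using \<Phi>0[of x0] \<open>r > 0\<close> by (simp add: \<Psi>_def x0)
  have "\<Psi>' x0 v = v" for v
  proof -
    have perp: "\<Psi>' x0 u = u" if "u \<bullet> ?X = 0" for u
    proof -
      have *: "\<tau> (x0 + h *\<^sub>R u) = 0" "\<sigma> (x0 + h *\<^sub>R u) = x0 + h *\<^sub>R u" for h
        using that by (simp_all add: \<tau>_def \<sigma>_def)
      obtain \<delta> where \<delta>: "\<delta> > 0" "\<And>h. \<bar>h\<bar> < \<delta> \<Longrightarrow> x0 + h *\<^sub>R u \<in> ball x0 r"
        using open_line_segment[OF open_ball, of x0 x0 r u] \<open>r > 0\<close> by auto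
      have "((\<lambda>h. x0 + h *\<^sub>R u) has_vector_derivative u) (at 0)" by (auto intro!: derivative_eq_intros)
      then have "((\<lambda>h. \<Psi> (x0 + h *\<^sub>R u)) has_vector_derivative u) (at 0)"
        by (rule has_vector_derivative_transform_within_open[of _ _ _ "ball 0 \<delta>"])
          (use \<delta> \<Phi>0 in \<open>auto simp: \<Psi>_def *\<close>)
      moreover have "((\<lambda>h. \<Psi> (x0 + h *\<^sub>R u)) has_vector_derivative \<Psi>' x0 u) (at 0)"
        by (rule has_vector_derivative_directional) (use \<Psi>'[OF \<open>x0 \<in> N\<close>] in simp)
      ultimately show ?thesis by (rule vector_derivative_unique_at[symmetric])
    qed
    define a where "a = (v \<bullet> ?X) / (?X \<bullet> ?X)"
    have "(v - a *\<^sub>R ?X) \<bullet> ?X = 0" using XX by (simp add: a_def inner_diff_left)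
    from perp[OF this] have "\<Psi>' x0 (v - a *\<^sub>R ?X) = v - a *\<^sub>R ?X" .
    moreover have "\<Psi>' x0 ?X = ?X" using \<Psi>'X[OF \<open>x0 \<in> N\<close>] by (simp add: \<Psi>x0)
    ultimately show ?thesis by (simp add: blinfun.bilinear_simps)
  qed
  then have \<Psi>'x0: "blinfun_apply (\<Psi>' x0) = (\<lambda>v. v)" by blast
  then have d\<Psi>: "(\<Psi> has_derivative (\<lambda>v. v)) (at x0)" using \<Psi>'[OF \<open>x0 \<in> N\<close>] by simp
  obtain U' V G where G: "open U'" "x0 \<in> U'" "U' \<subseteq> N" "open V" "\<Psi> ` U' = V" "G ` V = U'"
    "\<And>y. y \<in> U' \<Longrightarrow> G (\<Psi> y) = y" "\<And>x. x \<in> V \<Longrightarrow> \<Psi> (G x) = x" "smooth_on V G"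
    by (rule smooth_inverse_function[OF \<open>open N\<close> \<open>smooth_on N \<Psi>\<close> \<open>x0 \<in> N\<close> d\<Psi>], rule that)
  have x0V: "x0 \<in> V" using G(2,5) \<Psi>x0 by force
  have Gx0: "G x0 = x0" using G(7)[OF G(2)] \<Psi>x0 by simp
  have GN: "G x \<in> N" "G x \<in> U'" if "x \<in> V" for x using G(3,6) that by auto
  have inv: "D (\<Psi>' (G x) v) = v" if "x \<in> V" "(G has_derivative D) (at x)" for x D v
  proof -
    have "(G has_derivative D) (at (\<Psi> (G x)))" using that G(8) by simp
    from has_derivative_compose[OF \<Psi>'[OF GN(1)[OF that(1)]] this]
    have "((\<lambda>y. G (\<Psi> y)) has_derivative (\<lambda>v. D (\<Psi>' (G x) v))) (at (G x))" .
    then have "((\<lambda>y. y) has_derivative (\<lambda>v. D (\<Psi>' (G x) v))) (at (G x))"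
      by (rule has_derivative_transform_within_open[OF _ G(1) GN(2)[OF that(1)]]) (rule G(7))
    from has_derivative_unique[OF this has_derivative_ident] show ?thesis by metis
  qed
  obtain D0 where D0: "(G has_derivative blinfun_apply D0) (at x0)"
    using smooth_on_openE[OF G(4,9)] x0V by metis
  have "blinfun_apply D0 = (\<lambda>v. v)"
    using inv[OF x0V D0] by (simp add: Gx0 \<Psi>'x0 fun_eq_iff)
  then have dG: "(G has_derivative (\<lambda>v. v)) (at x0)" using D0 by simp
  have stay: "\<Phi> (t, x) - x \<in> S" if "\<bar>t\<bar> < \<epsilon>" "x \<in> ball x0 r" for t x
  proof -
    define q where "q = (\<lambda>v. v - P v)"
    have q: "bounded_linear q"
      unfolding q_def by (intro bounded_linear_sub bounded_linear_ident P(1))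
    have s: "\<bar>s\<bar> < \<epsilon>" if "s \<in> {-\<bar>t\<bar>..\<bar>t\<bar>}" for s using that \<open>\<bar>t\<bar> < \<epsilon>\<close> by auto
    have "norm (q (\<Phi> (t, x)) - q (\<Phi> (0, x))) \<le> \<bar>t\<bar> * 0"
    proof (rule derivative_bound_symmetric_interval)
      show "((\<lambda>s. q (\<Phi> (s, x))) has_vector_derivative q (f (\<Phi> (s, x)))) (at s within {-\<bar>t\<bar>..\<bar>t\<bar>})"
        if "s \<in> {-\<bar>t\<bar>..\<bar>t\<bar>}" for s
        by (rule has_vector_derivative_at_within[OF bounded_linear.has_vector_derivative[OF q
              ode[OF s[OF that] \<open>x \<in> ball x0 r\<close>]]])
      show "norm (q (f (\<Phi> (s, x)))) \<le> 0" if "s \<in> {-\<bar>t\<bar>..\<bar>t\<bar>}" for s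
        using P(3)[OF fS[OF \<Phi>W[OF s[OF that] \<open>x \<in> ball x0 r\<close>]]] by (simp add: q_def)
    qed auto
    then have "q (\<Phi> (t, x)) = q x" using \<Phi>0[OF that(2)] by simp
    then have "\<Phi> (t, x) - x = P (\<Phi> (t, x)) - P x" by (simp add: q_def algebra_simps)
    then show ?thesis using subspace_diff[OF \<open>subspace S\<close> P(2) P(2)] by simp
  qed
  show ?thesis
  proof (rule that[OF G(4) x0V _ G(9) Gx0 dG])
    show "V \<subseteq> W"
    proof
      fix x assume "x \<in> V"
      then have "x = \<Phi> (\<tau> (G x), \<sigma> (G x))" using G(8) by (simp add: \<Psi>_def)
      then show "x \<in> W" using \<Phi>W[OF N[OF GN(1)[OF \<open>x \<in> V\<close>]]] by simp
    qed
    show "D (f x) = f x0" if "x \<in> V" "(G has_derivative D) (at x)" for x D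
      using inv[OF that, of ?X] \<Psi>'X[OF GN(1)[OF that(1)]] G(8)[OF that(1)] by simp
    show "G x - x \<in> S" if "x \<in> V" for x
    proof -
      let ?y = "G x"
      have "x = \<Phi> (\<tau> ?y, \<sigma> ?y)" using G(8) that by (simp add: \<Psi>_def)
      then have "x - \<sigma> ?y \<in> S" using stay[OF N[OF GN(1)[OF that]]] by simp
      moreover have "\<tau> ?y *\<^sub>R ?X \<in> S" by (intro subspace_scale \<open>subspace S\<close> fS assms)
      ultimately have "\<tau> ?y *\<^sub>R ?X - (x - \<sigma> ?y) \<in> S" by (rule subspace_diff[OF \<open>subspace S\<close>, rotated])
      then show ?thesis by (simp add: \<sigma>_def algebra_simps)
    qed
  qed
qed

text \<open>
  Take \<open>F = G + R (p - A G)\<close> for the coordinates \<open>G\<close> of a flow box. Its derivative at \<open>x0\<close> is the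
  identity because \<open>A\<close> is the derivative of \<open>p\<close> and that of \<open>G\<close> is the identity there. Since \<open>A R\<close> is
  the identity, \<open>A F = p\<close> on \<open>S\<close>. In these coordinates the field is
  \<open>f x0 + R (E (f x)) - R (A (f x0))\<close>, where \<open>E\<close> is the derivative of \<open>p\<close> at \<open>x\<close>, and this lies in
  the range of \<open>R\<close> as soon as \<open>R (A (f x0)) = f x0\<close>; as \<open>A (f x0) \<noteq> 0\<close>, some right inverse satisfies
  this.
\<close>

lemma transversal_normal_form:
  fixes f :: "'e::euclidean_space \<Rightarrow> 'e" and p :: "'e \<Rightarrow> 'f::euclidean_space"
  assumes "open W" "smooth_on W f" "smooth_on W p" "x0 \<in> W"
    and S: "subspace S" and T: "subspace T"
    and fS: "\<And>x. x \<in> W \<Longrightarrow> f x \<in> S" and pT: "\<And>x. x \<in> W \<Longrightarrow> p x \<in> T"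
    and A: "(p has_derivative A) (at x0)" and surj: "A ` S = T" and ne: "A (f x0) \<noteq> 0"
  obtains U V F \<Theta> R where "open U" "x0 \<in> U" "U \<subseteq> W" "open V" "F ` U = V" "\<Theta> ` V = U"
    "\<And>x. x \<in> U \<Longrightarrow> \<Theta> (F x) = x" "\<And>z. z \<in> V \<Longrightarrow> F (\<Theta> z) = z"
    "smooth_on U F" "smooth_on V \<Theta>"
    "linear R" "\<And>t. R t \<in> S" "\<And>t. t \<in> T \<Longrightarrow> A (R t) = t"
    "\<And>x. x \<in> U \<Longrightarrow> F x \<in> S \<longleftrightarrow> x \<in> S"
    "\<And>x. x \<in> U \<Longrightarrow> x \<in> S \<Longrightarrow> A (F x) = p x"
    "\<And>x D E. x \<in> U \<Longrightarrow> (F has_derivative D) (at x) \<Longrightarrow> (p has_derivative E) (at x) \<Longrightarrow> D (f x) = R (E (f x))"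
proof -
  have blA: "bounded_linear A" using A by (rule has_derivative_bounded_linear)
  then have linA: "linear A" by (rule bounded_linear.linear)
  let ?X = "f x0"
  have XS: "?X \<in> S" using fS assms(4) by blast
  have ne0: "?X \<noteq> 0" using ne linear_0[OF linA] by auto
  obtain U0 G where G: "open U0" "x0 \<in> U0" "U0 \<subseteq> W" "smooth_on U0 G" "G x0 = x0"
    "(G has_derivative (\<lambda>v. v)) (at x0)"
    "\<And>x D. x \<in> U0 \<Longrightarrow> (G has_derivative D) (at x) \<Longrightarrow> D (f x) = ?X"
    "\<And>x. x \<in> U0 \<Longrightarrow> G x - x \<in> S"
    by (rule flow_box[OF assms(1,2,4) ne0 S], rule fS, assumption, rule that)
  \<comment> \<open>a right inverse of \<open>A\<close> whose range contains the value of the field at \<open>x0\<close>\<close>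
  obtain R0 where R0: "range R0 \<subseteq> S" "linear R0" "\<forall>v\<in>A ` S. A (R0 v) = v"
    using linear_exists_right_inverse_on[OF linA S] by blast
  let ?a = "A ?X"
  define R where "R = (\<lambda>t. R0 t + (t \<bullet> (?a /\<^sub>R (?a \<bullet> ?a))) *\<^sub>R (?X - R0 ?a))"
  have aT: "?a \<in> T" using surj XS by blast
  have linR: "linear R"
    unfolding R_def
    by (intro linear_compose_add R0(2) bounded_linear.linear[OF bounded_linear_scaleR_const[OF bounded_linear_inner_left]])
  then have blR: "bounded_linear R" by (simp add: linear_conv_bounded_linear)
  have RS: "R t \<in> S" for t
    unfolding R_def using R0(1) XS by (intro subspace_add subspace_scale subspace_diff S) auto
  have AR: "A (R t) = t" if "t \<in> T" for t
    using R0(3) that aT surj by (simp add: R_def linear_add[OF linA] linear_scale[OF linA] linear_diff[OF linA])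
  have Ra: "R ?a = ?X" using ne by (simp add: R_def)
  define F where "F = (\<lambda>x. G x + R (p x - A (G x)))"
  have "smooth_on U0 F"
    unfolding smooth_on_def
  proof
    fix k
    have "Ck_on k U0 p" using assms(3) Ck_on_subset[OF _ G(3)] by (auto simp: smooth_on_def)
    moreover have "Ck_on k U0 G" using G(4) by (auto simp: smooth_on_def)
    ultimately show "Ck_on k U0 F"
      unfolding F_def by (intro Ck_on_add Ck_on_diff Ck_on_linear_compose[OF blR] Ck_on_linear_compose[OF blA])
  qed
  have dF: "(F has_derivative (\<lambda>v. D v + R (E v - A (D v)))) (at x)"
    if "(G has_derivative D) (at x)" "(p has_derivative E) (at x)" for x D E
    unfolding F_def
    by (intro has_derivative_add has_derivative_diff bounded_linear.has_derivative[OF blR]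
        bounded_linear.has_derivative[OF blA] that)
  have dF0: "(F has_derivative (\<lambda>v. v)) (at x0)"
    using dF[OF G(6) A] by (simp add: linear_0[OF linR])
  obtain U V \<Theta> where U: "open U" "x0 \<in> U" "U \<subseteq> U0" "open V" "F ` U = V" "\<Theta> ` V = U"
    "\<And>x. x \<in> U \<Longrightarrow> \<Theta> (F x) = x" "\<And>z. z \<in> V \<Longrightarrow> F (\<Theta> z) = z" "smooth_on V \<Theta>"
    by (rule smooth_inverse_function[OF G(1) \<open>smooth_on U0 F\<close> G(2) dF0], rule that)
  have FS: "F x - x \<in> S" if "x \<in> U" for x
  proof -
    have "(G x - x) + R (p x - A (G x)) \<in> S"
      using G(8) that U(3) by (intro subspace_add S RS) auto
    then show ?thesis by (simp add: F_def algebra_simps)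
  qed
  show ?thesis
  proof (rule that[OF U(1,2) _ U(4-8) _ U(9) linR RS AR])
    show "U \<subseteq> W" using U(3) G(3) by blast
    show "smooth_on U F"
      using \<open>smooth_on U0 F\<close> Ck_on_subset[OF _ U(3)] unfolding smooth_on_def by blast
    show "F x \<in> S \<longleftrightarrow> x \<in> S" if "x \<in> U" for x
      using subspace_add[OF S FS[OF that], of x] subspace_diff[OF S _ FS[OF that], of "F x"] by auto
    show "A (F x) = p x" if "x \<in> U" "x \<in> S" for x
    proof -
      have "(G x - x) + x \<in> S" using G(8) that U(3) by (intro subspace_add S) auto
      then have "A (G x) \<in> T" using surj by auto
      moreover have "p x \<in> T" using pT that U(3) G(3) by blast
      ultimately have "A (R (p x - A (G x))) = p x - A (G x)"
        by (intro AR subspace_diff T)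
      then show ?thesis by (simp add: F_def linear_add[OF linA])
    qed
    show "D (f x) = R (E (f x))"
      if "x \<in> U" "(F has_derivative D) (at x)" "(p has_derivative E) (at x)" for x D E
    proof -
      have x: "x \<in> U0" using that U(3) by blast
      obtain G' where G': "(G has_derivative blinfun_apply G') (at x)"
        using smooth_on_openE[OF G(1,4)] x by metis
      have "D = (\<lambda>v. G' v + R (E v - A (G' v)))"
        using dF[OF G' that(3)] that(2) has_derivative_unique by blast
      then have "D (f x) = ?X + R (E (f x) - ?a)" using G(7)[OF x G'] by simp
      then show ?thesis using Ra by (simp add: linear_diff[OF linR])
    qed
  qed
qed

section \<open>Charts, open submanifolds and products\<close>

text \<open>
  The part of the definition of a smooth manifold that concerns charts, to which all local
  computations refer.
\<close>

definition charted_space :: "('a, 'e::euclidean_space) manifold \<Rightarrow> bool" where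
  "charted_space M \<longleftrightarrow>
     subspace (model M) \<and> (\<forall>c\<in>atlas M. is_chart (mtop M) (model M) c) \<and>
     (\<Union>(V, \<phi>)\<in>atlas M. V) = carrier_of M \<and>
     (\<forall>(V, \<phi>)\<in>atlas M. \<forall>(W, \<psi>)\<in>atlas M. smooth_on (\<phi> ` (V \<inter> W)) (\<psi> \<circ> inv_into V \<phi>))"

lemma smooth_manifold_iff:
  "smooth_manifold M \<longleftrightarrow>
    Hausdorff_space (mtop M) \<and> second_countable_space (mtop M) \<and> charted_space M"
  by (auto simp: smooth_manifold_def charted_space_def)

lemma smooth_on_cong: "(\<And>x. x \<in> U \<Longrightarrow> f x = g x) \<Longrightarrow> smooth_on U f \<longleftrightarrow> smooth_on U g"
  unfolding smooth_on_def using Ck_on_cong by blast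

lemma smooth_on_eq: "smooth_on U g \<Longrightarrow> (\<And>x. x \<in> U \<Longrightarrow> f x = g x) \<Longrightarrow> smooth_on U f"
  using smooth_on_cong[of U f g] by simp

lemma smooth_on_subset: "smooth_on U f \<Longrightarrow> V \<subseteq> U \<Longrightarrow> smooth_on V f"
  unfolding smooth_on_def using Ck_on_subset by blast

lemma smooth_on_compose:
  fixes f :: "'a::real_normed_vector \<Rightarrow> 'b::euclidean_space"
  shows "smooth_on U f \<Longrightarrow> smooth_on V g \<Longrightarrow> f ` U \<subseteq> V \<Longrightarrow> smooth_on U (\<lambda>x. g (f x))"
  unfolding smooth_on_def using Ck_on_compose by blast

lemma smooth_on_Pair: "smooth_on U f \<Longrightarrow> smooth_on U g \<Longrightarrow> smooth_on U (\<lambda>x. (f x, g x))"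
  unfolding smooth_on_def using Ck_on_Pair by blast

lemma smooth_on_linear: "bounded_linear f \<Longrightarrow> smooth_on U f"
  unfolding smooth_on_def using Ck_on_linear by blast

lemma smooth_on_imp_continuous_on: "smooth_on U f \<Longrightarrow> continuous_on U f"
  unfolding smooth_on_def using Ck_on_imp_continuous_on by blast

lemma smooth_on_add: "smooth_on U f \<Longrightarrow> smooth_on U g \<Longrightarrow> smooth_on U (\<lambda>x. f x + g x)"
  unfolding smooth_on_def using Ck_on_add by blast

context
  fixes M :: "('a, 'e::euclidean_space) manifold" and V \<phi>
  assumes M: "charted_space M" and V\<phi>: "(V, \<phi>) \<in> atlas M"
begin

lemma chart_is_chart: "is_chart (mtop M) (model M) (V, \<phi>)"
  using M V\<phi> by (auto simp: charted_space_def)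

lemma chart_openin: "openin (mtop M) V"
  using chart_is_chart by (simp add: is_chart_def)

lemma chart_subset: "V \<subseteq> carrier_of M"
  using openin_subset[OF chart_openin] .

lemma chart_image_openin: "openin (top_of_set (model M)) (\<phi> ` V)"
  using chart_is_chart by (simp add: is_chart_def)

lemma chart_in_model: "p \<in> V \<Longrightarrow> \<phi> p \<in> model M"
  using openin_subset[OF chart_image_openin] by auto

lemma chart_homeomorphic: "homeomorphic_map (subtopology (mtop M) V) (top_of_set (\<phi> ` V)) \<phi>"
  using chart_is_chart by (simp add: is_chart_def)

lemma chart_topspace: "topspace (subtopology (mtop M) V) = V"
  using chart_subset by auto

lemma chart_inj: "inj_on \<phi> V"
  using homeomorphic_imp_injective_map[OF chart_homeomorphic] chart_topspace by simp

lemma chart_inv: "p \<in> V \<Longrightarrow> inv_into V \<phi> (\<phi> p) = p"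
  using chart_inj by simp

lemma chart_open_image:
  assumes "openin (mtop M) Z" "Z \<subseteq> V"
  shows "openin (top_of_set (model M)) (\<phi> ` Z)"
proof -
  have "openin (subtopology (mtop M) V) Z"
    using assms chart_openin openin_open_subtopology by blast
  then have "openin (top_of_set (\<phi> ` V)) (\<phi> ` Z)"
    using homeomorphic_map_openness[OF chart_homeomorphic, of Z] assms(2) chart_topspace by auto
  then show ?thesis using chart_image_openin openin_trans by blast
qed

lemma chart_preimage_open:
  assumes "open B"
  shows "openin (mtop M) {p \<in> V. \<phi> p \<in> B}"
proof -
  have "continuous_map (subtopology (mtop M) V) (top_of_set (\<phi> ` V)) \<phi>"
    by (rule homeomorphic_imp_continuous_map[OF chart_homeomorphic])
  then have "continuous_map (subtopology (mtop M) V) euclidean \<phi>"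
    using continuous_map_in_subtopology by blast
  from openin_continuous_map_preimage[OF this, of B]
  have "openin (subtopology (mtop M) V) {p \<in> topspace (subtopology (mtop M) V). \<phi> p \<in> B}"
    using assms by simp
  then have "openin (subtopology (mtop M) V) {p \<in> V. \<phi> p \<in> B}"
    unfolding chart_topspace .
  then show ?thesis using chart_openin openin_trans_full by blast
qed

lemma chart_inv_continuous: "continuous_map (top_of_set (\<phi> ` V)) (mtop M) (inv_into V \<phi>)"
proof -
  obtain g where "homeomorphic_maps (subtopology (mtop M) V) (top_of_set (\<phi> ` V)) \<phi> g"
    using chart_homeomorphic unfolding homeomorphic_map_maps by blast
  then have g: "continuous_map (top_of_set (\<phi> ` V)) (subtopology (mtop M) V) g"
    "\<And>p. p \<in> V \<Longrightarrow> g (\<phi> p) = p"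
    using chart_topspace by (simp_all add: homeomorphic_maps_def)
  have "continuous_map (top_of_set (\<phi> ` V)) (mtop M) g"
    using g(1) continuous_map_in_subtopology by blast
  then show ?thesis
    by (rule continuous_map_eq) (auto simp: g(2) chart_inv)
qed

end

lemma chart_transition:
  assumes "charted_space M" "(V, \<phi>) \<in> atlas M" "(W, \<psi>) \<in> atlas M"
  shows "smooth_on (\<phi> ` (V \<inter> W)) (\<lambda>y. \<psi> (inv_into V \<phi> y))"
proof -
  have "\<forall>(V, \<phi>)\<in>atlas M. \<forall>(W, \<psi>)\<in>atlas M. smooth_on (\<phi> ` (V \<inter> W)) (\<psi> \<circ> inv_into V \<phi>)"
    using assms(1) unfolding charted_space_def by (elim conjE)
  from bspec[OF bspec[OF this assms(2), unfolded prod.case] assms(3), unfolded prod.case]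
  show ?thesis by (simp only: o_def)
qed

lemma chart_cover:
  assumes "charted_space M" "p \<in> carrier_of M"
  obtains V \<phi> where "(V, \<phi>) \<in> atlas M" "p \<in> V"
proof -
  have "p \<in> (\<Union>(V, \<phi>)\<in>atlas M. V)"
    using assms by (simp only: charted_space_def)
  then show thesis using that by blast
qed

text \<open>
  Restricting a chart changes its domain, and with it the term for the inverse of the coordinate
  map, but not the values of the inverse on the smaller image.
\<close>

lemma inv_into_chart_restrict:
  assumes "charted_space M" "(V, \<phi>) \<in> atlas M" "y \<in> \<phi> ` (V \<inter> U)"
  shows "inv_into (V \<inter> U) \<phi> y = inv_into V \<phi> y"
proof -
  have "inj_on \<phi> V" by (rule chart_inj[OF assms(1,2)])
  moreover obtain p where "p \<in> V \<inter> U" "y = \<phi> p" using assms(3) by blast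
  ultimately show ?thesis by (metis Int_iff inf_le1 inj_on_subset inv_into_f_f)
qed

lemma open_submanifold_simps [simp]:
  "mtop (open_submanifold M U) = subtopology (mtop M) U"
  "model (open_submanifold M U) = model M"
  "atlas (open_submanifold M U) = (\<lambda>(V, \<phi>). (V \<inter> U, \<phi>)) ` atlas M"
  by (simp_all add: open_submanifold_def)

lemma open_submanifold_chart:
  "(V, \<phi>) \<in> atlas M \<Longrightarrow> (V \<inter> U, \<phi>) \<in> atlas (open_submanifold M U)"
  by (simp add: image_iff split_beta') force

lemma charted_space_open_submanifold:
  assumes M: "charted_space M" and U: "openin (mtop M) U"
  shows "charted_space (open_submanifold M U)"
  unfolding charted_space_def
proof (intro conjI)
  show "subspace (model (open_submanifold M U))"
    using M by (simp add: charted_space_def)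
  have "is_chart (subtopology (mtop M) U) (model M) (V \<inter> U, \<phi>)" if c: "(V, \<phi>) \<in> atlas M" for V \<phi>
    unfolding is_chart_def prod.case
  proof (intro conjI)
    have VU: "openin (mtop M) (V \<inter> U)"
      using chart_openin[OF M c] U by (rule openin_Int)
    then show "openin (subtopology (mtop M) U) (V \<inter> U)"
      by (metis U inf_le2 openin_open_subtopology)
    show "openin (top_of_set (model M)) (\<phi> ` (V \<inter> U))"
      by (rule chart_open_image[OF M c VU]) simp
    have "homeomorphic_map (subtopology (subtopology (mtop M) V) (V \<inter> U))
        (subtopology (top_of_set (\<phi> ` V)) (\<phi> ` (V \<inter> U))) \<phi>"
      by (rule homeomorphic_map_subtopologies[OF chart_homeomorphic[OF M c]])
        (use chart_topspace[OF M c] in auto)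
    moreover have "V \<inter> (V \<inter> U) = U \<inter> (V \<inter> U)" "\<phi> ` V \<inter> \<phi> ` (V \<inter> U) = \<phi> ` (V \<inter> U)" by auto
    ultimately show "homeomorphic_map (subtopology (subtopology (mtop M) U) (V \<inter> U))
        (top_of_set (\<phi> ` (V \<inter> U))) \<phi>"
      by (simp add: subtopology_subtopology)
  qed
  then show "\<forall>c\<in>atlas (open_submanifold M U). is_chart (mtop (open_submanifold M U)) (model (open_submanifold M U)) c"
    by auto
  have "(\<Union>(V, \<phi>)\<in>atlas M. V) = carrier_of M" using M by (simp add: charted_space_def)
  then show "(\<Union>(V, \<phi>)\<in>atlas (open_submanifold M U). V) = carrier_of (open_submanifold M U)"
    by (auto simp: split_beta)
  have "smooth_on (\<phi> ` ((V \<inter> U) \<inter> (W \<inter> U))) (\<psi> \<circ> inv_into (V \<inter> U) \<phi>)"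
    if c: "(V, \<phi>) \<in> atlas M" and "(W, \<psi>) \<in> atlas M" for V \<phi> W \<psi>
  proof -
    have "smooth_on (\<phi> ` ((V \<inter> U) \<inter> (W \<inter> U))) (\<lambda>y. \<psi> (inv_into V \<phi> y))"
      by (rule smooth_on_subset[OF chart_transition[OF M that]]) auto
    moreover have "inv_into (V \<inter> U) \<phi> y = inv_into V \<phi> y" if "y \<in> \<phi> ` ((V \<inter> U) \<inter> (W \<inter> U))" for y
      by (rule inv_into_chart_restrict[OF M c]) (use that in auto)
    ultimately show ?thesis
      by (subst smooth_on_cong[where g = "\<lambda>y. \<psi> (inv_into V \<phi> y)"]) simp_all
  qed
  then show "\<forall>(V, \<phi>)\<in>atlas (open_submanifold M U). \<forall>(W, \<psi>)\<in>atlas (open_submanifold M U).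
      smooth_on (\<phi> ` (V \<inter> W)) (\<psi> \<circ> inv_into V \<phi>)"
    by auto
qed

lemma second_countable_subtopology:
  assumes "second_countable_space X"
  shows "second_countable_space (subtopology X U)"
proof -
  obtain \<B> where B: "countable \<B>" "\<forall>B\<in>\<B>. openin X B"
    "\<And>W x. openin X W \<Longrightarrow> x \<in> W \<Longrightarrow> \<exists>B\<in>\<B>. x \<in> B \<and> B \<subseteq> W"
    using assms unfolding second_countable_space_def by metis
  show ?thesis
    unfolding second_countable_space_def
  proof (intro exI conjI allI impI)
    show "countable ((\<lambda>B. B \<inter> U) ` \<B>)" using B(1) by blast
    show "\<forall>B\<in>(\<lambda>B. B \<inter> U) ` \<B>. openin (subtopology X U) B"
      using B(2) by (auto simp: openin_subtopology)
    fix W x assume "openin (subtopology X U) W \<and> x \<in> W"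
    then obtain W' where W': "openin X W'" "W = W' \<inter> U" "x \<in> W'" "x \<in> U"
      unfolding openin_subtopology by blast
    obtain b where "b \<in> \<B>" "x \<in> b" "b \<subseteq> W'" using B(3)[OF W'(1,3)] by blast
    then show "\<exists>B\<in>(\<lambda>B. B \<inter> U) ` \<B>. x \<in> B \<and> B \<subseteq> W" using W' by (intro bexI[of _ "b \<inter> U"]) auto
  qed
qed

lemma smooth_manifold_open_submanifold:
  assumes "smooth_manifold M" "openin (mtop M) U"
  shows "smooth_manifold (open_submanifold M U)"
  using assms charted_space_open_submanifold second_countable_subtopology Hausdorff_space_subtopology
  unfolding smooth_manifold_iff by auto

lemma smooth_manifold_open_subset:
  fixes K B :: "'e::euclidean_space set"
  assumes "subspace K" "openin (top_of_set K) B"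
  shows "smooth_manifold \<lparr> mtop = top_of_set B, model = K, atlas = {(B, \<lambda>x. x)} \<rparr>"
  unfolding smooth_manifold_def
proof (intro conjI)
  have "second_countable_space (euclidean :: 'e topology)"
  proof -
    obtain \<B> :: "'e set set" where B: "countable \<B>" "topological_basis \<B>"
      using ex_countable_basis by blast
    show ?thesis
      unfolding second_countable_space_def
    proof (intro exI conjI allI impI)
      show "\<forall>b\<in>\<B>. openin euclidean b" using B(2) topological_basis_open by auto
      show "\<exists>b\<in>\<B>. x \<in> b \<and> b \<subseteq> U" if "openin euclidean U \<and> x \<in> U" for U x
        using topological_basisE[OF B(2), of U x] that by (metis open_openin)
    qed (rule B(1))
  qed
  then show "second_countable_space (mtop \<lparr> mtop = top_of_set B, model = K, atlas = {(B, \<lambda>x. x)} \<rparr>)"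
    by (simp add: second_countable_subtopology)
  have "inv_into B (\<lambda>x. x) y = y" if "y \<in> B" for y
    using inv_into_f_f[of "\<lambda>x. x" B y] that by (simp add: inj_on_def)
  then have "smooth_on B ((\<lambda>x. x) \<circ> inv_into B (\<lambda>x. x))"
    by (subst smooth_on_cong[where g = "\<lambda>y. y"]) (simp_all add: smooth_on_linear bounded_linear_ident)
  then show "\<forall>(V, \<phi>)\<in>atlas \<lparr> mtop = top_of_set B, model = K, atlas = {(B, \<lambda>x. x)} \<rparr>.
      \<forall>(W, \<psi>)\<in>atlas \<lparr> mtop = top_of_set B, model = K, atlas = {(B, \<lambda>x. x)} \<rparr>.
        smooth_on (\<phi> ` (V \<inter> W)) (\<psi> \<circ> inv_into V \<phi>)"
    by simp
  have "homeomorphic_map (top_of_set B) (top_of_set B) (\<lambda>x. x)"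
    using homeomorphic_map_id[of "top_of_set B" "top_of_set B"] by (simp add: id_def)
  then show "\<forall>c\<in>atlas \<lparr> mtop = top_of_set B, model = K, atlas = {(B, \<lambda>x. x)} \<rparr>.
      is_chart (mtop \<lparr> mtop = top_of_set B, model = K, atlas = {(B, \<lambda>x. x)} \<rparr>)
        (model \<lparr> mtop = top_of_set B, model = K, atlas = {(B, \<lambda>x. x)} \<rparr>) c"
    using assms(2) by (simp add: is_chart_def subtopology_subtopology)
qed (use assms(1) in \<open>simp_all add: Hausdorff_space_subtopology\<close>)

lemma charted_space_product:
  fixes M :: "('a, 'e::euclidean_space) manifold" and N :: "('b, 'f::euclidean_space) manifold"
  assumes M: "charted_space M" and N: "charted_space N"
  shows "charted_space (product_manifold M N)"
  unfolding charted_space_def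
proof (intro conjI)
  have simps: "mtop (product_manifold M N) = prod_topology (mtop M) (mtop N)"
    "model (product_manifold M N) = model M \<times> model N"
    "atlas (product_manifold M N) = {(V \<times> W, map_prod \<phi> \<psi>) |V \<phi> W \<psi>. (V, \<phi>) \<in> atlas M \<and> (W, \<psi>) \<in> atlas N}"
    by (simp_all add: product_manifold_def)
  show "subspace (model (product_manifold M N))"
    using M N by (simp add: simps charted_space_def subspace_Times)
  have "is_chart (prod_topology (mtop M) (mtop N)) (model M \<times> model N) (V \<times> W, map_prod \<phi> \<psi>)"
    if c: "(V, \<phi>) \<in> atlas M" "(W, \<psi>) \<in> atlas N" for V \<phi> W \<psi>
    unfolding is_chart_def prod.case
  proof (intro conjI)
    have im: "map_prod \<phi> \<psi> ` (V \<times> W) = \<phi> ` V \<times> \<psi> ` W" by (rule map_prod_surj_on) auto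
    show "openin (prod_topology (mtop M) (mtop N)) (V \<times> W)"
      using chart_openin[OF M c(1)] chart_openin[OF N c(2)] by (simp add: openin_prod_Times_iff)
    show "openin (top_of_set (model M \<times> model N)) (map_prod \<phi> \<psi> ` (V \<times> W))"
      unfolding im by (rule openin_Times[OF chart_image_openin[OF M c(1)] chart_image_openin[OF N c(2)]])
    obtain g h where gh: "homeomorphic_maps (subtopology (mtop M) V) (top_of_set (\<phi> ` V)) \<phi> g"
      "homeomorphic_maps (subtopology (mtop N) W) (top_of_set (\<psi> ` W)) \<psi> h"
      using chart_homeomorphic[OF M c(1)] chart_homeomorphic[OF N c(2)] unfolding homeomorphic_map_maps by blast
    then have "homeomorphic_maps (prod_topology (subtopology (mtop M) V) (subtopology (mtop N) W))
        (prod_topology (top_of_set (\<phi> ` V)) (top_of_set (\<psi> ` W))) (\<lambda>(x, y). (\<phi> x, \<psi> y)) (\<lambda>(x, y). (g x, h y))"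
      using homeomorphic_maps_prod by blast
    then have "homeomorphic_map (prod_topology (subtopology (mtop M) V) (subtopology (mtop N) W))
        (top_of_set (\<phi> ` V \<times> \<psi> ` W)) (map_prod \<phi> \<psi>)"
      unfolding map_prod_def homeomorphic_map_maps by auto
    then show "homeomorphic_map (subtopology (prod_topology (mtop M) (mtop N)) (V \<times> W))
        (top_of_set (map_prod \<phi> \<psi> ` (V \<times> W))) (map_prod \<phi> \<psi>)"
      unfolding im subtopology_Times .
  qed
  note charts = this
  show "\<forall>c\<in>atlas (product_manifold M N). is_chart (mtop (product_manifold M N)) (model (product_manifold M N)) c"
  proof
    fix c assume "c \<in> atlas (product_manifold M N)"
    then show "is_chart (mtop (product_manifold M N)) (model (product_manifold M N)) c"
      unfolding simps mem_Collect_eq by (elim exE conjE) (simp only: charts)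
  qed
  show "(\<Union>(V, \<phi>)\<in>atlas (product_manifold M N). V) = carrier_of (product_manifold M N)"
  proof (intro subset_antisym subsetI)
    fix x assume "x \<in> (\<Union>(V, \<phi>)\<in>atlas (product_manifold M N). V)"
    then obtain c where "c \<in> atlas (product_manifold M N)" "x \<in> fst c" by auto
    then obtain V \<phi> W \<psi> where c: "(V, \<phi>) \<in> atlas M" "(W, \<psi>) \<in> atlas N" and x: "x \<in> V \<times> W"
      unfolding simps by auto
    have "V \<times> W \<subseteq> carrier_of M \<times> carrier_of N"
      using chart_subset[OF M c(1)] chart_subset[OF N c(2)] by blast
    then show "x \<in> carrier_of (product_manifold M N)" using x by (auto simp: simps)
  next
    fix x assume "x \<in> carrier_of (product_manifold M N)"
    then have x: "fst x \<in> carrier_of M" "snd x \<in> carrier_of N" by (auto simp: simps)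
    obtain V \<phi> where c: "(V, \<phi>) \<in> atlas M" "fst x \<in> V" by (rule chart_cover[OF M x(1)])
    obtain W \<psi> where d: "(W, \<psi>) \<in> atlas N" "snd x \<in> W" by (rule chart_cover[OF N x(2)])
    have "(V \<times> W, map_prod \<phi> \<psi>) \<in> atlas (product_manifold M N)"
      unfolding simps using c(1) d(1) by blast
    moreover have "x \<in> V \<times> W" using c d by (simp add: mem_Times_iff)
    ultimately show "x \<in> (\<Union>(V, \<phi>)\<in>atlas (product_manifold M N). V)" by blast
  qed
  have "smooth_on (map_prod \<phi> \<psi> ` (V \<times> W \<inter> V' \<times> W')) (map_prod \<phi>' \<psi>' \<circ> inv_into (V \<times> W) (map_prod \<phi> \<psi>))"
    if c: "(V, \<phi>) \<in> atlas M" "(W, \<psi>) \<in> atlas N" "(V', \<phi>') \<in> atlas M" "(W', \<psi>') \<in> atlas N"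
    for V \<phi> W \<psi> V' \<phi>' W' \<psi>'
  proof -
    let ?D = "map_prod \<phi> \<psi> ` (V \<times> W \<inter> V' \<times> W')"
    have inj: "inj_on (map_prod \<phi> \<psi>) (V \<times> W)"
      using map_prod_inj_on[OF chart_inj[OF M c(1)] chart_inj[OF N c(2)]] .
    have "smooth_on ?D (\<lambda>y. (\<phi>' (inv_into V \<phi> (fst y)), \<psi>' (inv_into W \<psi> (snd y))))"
    proof (rule smooth_on_Pair)
      show "smooth_on ?D (\<lambda>y. \<phi>' (inv_into V \<phi> (fst y)))"
        by (rule smooth_on_compose[OF smooth_on_linear[OF bounded_linear_fst] chart_transition[OF M c(1,3)]]) auto
      show "smooth_on ?D (\<lambda>y. \<psi>' (inv_into W \<psi> (snd y)))"
        by (rule smooth_on_compose[OF smooth_on_linear[OF bounded_linear_snd] chart_transition[OF N c(2,4)]]) auto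
    qed
    moreover have "(map_prod \<phi>' \<psi>' \<circ> inv_into (V \<times> W) (map_prod \<phi> \<psi>)) y
        = (\<phi>' (inv_into V \<phi> (fst y)), \<psi>' (inv_into W \<psi> (snd y)))" if y: "y \<in> ?D" for y
    proof -
      obtain a b where ab: "y = map_prod \<phi> \<psi> (a, b)" "a \<in> V" "b \<in> W" using y by auto
      then have "inv_into (V \<times> W) (map_prod \<phi> \<psi>) y = (a, b)"
        using inv_into_f_f[OF inj, of "(a, b)"] by simp
      then show ?thesis using ab chart_inv[OF M c(1)] chart_inv[OF N c(2)] by simp
    qed
    ultimately show ?thesis by (rule smooth_on_eq)
  qed
  note transition = this
  show "\<forall>(V, \<phi>)\<in>atlas (product_manifold M N). \<forall>(W, \<psi>)\<in>atlas (product_manifold M N).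
      smooth_on (\<phi> ` (V \<inter> W)) (\<psi> \<circ> inv_into V \<phi>)"
  proof (intro ballI, clarify)
    fix V \<phi> W \<psi>
    assume V: "(V, \<phi>) \<in> atlas (product_manifold M N)" and W: "(W, \<psi>) \<in> atlas (product_manifold M N)"
    obtain V1 \<phi>1 V2 \<phi>2 where c: "V = V1 \<times> V2" "\<phi> = map_prod \<phi>1 \<phi>2"
      "(V1, \<phi>1) \<in> atlas M" "(V2, \<phi>2) \<in> atlas N"
      using V unfolding simps mem_Collect_eq prod.inject by (elim exE conjE) (rule that)
    obtain W1 \<psi>1 W2 \<psi>2 where d: "W = W1 \<times> W2" "\<psi> = map_prod \<psi>1 \<psi>2"
      "(W1, \<psi>1) \<in> atlas M" "(W2, \<psi>2) \<in> atlas N"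
      using W unfolding simps mem_Collect_eq prod.inject by (elim exE conjE) (rule that)
    show "smooth_on (\<phi> ` (V \<inter> W)) (\<psi> \<circ> inv_into V \<phi>)"
      unfolding c(1,2) d(1,2) by (rule transition[OF c(3,4) d(3,4)])
  qed
qed

lemma smooth_mapD:
  assumes "smooth_map M N f" "(V, \<phi>) \<in> atlas M" "(W, \<psi>) \<in> atlas N"
  shows "smooth_on (\<phi> ` (V \<inter> f -` W)) (\<lambda>y. \<psi> (f (inv_into V \<phi> y)))"
proof -
  have "\<forall>(V, \<phi>)\<in>atlas M. \<forall>(W, \<psi>)\<in>atlas N. smooth_on (\<phi> ` (V \<inter> f -` W)) (\<psi> \<circ> f \<circ> inv_into V \<phi>)"
    using assms(1) unfolding smooth_map_def by (elim conjE)
  from bspec[OF bspec[OF this assms(2), unfolded prod.case] assms(3), unfolded prod.case]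
  show ?thesis by (simp only: o_def)
qed

text \<open>
  If one chart of the source and one of the target suffice to cover everything in sight, smoothness
  need only be checked in these, because all other charts are smoothly compatible with them.
\<close>

lemma smooth_map_from_single_chart:
  fixes M :: "('a, 'e::euclidean_space) manifold" and N :: "('b, 'f::euclidean_space) manifold"
  assumes M: "charted_space M" and N: "charted_space N"
    and c: "(V, \<phi>) \<in> atlas M" "carrier_of M \<subseteq> V" and d: "(W, \<psi>) \<in> atlas N"
    and f: "\<And>p. p \<in> carrier_of M \<Longrightarrow> f p \<in> W" "\<And>p. p \<in> carrier_of M \<Longrightarrow> \<psi> (f p) = g (\<phi> p)"
    and g: "smooth_on (\<phi> ` V) g"
  shows "smooth_map M N f"
  unfolding smooth_map_def
proof
  have V: "V = carrier_of M" using c(2) chart_subset[OF M c(1)] by blast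
  have gW: "g ` \<phi> ` V \<subseteq> \<psi> ` W" using f V by force
  have cont\<phi>: "continuous_map (mtop M) (top_of_set (\<phi> ` V)) \<phi>"
    using homeomorphic_imp_continuous_map[OF chart_homeomorphic[OF M c(1)]] V by simp
  have contg: "continuous_map (top_of_set (\<phi> ` V)) (top_of_set (\<psi> ` W)) g"
    using smooth_on_imp_continuous_on[OF g] gW by (simp add: continuous_map_in_subtopology image_subset_iff_funcset)
  have "continuous_map (mtop M) (mtop N) (inv_into W \<psi> \<circ> (g \<circ> \<phi>))"
    by (rule continuous_map_compose[OF continuous_map_compose[OF cont\<phi> contg] chart_inv_continuous[OF N d]])
  then show "continuous_map (mtop M) (mtop N) f"
    by (rule continuous_map_eq) (use f chart_inv[OF N d] in \<open>simp flip: f(2)\<close>)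
  have "smooth_on (\<phi>' ` (V' \<inter> f -` W')) (\<psi>' \<circ> f \<circ> inv_into V' \<phi>')"
    if c': "(V', \<phi>') \<in> atlas M" and d': "(W', \<psi>') \<in> atlas N" for V' \<phi>' W' \<psi>'
  proof -
    let ?D = "\<phi>' ` (V' \<inter> f -` W')"
    have V': "V' \<subseteq> V" using chart_subset[OF M c'] V by blast
    have "smooth_on ?D (\<lambda>y. \<phi> (inv_into V' \<phi>' y))"
      by (rule smooth_on_subset[OF chart_transition[OF M c' c(1)]]) (use V' in auto)
    then have "smooth_on ?D (\<lambda>y. g (\<phi> (inv_into V' \<phi>' y)))"
      by (rule smooth_on_compose[OF _ g]) (use V' chart_inv[OF M c'] in auto)
    then have "smooth_on ?D (\<lambda>y. \<psi>' (inv_into W \<psi> (g (\<phi> (inv_into V' \<phi>' y)))))"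
    proof (rule smooth_on_compose[OF _ chart_transition[OF N d d']])
      show "(\<lambda>y. g (\<phi> (inv_into V' \<phi>' y))) ` ?D \<subseteq> \<psi> ` (W \<inter> W')"
      proof (rule image_subsetI)
        fix y assume "y \<in> ?D"
        then obtain p where p: "p \<in> V'" "f p \<in> W'" "y = \<phi>' p" by auto
        then have "p \<in> carrier_of M" using V' V by blast
        then have "g (\<phi> (inv_into V' \<phi>' y)) = \<psi> (f p)" "f p \<in> W"
          using f p chart_inv[OF M c' p(1)] by simp_all
        then show "g (\<phi> (inv_into V' \<phi>' y)) \<in> \<psi> ` (W \<inter> W')" using p by simp
      qed
    qed
    moreover have "(\<psi>' \<circ> f \<circ> inv_into V' \<phi>') y = \<psi>' (inv_into W \<psi> (g (\<phi> (inv_into V' \<phi>' y))))" if y: "y \<in> ?D" for y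
    proof -
      obtain p where p: "p \<in> V'" "y = \<phi>' p" using y by auto
      then have "p \<in> carrier_of M" using V' V by blast
      then show ?thesis using p f chart_inv[OF M c' p(1)] chart_inv[OF N d] by (simp flip: f(2))
    qed
    ultimately show ?thesis by (rule smooth_on_eq)
  qed
  note in_charts = this
  show "\<forall>(V, \<phi>)\<in>atlas M. \<forall>(W, \<psi>)\<in>atlas N. smooth_on (\<phi> ` (V \<inter> f -` W)) (\<psi> \<circ> f \<circ> inv_into V \<phi>)"
    by (intro ballI, clarify) (rule in_charts)
qed

lemma smooth_map_restrict:
  assumes M: "charted_space M" and f: "smooth_map M N f" and fU: "f ` U \<subseteq> U'"
  shows "smooth_map (open_submanifold M U) (open_submanifold N U') f"
  unfolding smooth_map_def
proof
  have "continuous_map (mtop M) (mtop N) f" using f by (simp add: smooth_map_def)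
  then have "continuous_map (subtopology (mtop M) U) (subtopology (mtop N) U') f"
    using fU by (auto simp: continuous_map_in_subtopology continuous_map_from_subtopology)
  then show "continuous_map (mtop (open_submanifold M U)) (mtop (open_submanifold N U')) f" by simp
  have "smooth_on (\<phi> ` ((V \<inter> U) \<inter> f -` (W \<inter> U'))) (\<psi> \<circ> f \<circ> inv_into (V \<inter> U) \<phi>)"
    if c: "(V, \<phi>) \<in> atlas M" and "(W, \<psi>) \<in> atlas N" for V \<phi> W \<psi>
  proof -
    have "smooth_on (\<phi> ` ((V \<inter> U) \<inter> f -` (W \<inter> U'))) (\<lambda>y. \<psi> (f (inv_into V \<phi> y)))"
      by (rule smooth_on_subset[OF smooth_mapD[OF f that]]) auto
    moreover have "inv_into (V \<inter> U) \<phi> y = inv_into V \<phi> y" if "y \<in> \<phi> ` ((V \<inter> U) \<inter> f -` (W \<inter> U'))" for y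
      by (rule inv_into_chart_restrict[OF M c]) (use that in auto)
    ultimately show ?thesis
      by (subst smooth_on_cong[where g = "\<lambda>y. \<psi> (f (inv_into V \<phi> y))"]) simp_all
  qed
  note in_charts = this
  show "\<forall>(V, \<phi>)\<in>atlas (open_submanifold M U). \<forall>(W, \<psi>)\<in>atlas (open_submanifold N U').
      smooth_on (\<phi> ` (V \<inter> f -` W)) (\<psi> \<circ> f \<circ> inv_into V \<phi>)"
    unfolding open_submanifold_simps by (intro ballI, clarify) (rule in_charts)
qed

section \<open>Tangent vectors in coordinates\<close>

text \<open>
  Continuity of a curve at \<open>0\<close> is only given in coordinates; it carries over to \<open>M\<close> because charts
  are homeomorphisms.
\<close>

lemma curve_eventually_in_open:
  assumes M: "charted_space M" and c: "(V, \<phi>) \<in> atlas M"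
    and Z: "openin (mtop M) Z" and p: "\<gamma> 0 \<in> V" "\<gamma> 0 \<in> Z"
    and ev: "\<forall>\<^sub>F t in at 0. \<gamma> t \<in> V" and cont: "isCont (\<phi> \<circ> \<gamma>) (0::real)"
  shows "\<forall>\<^sub>F t in at 0. \<gamma> t \<in> V \<inter> Z"
proof -
  have "openin (top_of_set (model M)) (\<phi> ` (V \<inter> Z))"
    by (rule chart_open_image[OF M c openin_Int[OF chart_openin[OF M c] Z]]) simp
  then obtain B where B: "open B" "\<phi> ` (V \<inter> Z) = model M \<inter> B"
    unfolding openin_open by blast
  have "\<phi> (\<gamma> 0) \<in> B" using B(2) p by blast
  then have "\<forall>\<^sub>F t in at 0. (\<phi> \<circ> \<gamma>) t \<in> B"
    using topological_tendstoD[OF cont[unfolded isCont_def] B(1)] by simp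
  then show ?thesis
    using ev
  proof eventually_elim
    case (elim t)
    then have "\<phi> (\<gamma> t) \<in> \<phi> ` (V \<inter> Z)" using chart_in_model[OF M c] B(2) by simp
    then obtain x where "x \<in> V \<inter> Z" "\<phi> (\<gamma> t) = \<phi> x" by blast
    then show ?case using inj_onD[OF chart_inj[OF M c], of "\<gamma> t" x] elim(2) by auto
  qed
qed

text \<open>
  In charts, a smooth map acts on velocities of curves by the derivative of its coordinate
  expression. The point of the formulation is that \<open>D\<close> does not depend on the curve; applied to the
  identity, it says that velocities may be compared in any chart.
\<close>

lemma smooth_map_derivative:
  assumes M: "charted_space M" and f: "smooth_map M N f" and N: "charted_space N"
    and c: "(V, \<phi>) \<in> atlas M" and d: "(W, \<psi>) \<in> atlas N" and p: "p \<in> V" "f p \<in> W"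
  obtains D where "bounded_linear D"
    "\<And>\<gamma> w. \<gamma> 0 = p \<Longrightarrow> \<forall>\<^sub>F t in at 0. \<gamma> t \<in> V \<Longrightarrow> ((\<phi> \<circ> \<gamma>) has_vector_derivative w) (at 0) \<Longrightarrow>
      (\<forall>\<^sub>F t in at 0. f (\<gamma> t) \<in> W) \<and> ((\<psi> \<circ> (f \<circ> \<gamma>)) has_vector_derivative D w) (at 0)"
proof -
  let ?g = "\<lambda>y. \<psi> (f (inv_into V \<phi> y))" and ?D = "\<phi> ` (V \<inter> f -` W)"
  define Z where "Z = {x \<in> carrier_of M. f x \<in> W}"
  have Z: "openin (mtop M) Z"
    unfolding Z_def using f chart_openin[OF N d] unfolding smooth_map_def
    by (blast intro: openin_continuous_map_preimage)
  have pZ: "p \<in> Z" using p chart_subset[OF M c] by (auto simp: Z_def)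
  have "Ck_on (Suc 0) ?D ?g" using smooth_mapD[OF f c d] by (simp add: smooth_on_def)
  then obtain D where D: "\<And>y. y \<in> ?D \<Longrightarrow> (?g has_derivative D y) (at y within ?D)"
    unfolding Ck_on.simps(2) by blast
  have "\<phi> p \<in> ?D" using p by blast
  note Dp = D[OF this]
  show ?thesis
  proof
    show "bounded_linear (D (\<phi> p))" using Dp by (rule has_derivative_bounded_linear)
    fix \<gamma> w
    assume \<gamma>: "\<gamma> 0 = p" "\<forall>\<^sub>F t in at 0. \<gamma> t \<in> V" "((\<phi> \<circ> \<gamma>) has_vector_derivative w) (at 0)"
    have "\<forall>\<^sub>F t in at 0. \<gamma> t \<in> V \<inter> Z"
      by (rule curve_eventually_in_open[OF M c Z _ _ \<gamma>(2) has_vector_derivative_continuous[OF \<gamma>(3)]])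
        (use p pZ \<gamma>(1) in auto)
    then obtain J where J: "open J" "0 \<in> J" "\<And>t. t \<in> J \<Longrightarrow> t \<noteq> 0 \<Longrightarrow> \<gamma> t \<in> V \<inter> Z"
      unfolding eventually_at_topological by blast
    have JZ: "\<gamma> t \<in> V \<inter> Z" if "t \<in> J" for t
      using J(3)[OF that] p pZ \<gamma>(1) by (cases "t = 0") auto
    have "\<forall>\<^sub>F t in at 0. f (\<gamma> t) \<in> W"
      unfolding eventually_at_topological using J JZ by (auto simp: Z_def)
    moreover have "((\<psi> \<circ> (f \<circ> \<gamma>)) has_vector_derivative D (\<phi> p) w) (at 0)"
    proof -
      have "((\<phi> \<circ> \<gamma>) has_derivative (\<lambda>h. h *\<^sub>R w)) (at 0 within J)"
        using \<gamma>(3) by (auto simp: has_vector_derivative_def intro: has_derivative_at_withinI)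
      moreover have "(?g has_derivative D (\<phi> p)) (at ((\<phi> \<circ> \<gamma>) 0) within (\<phi> \<circ> \<gamma>) ` J)"
      proof -
        have "(\<phi> \<circ> \<gamma>) ` J \<subseteq> ?D" using JZ by (auto simp: Z_def)
        then show ?thesis using has_derivative_subset[OF Dp] \<gamma>(1) by simp
      qed
      ultimately have "((\<lambda>t. ?g ((\<phi> \<circ> \<gamma>) t)) has_derivative (\<lambda>h. D (\<phi> p) (h *\<^sub>R w))) (at 0 within J)"
        by (rule has_derivative_in_compose)
      then have "((\<lambda>t. ?g ((\<phi> \<circ> \<gamma>) t)) has_derivative (\<lambda>h. h *\<^sub>R D (\<phi> p) w)) (at 0)"
        using at_within_open[OF J(2,1)] linear_cmul[OF bounded_linear.linear[OF has_derivative_bounded_linear[OF Dp]]]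
        by simp
      then have "((\<psi> \<circ> (f \<circ> \<gamma>)) has_derivative (\<lambda>h. h *\<^sub>R D (\<phi> p) w)) (at 0)"
        by (rule has_derivative_transform_within_open[OF _ J(1,2)])
          (use JZ chart_inv[OF M c] in auto)
      then show ?thesis by (simp add: has_vector_derivative_def)
    qed
    ultimately show "(\<forall>\<^sub>F t in at 0. f (\<gamma> t) \<in> W) \<and> ((\<psi> \<circ> (f \<circ> \<gamma>)) has_vector_derivative D (\<phi> p) w) (at 0)" ..
  qed
qed

lemma smooth_map_ident:
  assumes "charted_space M"
  shows "smooth_map M M (\<lambda>x. x)"
  unfolding smooth_map_def
proof
  show "continuous_map (mtop M) (mtop M) (\<lambda>x. x)" by simp
  have "smooth_on (\<phi> ` (V \<inter> (\<lambda>x. x) -` W)) (\<psi> \<circ> (\<lambda>x. x) \<circ> inv_into V \<phi>)"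
    if "(V, \<phi>) \<in> atlas M" "(W, \<psi>) \<in> atlas M" for V \<phi> W \<psi>
    using chart_transition[OF assms that] by (simp add: o_def)
  note in_charts = this
  show "\<forall>(V, \<phi>)\<in>atlas M. \<forall>(W, \<psi>)\<in>atlas M. smooth_on (\<phi> ` (V \<inter> (\<lambda>x. x) -` W)) (\<psi> \<circ> (\<lambda>x. x) \<circ> inv_into V \<phi>)"
    by (intro ballI, clarify) (rule in_charts)
qed

lemma curve_at_carrier: "curve_at M p \<gamma> \<Longrightarrow> p \<in> carrier_of M \<and> \<gamma> 0 = p"
  by (simp add: curve_at_def)

lemma curve_in_velocity:
  assumes "curve_at M p \<gamma>"
  shows "\<gamma> \<in> velocity M \<gamma>"
proof -
  have "curve_at M (\<gamma> 0) \<gamma>" using assms curve_at_carrier[OF assms] by simp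
  then show ?thesis by (simp add: velocity_def)
qed

lemma velocityD:
  assumes "\<delta> \<in> velocity M \<gamma>" "(V, \<phi>) \<in> atlas M" "\<gamma> 0 \<in> V"
  shows "vector_derivative (\<phi> \<circ> \<delta>) (at 0) = vector_derivative (\<phi> \<circ> \<gamma>) (at 0)"
proof -
  have "\<forall>(V, \<phi>)\<in>atlas M. \<gamma> 0 \<in> V \<longrightarrow>
      vector_derivative (\<phi> \<circ> \<delta>) (at 0) = vector_derivative (\<phi> \<circ> \<gamma>) (at 0)"
    using assms(1) by (simp add: velocity_def)
  from bspec[OF this assms(2), unfolded prod.case] assms(3) show ?thesis by simp
qed

context
  fixes M :: "('a, 'e::euclidean_space) manifold" and V \<phi> p
  assumes M: "charted_space M" and c: "(V, \<phi>) \<in> atlas M" and p: "p \<in> V"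
begin

lemma curve_atD:
  assumes "curve_at M p \<gamma>"
  shows "\<gamma> 0 = p" "\<forall>\<^sub>F t in at 0. \<gamma> t \<in> V"
    "((\<phi> \<circ> \<gamma>) has_vector_derivative vector_derivative (\<phi> \<circ> \<gamma>) (at 0)) (at 0)"
proof -
  have "\<forall>(V, \<phi>)\<in>atlas M. p \<in> V \<longrightarrow> (\<forall>\<^sub>F t in at 0. \<gamma> t \<in> V) \<and> (\<phi> \<circ> \<gamma>) differentiable (at 0)"
    and 0: "\<gamma> 0 = p"
    using assms unfolding curve_at_def by blast+
  from bspec[OF this(1) c, unfolded prod.case] p
  show "\<forall>\<^sub>F t in at 0. \<gamma> t \<in> V"
    "((\<phi> \<circ> \<gamma>) has_vector_derivative vector_derivative (\<phi> \<circ> \<gamma>) (at 0)) (at 0)"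
    by (simp_all add: vector_derivative_works)
  show "\<gamma> 0 = p" by (rule 0)
qed

lemma curve_atI:
  assumes \<gamma>: "\<gamma> 0 = p" "\<forall>\<^sub>F t in at 0. \<gamma> t \<in> V" "((\<phi> \<circ> \<gamma>) has_vector_derivative w) (at 0)"
  shows "curve_at M p \<gamma>"
  unfolding curve_at_def
proof (intro conjI ballI, goal_cases)
  case 1
  show ?case using p chart_subset[OF M c] by blast
next
  case 2
  show ?case by (rule \<gamma>(1))
next
  case (3 d)
  obtain W \<psi> where d: "d = (W, \<psi>)" by fastforce
  have "(\<forall>\<^sub>F t in at 0. \<gamma> t \<in> W) \<and> (\<psi> \<circ> \<gamma>) differentiable (at 0)" if pW: "p \<in> W"
  proof -
    obtain D where D: "\<And>\<gamma> w. \<gamma> 0 = p \<Longrightarrow> \<forall>\<^sub>F t in at 0. \<gamma> t \<in> V \<Longrightarrow> ((\<phi> \<circ> \<gamma>) has_vector_derivative w) (at 0) \<Longrightarrow>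
      (\<forall>\<^sub>F t in at 0. (\<lambda>x. x) (\<gamma> t) \<in> W) \<and> ((\<psi> \<circ> ((\<lambda>x. x) \<circ> \<gamma>)) has_vector_derivative D w) (at 0)"
      by (rule smooth_map_derivative[OF M smooth_map_ident[OF M] M c 3[unfolded d] p pW], rule that)
    from D[OF \<gamma>] show ?thesis by (auto simp: o_def intro: differentiableI_vector)
  qed
  then show ?case by (simp add: d)
qed

lemma velocity_eqI:
  assumes \<gamma>: "curve_at M p \<gamma>" and \<delta>: "curve_at M p \<delta>"
    and eq: "vector_derivative (\<phi> \<circ> \<gamma>) (at 0) = vector_derivative (\<phi> \<circ> \<delta>) (at 0)"
  shows "velocity M \<gamma> = velocity M \<delta>"
proof -
  have "vector_derivative (\<psi> \<circ> \<gamma>) (at 0) = vector_derivative (\<psi> \<circ> \<delta>) (at 0)"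
    if d: "(W, \<psi>) \<in> atlas M" and "p \<in> W" for W \<psi>
  proof -
    obtain D where D: "\<And>\<gamma> w. \<gamma> 0 = p \<Longrightarrow> \<forall>\<^sub>F t in at 0. \<gamma> t \<in> V \<Longrightarrow> ((\<phi> \<circ> \<gamma>) has_vector_derivative w) (at 0) \<Longrightarrow>
      (\<forall>\<^sub>F t in at 0. (\<lambda>x. x) (\<gamma> t) \<in> W) \<and> ((\<psi> \<circ> ((\<lambda>x. x) \<circ> \<gamma>)) has_vector_derivative D w) (at 0)"
      by (rule smooth_map_derivative[OF M smooth_map_ident[OF M] M c d p \<open>p \<in> W\<close>], rule that)
    have "((\<psi> \<circ> \<eta>) has_vector_derivative D (vector_derivative (\<phi> \<circ> \<eta>) (at 0))) (at 0)" if "curve_at M p \<eta>" for \<eta>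
      using D[OF curve_atD[OF that]] by (simp add: o_def)
    from this[OF \<gamma>] this[OF \<delta>] show ?thesis using eq vector_derivative_at by metis
  qed
  moreover have "\<gamma> 0 = p" "\<delta> 0 = p" using curve_atD \<gamma> \<delta> by blast+
  ultimately have "\<forall>c\<in>atlas M. (case c of (W, \<psi>) \<Rightarrow> p \<in> W \<longrightarrow>
      vector_derivative (\<psi> \<circ> \<gamma>) (at 0) = vector_derivative (\<psi> \<circ> \<delta>) (at 0))"
    by blast
  then show ?thesis
    unfolding velocity_def \<open>\<gamma> 0 = p\<close> \<open>\<delta> 0 = p\<close> by (intro Collect_cong conj_cong refl ball_cong) fastforce
qed

lemma velocity_eqD:
  assumes "curve_at M p \<gamma>" "curve_at M p \<delta>" "velocity M \<gamma> = velocity M \<delta>"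
  shows "vector_derivative (\<phi> \<circ> \<gamma>) (at 0) = vector_derivative (\<phi> \<circ> \<delta>) (at 0)"
proof -
  have 0: "\<gamma> 0 = p" "\<delta> 0 = p" using curve_atD assms by blast+
  have "\<gamma> \<in> velocity M \<delta>" using curve_in_velocity[OF assms(1)] assms(3) by simp
  from velocityD[OF this c] show ?thesis using 0 p by simp
qed

lemma coordinates_velocity:
  assumes "curve_at M p \<gamma>"
  shows "coordinates \<phi> (velocity M \<gamma>) = vector_derivative (\<phi> \<circ> \<gamma>) (at 0)"
  unfolding coordinates_def
proof (rule the_equality)
  have 0: "\<gamma> 0 = p" using curve_atD assms by blast
  show "\<forall>\<delta>\<in>velocity M \<gamma>. ((\<phi> \<circ> \<delta>) has_vector_derivative vector_derivative (\<phi> \<circ> \<gamma>) (at 0)) (at 0)"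
  proof
    fix \<delta> assume "\<delta> \<in> velocity M \<gamma>"
    then have \<delta>: "curve_at M p \<delta>" using 0 by (simp add: velocity_def)
    have "vector_derivative (\<phi> \<circ> \<delta>) (at 0) = vector_derivative (\<phi> \<circ> \<gamma>) (at 0)"
      by (rule velocityD[OF \<open>\<delta> \<in> velocity M \<gamma>\<close> c]) (use 0 p in simp)
    then show "((\<phi> \<circ> \<delta>) has_vector_derivative vector_derivative (\<phi> \<circ> \<gamma>) (at 0)) (at 0)"
      using curve_atD(3)[OF \<delta>] by simp
  qed
  show "w = vector_derivative (\<phi> \<circ> \<gamma>) (at 0)"
    if "\<forall>\<delta>\<in>velocity M \<gamma>. ((\<phi> \<circ> \<delta>) has_vector_derivative w) (at 0)" for w
    using vector_derivative_at[OF bspec[OF that curve_in_velocity[OF assms]]] by simp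
qed

lemma vector_derivative_in_model:
  assumes "curve_at M p \<gamma>"
  shows "vector_derivative (\<phi> \<circ> \<gamma>) (at 0) \<in> model M"
proof -
  have S: "subspace (model M)" using M by (simp add: charted_space_def)
  note \<gamma> = curve_atD[OF assms]
  obtain J where J: "open J" "0 \<in> J" "\<And>t. t \<in> J \<Longrightarrow> t \<noteq> 0 \<Longrightarrow> \<gamma> t \<in> V"
    using \<gamma>(2) unfolding eventually_at_topological by blast
  have "1 *\<^sub>R vector_derivative (\<phi> \<circ> \<gamma>) (at 0) \<in> model M"
  proof (rule derivative_in_subspace[where f = "\<phi> \<circ> \<gamma>" and v = 1
        and D = "\<lambda>h. h *\<^sub>R vector_derivative (\<phi> \<circ> \<gamma>) (at 0)", OF S _ J(1,2)])
    show "((\<phi> \<circ> \<gamma>) has_derivative (\<lambda>h. h *\<^sub>R vector_derivative (\<phi> \<circ> \<gamma>) (at 0))) (at 0)"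
      using \<gamma>(3) by (simp add: has_vector_derivative_def)
    show "(\<phi> \<circ> \<gamma>) t \<in> model M" if "t \<in> J" for t
      using J(3)[OF that] \<gamma>(1) p chart_in_model[OF M c] by (cases "t = 0") auto
  qed
  then show ?thesis by simp
qed

end

lemma curve_at_smooth_map:
  assumes M: "charted_space M" and N: "charted_space N" and f: "smooth_map M N f"
    and \<gamma>: "curve_at M p \<gamma>"
  shows "curve_at N (f p) (f \<circ> \<gamma>)"
proof -
  have p: "p \<in> carrier_of M" using curve_at_carrier[OF \<gamma>] by blast
  then have fp: "f p \<in> carrier_of N"
    using f unfolding smooth_map_def continuous_map_def by blast
  obtain V \<phi> where c: "(V, \<phi>) \<in> atlas M" "p \<in> V" by (rule chart_cover[OF M p])
  obtain W \<psi> where d: "(W, \<psi>) \<in> atlas N" "f p \<in> W" by (rule chart_cover[OF N fp])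
  obtain D where D: "\<And>\<gamma> w. \<gamma> 0 = p \<Longrightarrow> \<forall>\<^sub>F t in at 0. \<gamma> t \<in> V \<Longrightarrow> ((\<phi> \<circ> \<gamma>) has_vector_derivative w) (at 0) \<Longrightarrow>
      (\<forall>\<^sub>F t in at 0. f (\<gamma> t) \<in> W) \<and> ((\<psi> \<circ> (f \<circ> \<gamma>)) has_vector_derivative D w) (at 0)"
    by (rule smooth_map_derivative[OF M f N c(1) d(1) c(2) d(2)], rule that)
  from D[OF curve_atD[OF M c \<gamma>]] curve_atD(1)[OF M c \<gamma>]
  show ?thesis by (intro curve_atI[OF N d]) auto
qed

lemma tangent_map_velocity:
  assumes M: "charted_space M" and N: "charted_space N" and f: "smooth_map M N f"
    and \<gamma>: "curve_at M p \<gamma>"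
  shows "tangent_map N f (velocity M \<gamma>) = velocity N (f \<circ> \<gamma>)"
proof -
  have p: "p \<in> carrier_of M" "\<gamma> 0 = p" using curve_at_carrier[OF \<gamma>] by blast+
  then have fp: "f p \<in> carrier_of N"
    using f unfolding smooth_map_def continuous_map_def by blast
  obtain V \<phi> where c: "(V, \<phi>) \<in> atlas M" "p \<in> V" by (rule chart_cover[OF M p(1)])
  obtain W \<psi> where d: "(W, \<psi>) \<in> atlas N" "f p \<in> W" by (rule chart_cover[OF N fp])
  obtain D where D: "\<And>\<gamma> w. \<gamma> 0 = p \<Longrightarrow> \<forall>\<^sub>F t in at 0. \<gamma> t \<in> V \<Longrightarrow> ((\<phi> \<circ> \<gamma>) has_vector_derivative w) (at 0) \<Longrightarrow>
      (\<forall>\<^sub>F t in at 0. f (\<gamma> t) \<in> W) \<and> ((\<psi> \<circ> (f \<circ> \<gamma>)) has_vector_derivative D w) (at 0)"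
    by (rule smooth_map_derivative[OF M f N c(1) d(1) c(2) d(2)], rule that)
  have Dv: "vector_derivative (\<psi> \<circ> (f \<circ> \<eta>)) (at 0) = D (vector_derivative (\<phi> \<circ> \<eta>) (at 0))"
    if "curve_at M p \<eta>" for \<eta>
    using D[OF curve_atD[OF M c that]] vector_derivative_at by blast
  have "velocity N (f \<circ> \<delta>) = velocity N (f \<circ> \<gamma>)" if "\<delta> \<in> velocity M \<gamma>" for \<delta>
  proof -
    have \<delta>: "curve_at M p \<delta>" using that p(2) by (simp add: velocity_def)
    have "vector_derivative (\<phi> \<circ> \<delta>) (at 0) = vector_derivative (\<phi> \<circ> \<gamma>) (at 0)"
      by (rule velocityD[OF that c(1)]) (use p(2) c(2) in simp)
    then have "vector_derivative (\<psi> \<circ> (f \<circ> \<delta>)) (at 0) = vector_derivative (\<psi> \<circ> (f \<circ> \<gamma>)) (at 0)"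
      using Dv[OF \<gamma>] Dv[OF \<delta>] by simp
    then show ?thesis
      by (rule velocity_eqI[OF N d curve_at_smooth_map[OF M N f \<delta>] curve_at_smooth_map[OF M N f \<gamma>]])
  qed
  then show ?thesis
    unfolding tangent_map_def using curve_in_velocity[OF \<gamma>] by blast
qed

text \<open>
  The following lemmas justify the convention that tangent vectors, tangent maps and vector fields on
  an open submanifold are those of the whole manifold.
\<close>

lemma curve_at_open_submanifold:
  assumes M: "charted_space M" and U: "openin (mtop M) U" and p: "p \<in> U"
  shows "curve_at (open_submanifold M U) p \<gamma> \<longleftrightarrow> curve_at M p \<gamma>"
proof -
  note MU = charted_space_open_submanifold[OF M U]
  have pM: "p \<in> carrier_of M" using openin_subset[OF U] p by blast
  obtain V \<phi> where c: "(V, \<phi>) \<in> atlas M" "p \<in> V" by (rule chart_cover[OF M pM])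
  then have c': "(V \<inter> U, \<phi>) \<in> atlas (open_submanifold M U)" "p \<in> V \<inter> U" using p by auto
  show ?thesis
  proof
    assume "curve_at (open_submanifold M U) p \<gamma>"
    note \<gamma> = curve_atD[OF MU c' this]
    show "curve_at M p \<gamma>"
      by (rule curve_atI[OF M c \<gamma>(1) _ \<gamma>(3)]) (use \<gamma>(2) in \<open>auto elim: eventually_mono\<close>)
  next
    assume "curve_at M p \<gamma>"
    note \<gamma> = curve_atD[OF M c this]
    show "curve_at (open_submanifold M U) p \<gamma>"
      by (rule curve_atI[OF MU c' \<gamma>(1) curve_eventually_in_open[OF M c(1) U _ _ \<gamma>(2)
              has_vector_derivative_continuous[OF \<gamma>(3)]] \<gamma>(3)])
        (use c(2) p \<gamma>(1) in auto)
  qed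
qed

lemma velocity_open_submanifold:
  assumes M: "charted_space M" and U: "openin (mtop M) U" and "\<gamma> 0 \<in> U"
  shows "velocity (open_submanifold M U) \<gamma> = velocity M \<gamma>"
  using assms(3) unfolding velocity_def curve_at_open_submanifold[OF assms] by auto

lemma tangent_space_open_submanifold:
  assumes M: "charted_space M" and U: "openin (mtop M) U" and p: "p \<in> U"
  shows "tangent_space (open_submanifold M U) p = tangent_space M p"
proof -
  have "velocity (open_submanifold M U) \<gamma> = velocity M \<gamma>" if "curve_at M p \<gamma>" for \<gamma>
    using velocity_open_submanifold[OF M U] that p by (simp add: curve_at_def)
  then show ?thesis
    unfolding tangent_space_def curve_at_open_submanifold[OF assms] by (intro Collect_cong) auto
qed

lemma tangent_map_open_submanifold:
  assumes M: "charted_space M" and N: "charted_space N" and U: "openin (mtop N) U"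
    and v: "v \<in> tangent_space M p" and p: "f p \<in> U"
  shows "tangent_map (open_submanifold N U) f v = tangent_map N f v"
proof -
  have "velocity (open_submanifold N U) (f \<circ> \<gamma>) = velocity N (f \<circ> \<gamma>)" if "\<gamma> \<in> v" for \<gamma>
  proof -
    have "\<gamma> 0 = p" using v that by (auto simp: tangent_space_def velocity_def curve_at_def)
    then show ?thesis by (intro velocity_open_submanifold N U) (simp add: p)
  qed
  then show ?thesis unfolding tangent_map_def by simp
qed

lemma vector_field_open_submanifold:
  assumes M: "charted_space M" and X: "vector_field M X" and U: "openin (mtop M) U"
  shows "vector_field (open_submanifold M U) X"
  unfolding vector_field_def
proof (intro conjI ballI)
  fix p assume "p \<in> carrier_of (open_submanifold M U)"
  then show "X p \<in> tangent_space (open_submanifold M U) p"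
    using X tangent_space_open_submanifold[OF M U] by (simp add: vector_field_def)
next
  fix d assume "d \<in> atlas (open_submanifold M U)"
  then obtain V \<phi> where c: "(V, \<phi>) \<in> atlas M" and d: "d = (V \<inter> U, \<phi>)" by auto
  have "\<forall>(V, \<phi>)\<in>atlas M. smooth_on (\<phi> ` V) (\<lambda>y. coordinates \<phi> (X (inv_into V \<phi> y)))"
    using X by (simp add: vector_field_def)
  from bspec[OF this c, unfolded prod.case]
  have "smooth_on (\<phi> ` (V \<inter> U)) (\<lambda>y. coordinates \<phi> (X (inv_into V \<phi> y)))"
    by (rule smooth_on_subset) auto
  then have "smooth_on (\<phi> ` (V \<inter> U)) (\<lambda>y. coordinates \<phi> (X (inv_into (V \<inter> U) \<phi> y)))"
    by (rule smooth_on_eq) (simp only: inv_into_chart_restrict[OF M c])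
  then show "case d of (V, \<phi>) \<Rightarrow> smooth_on (\<phi> ` V) (\<lambda>y. coordinates \<phi> (X (inv_into V \<phi> y)))"
    by (simp only: d prod.case)
qed

lemma fibration_restrict:
  assumes f: "fibration M N \<pi>" and U: "openin (mtop M) U" and \<pi>U: "openin (mtop N) (\<pi> ` U)"
  shows "fibration (open_submanifold M U) (open_submanifold N (\<pi> ` U)) \<pi>"
proof -
  have M: "smooth_manifold M" and N: "smooth_manifold N" and s: "submersion M N \<pi>"
    using f by (simp_all add: fibration_def)
  have cM: "charted_space M" and cN: "charted_space N"
    using M N by (simp_all add: smooth_manifold_iff)
  have sm: "smooth_map M N \<pi>" using s by (simp add: submersion_def)
  have UM: "U \<subseteq> carrier_of M" and UN: "\<pi> ` U \<subseteq> carrier_of N"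
    using openin_subset U \<pi>U by blast+
  have "tangent_map (open_submanifold N (\<pi> ` U)) \<pi> ` tangent_space (open_submanifold M U) p
      = tangent_space (open_submanifold N (\<pi> ` U)) (\<pi> p)" if p: "p \<in> U" for p
  proof -
    have "tangent_map (open_submanifold N (\<pi> ` U)) \<pi> v = tangent_map N \<pi> v" if "v \<in> tangent_space M p" for v
      by (rule tangent_map_open_submanifold[OF cM cN \<pi>U that]) (use p in blast)
    then have "tangent_map (open_submanifold N (\<pi> ` U)) \<pi> ` tangent_space M p = tangent_map N \<pi> ` tangent_space M p"
      by (rule image_cong[OF refl])
    also have "\<dots> = tangent_space N (\<pi> p)" using s p UM by (auto simp: submersion_def)
    finally show ?thesis
      using tangent_space_open_submanifold[OF cM U p] tangent_space_open_submanifold[OF cN \<pi>U, of "\<pi> p"] p by simp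
  qed
  then have "submersion (open_submanifold M U) (open_submanifold N (\<pi> ` U)) \<pi>"
    using smooth_map_restrict[OF cM sm order_refl] by (simp add: submersion_def)
  moreover have "\<pi> ` carrier_of (open_submanifold M U) = carrier_of (open_submanifold N (\<pi> ` U))"
    using UM UN by (simp add: Int_absorb1)
  ultimately show ?thesis
    using smooth_manifold_open_submanifold[OF M U] smooth_manifold_open_submanifold[OF N \<pi>U]
    by (simp add: fibration_def)
qed

section \<open>Complete solutions near a point where the field is not vertical\<close>

lemma has_vector_derivative_compose_derivative:
  assumes "(c has_vector_derivative w) (at t)" "(g has_derivative D) (at (c t))"
  shows "((g \<circ> c) has_vector_derivative D w) (at t)"
proof -
  have "((\<lambda>s. g (c s)) has_derivative (\<lambda>h. D (h *\<^sub>R w))) (at t)"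
    using assms has_derivative_compose unfolding has_vector_derivative_def by blast
  moreover have "D (h *\<^sub>R w) = h *\<^sub>R D w" for h
    using linear_scale[OF bounded_linear.linear[OF has_derivative_bounded_linear[OF assms(2)]]] .
  ultimately show ?thesis by (simp add: has_vector_derivative_def o_def)
qed

lemma has_vector_derivative_eventually_eq:
  assumes "(g has_vector_derivative w) (at t)" "\<forall>\<^sub>F s in at t. g s = f s" "g t = f t"
  shows "(f has_vector_derivative w) (at t)"
  using has_derivative_transform_eventually[OF assms(1)[unfolded has_vector_derivative_def] assms(2,3) UNIV_I]
  by (simp add: has_vector_derivative_def)

text \<open>
  The normal form, transported to the manifold. In the coordinates \<open>F \<circ> \<phi>\<close> on \<open>M\<close> and \<open>\<psi>\<close> on \<open>N\<close>, the
  fibration is the linear map \<open>A\<close>. The last conclusion says that the field is horizontal: if a curve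
  represents it at \<open>p\<close> and its projection has velocity \<open>b\<close>, its own velocity is \<open>R b\<close>.
\<close>

lemma straightening_chart:
  fixes M :: "('a, 'e::euclidean_space) manifold" and N :: "('b, 'f::euclidean_space) manifold"
  assumes "dynamical_system M X" and fib: "fibration M N \<pi>"
    and m: "m \<in> carrier_of M" and ker: "X m \<notin> ker_tangent_map M N \<pi>"
  obtains V \<phi> W \<psi> Z U\<^sub>0 V\<^sub>0 F \<Theta> R A where
    "(V, \<phi>) \<in> atlas M" "(W, \<psi>) \<in> atlas N" "openin (mtop M) Z" "m \<in> Z" "Z \<subseteq> V" "\<pi> ` Z \<subseteq> W"
    "open U\<^sub>0" "\<phi> m \<in> U\<^sub>0" "open V\<^sub>0" "F ` U\<^sub>0 = V\<^sub>0" "\<Theta> ` V\<^sub>0 = U\<^sub>0"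
    "\<And>x. x \<in> U\<^sub>0 \<Longrightarrow> \<Theta> (F x) = x" "\<And>z. z \<in> V\<^sub>0 \<Longrightarrow> F (\<Theta> z) = z"
    "smooth_on U\<^sub>0 F" "smooth_on V\<^sub>0 \<Theta>"
    "\<And>x. x \<in> U\<^sub>0 \<Longrightarrow> x \<in> model M \<Longrightarrow> x \<in> \<phi> ` Z"
    "\<And>x. x \<in> U\<^sub>0 \<Longrightarrow> F x \<in> model M \<longleftrightarrow> x \<in> model M"
    "linear A" "linear R" "A ` model M = model N"
    "\<And>t. R t \<in> model M" "\<And>t. t \<in> model N \<Longrightarrow> A (R t) = t"
    "\<And>p. p \<in> Z \<Longrightarrow> \<phi> p \<in> U\<^sub>0 \<Longrightarrow> A (F (\<phi> p)) = \<psi> (\<pi> p)"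
    "\<And>p \<gamma>. p \<in> Z \<Longrightarrow> \<phi> p \<in> U\<^sub>0 \<Longrightarrow> curve_at M p \<gamma> \<Longrightarrow> X p = velocity M \<gamma> \<Longrightarrow>
      \<exists>b. ((\<psi> \<circ> (\<pi> \<circ> \<gamma>)) has_vector_derivative b) (at 0) \<and>
          ((F \<circ> (\<phi> \<circ> \<gamma>)) has_vector_derivative R b) (at 0)"
proof -
  have X: "vector_field M X" and "smooth_manifold M" "smooth_manifold N"
    and sub: "submersion M N \<pi>"
    using assms(1,2) by (auto simp: dynamical_system_def fibration_def)
  then have M: "charted_space M" and N: "charted_space N" by (simp_all add: smooth_manifold_iff)
  have \<pi>: "smooth_map M N \<pi>" using sub by (simp add: submersion_def)
  have S: "subspace (model M)" and T: "subspace (model N)"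
    using M N by (simp_all add: charted_space_def)
  have \<pi>m: "\<pi> m \<in> carrier_of N" using fib m by (auto simp: fibration_def)
  obtain V \<phi> where c: "(V, \<phi>) \<in> atlas M" and mV: "m \<in> V" by (rule chart_cover[OF M m])
  obtain W \<psi> where d: "(W, \<psi>) \<in> atlas N" and mW: "\<pi> m \<in> W" by (rule chart_cover[OF N \<pi>m])
  define Z where "Z = V \<inter> {p \<in> carrier_of M. \<pi> p \<in> W}"
  have Z: "openin (mtop M) Z"
    unfolding Z_def
    by (intro openin_Int chart_openin[OF M c] openin_continuous_map_preimage[OF _ chart_openin[OF N d]])
      (use \<pi> in \<open>simp add: smooth_map_def\<close>)
  have mZ: "m \<in> Z" and ZV: "Z \<subseteq> V" and ZW: "\<pi> ` Z \<subseteq> W" using m mV mW by (auto simp: Z_def)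
  obtain P where P: "bounded_linear P" "\<And>v. P v \<in> model M" "\<And>v. v \<in> model M \<Longrightarrow> P v = v"
    by (rule subspace_linear_projection[OF S], rule that)
  obtain B where B: "open B" "\<phi> ` Z = model M \<inter> B"
    using chart_open_image[OF M c Z ZV] unfolding openin_open by blast
  define D where "D = P -` B"
  have "open D" unfolding D_def by (rule open_vimage[OF B(1) linear_continuous_on[OF P(1)]])
  have PD: "P x \<in> \<phi> ` Z" if "x \<in> D" for x using that P(2) B(2) by (simp add: D_def)
  have P\<phi>: "P (\<phi> p) = \<phi> p" if "p \<in> V" for p by (rule P(3)[OF chart_in_model[OF M c that]])
  have \<phi>D: "\<phi> p \<in> D" if "p \<in> Z" for p
    using that P\<phi> ZV B(2) by (auto simp: D_def)
  let ?i = "\<lambda>x. inv_into V \<phi> (P x)"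
  have iZ: "?i x \<in> Z" "\<phi> (?i x) = P x" if x: "x \<in> D" for x
  proof -
    obtain p where "p \<in> Z" "P x = \<phi> p" using PD[OF x] by blast
    then show "?i x \<in> Z" "\<phi> (?i x) = P x" using chart_inv[OF M c] ZV by auto
  qed
  have i\<phi>: "?i (\<phi> p) = p" if "p \<in> V" for p using that P\<phi> chart_inv[OF M c] by simp
  define f where "f = (\<lambda>x. coordinates \<phi> (X (?i x)))"
  define g where "g = (\<lambda>x. \<psi> (\<pi> (?i x)))"
  have f: "smooth_on D f"
  proof -
    have "\<forall>(V, \<phi>)\<in>atlas M. smooth_on (\<phi> ` V) (\<lambda>y. coordinates \<phi> (X (inv_into V \<phi> y)))"
      using X by (simp add: vector_field_def)
    from bspec[OF this c, unfolded prod.case] show ?thesis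
      unfolding f_def by (rule smooth_on_compose[OF smooth_on_linear[OF P(1)]]) (use PD ZV in blast)
  qed
  have g: "smooth_on D g"
    unfolding g_def
    by (rule smooth_on_compose[OF smooth_on_linear[OF P(1)] smooth_mapD[OF \<pi> c d]])
      (use PD ZV ZW in blast)
  have fX: "f (\<phi> p) = vector_derivative (\<phi> \<circ> \<gamma>) (at 0)"
    if "p \<in> V" "curve_at M p \<gamma>" "X p = velocity M \<gamma>" for p \<gamma>
    using coordinates_velocity[OF M c that(1,2)] i\<phi>[OF that(1)] that(3) by (simp add: f_def)
  have Xcurve: "\<exists>\<gamma>. curve_at M p \<gamma> \<and> X p = velocity M \<gamma>" if "p \<in> carrier_of M" for p
    using X that by (auto simp: vector_field_def tangent_space_def)
  have fS: "f x \<in> model M" if "x \<in> D" for x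
  proof -
    have p: "?i x \<in> V" using iZ[OF that] ZV by blast
    then have "?i x \<in> carrier_of M" using chart_subset[OF M c] by blast
    then obtain \<gamma> where \<gamma>: "curve_at M (?i x) \<gamma>" "X (?i x) = velocity M \<gamma>" using Xcurve by blast
    have "f x = vector_derivative (\<phi> \<circ> \<gamma>) (at 0)"
      using coordinates_velocity[OF M c p \<gamma>(1)] \<gamma>(2) by (simp add: f_def)
    then show ?thesis using vector_derivative_in_model[OF M c p \<gamma>(1)] by simp
  qed
  have gT: "g x \<in> model N" if "x \<in> D" for x
    unfolding g_def by (rule chart_in_model[OF N d]) (use iZ[OF that] ZW in blast)
  have g\<phi>: "g (\<phi> p) = \<psi> (\<pi> p)" if "p \<in> V" for p using i\<phi>[OF that] by (simp add: g_def)
  have push: "((\<psi> \<circ> (\<pi> \<circ> \<gamma>)) has_vector_derivative E (vector_derivative (\<phi> \<circ> \<gamma>) (at 0))) (at 0)"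
    if p: "p \<in> Z" and E: "(g has_derivative E) (at (\<phi> p))" and \<gamma>: "curve_at M p \<gamma>" for p E \<gamma>
  proof -
    have pV: "p \<in> V" using p ZV by blast
    note \<gamma>D = curve_atD[OF M c pV \<gamma>]
    have "(g has_derivative E) (at ((\<phi> \<circ> \<gamma>) 0))" using E \<gamma>D(1) by simp
    from has_vector_derivative_compose_derivative[OF \<gamma>D(3) this]
    show ?thesis
    proof (rule has_vector_derivative_eventually_eq)
      show "\<forall>\<^sub>F s in at 0. (g \<circ> (\<phi> \<circ> \<gamma>)) s = (\<psi> \<circ> (\<pi> \<circ> \<gamma>)) s"
        using \<gamma>D(2) by eventually_elim (simp add: g\<phi>)
    qed (use \<gamma>D(1) pV g\<phi> in simp)
  qed
  let ?x = "\<phi> m"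
  have xD: "?x \<in> D" by (rule \<phi>D[OF mZ])
  obtain A' where "(g has_derivative blinfun_apply A') (at ?x)"
    using smooth_on_openE[OF \<open>open D\<close> g] xD by metis
  then obtain A where A: "(g has_derivative A) (at ?x)" by blast
  have AT: "A v \<in> model N" for v
    by (rule derivative_in_subspace[OF T A \<open>open D\<close> xD gT])
  have surj: "A ` model M = model N"
  proof
    show "A ` model M \<subseteq> model N" using AT by blast
    show "model N \<subseteq> A ` model M"
    proof
      fix t assume t: "t \<in> model N"
      \<comment> \<open>the coordinate line through \<open>\<pi> m\<close> with velocity \<open>t\<close>\<close>
      define \<delta> where "\<delta> = (\<lambda>s::real. inv_into W \<psi> (\<psi> (\<pi> m) + s *\<^sub>R t))"
      obtain B' where B': "open B'" "\<psi> ` W = model N \<inter> B'"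
        using chart_image_openin[OF N d] unfolding openin_open by blast
      have "\<psi> (\<pi> m) \<in> B'" using B' mW by blast
      then obtain e where e: "e > 0" "\<And>s. \<bar>s\<bar> < e \<Longrightarrow> \<psi> (\<pi> m) + s *\<^sub>R t \<in> B'"
        using open_line_segment[OF B'(1)] by metis
      have \<delta>: "\<delta> s \<in> W" "\<psi> (\<delta> s) = \<psi> (\<pi> m) + s *\<^sub>R t" if "\<bar>s\<bar> < e" for s
      proof -
        have "\<psi> (\<pi> m) + s *\<^sub>R t \<in> \<psi> ` W"
          unfolding B'(2) using e(2)[OF that] chart_in_model[OF N d mW] t T
          by (auto intro: subspace_add subspace_scale)
        then show "\<delta> s \<in> W" "\<psi> (\<delta> s) = \<psi> (\<pi> m) + s *\<^sub>R t"
          unfolding \<delta>_def by (rule inv_into_into, rule f_inv_into_f)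
      qed
      have ev: "\<forall>\<^sub>F s in at 0. \<bar>s\<bar> < e" using e(1) unfolding eventually_at by (auto intro!: exI[of _ e])
      have "((\<lambda>s. \<psi> (\<pi> m) + s *\<^sub>R t) has_vector_derivative t) (at 0)"
        by (auto intro!: derivative_eq_intros)
      then have der: "((\<psi> \<circ> \<delta>) has_vector_derivative t) (at 0)"
      proof (rule has_vector_derivative_eventually_eq)
        show "\<forall>\<^sub>F s in at 0. \<psi> (\<pi> m) + s *\<^sub>R t = (\<psi> \<circ> \<delta>) s"
          using ev by eventually_elim (simp add: \<delta>)
      qed (use \<delta>(2)[of 0] e(1) in simp)
      have "\<delta> 0 = \<pi> m" using chart_inv[OF N d mW] by (simp add: \<delta>_def)
      moreover have "\<forall>\<^sub>F s in at 0. \<delta> s \<in> W" using ev by eventually_elim (rule \<delta>)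
      ultimately have \<delta>c: "curve_at N (\<pi> m) \<delta>" by (rule curve_atI[OF N d mW _ _ der])
      then have "velocity N \<delta> \<in> tangent_space N (\<pi> m)" by (auto simp: tangent_space_def)
      then have "velocity N \<delta> \<in> tangent_map N \<pi> ` tangent_space M m"
        using sub m by (simp add: submersion_def)
      then obtain \<gamma> where \<gamma>: "curve_at M m \<gamma>" "velocity N \<delta> = tangent_map N \<pi> (velocity M \<gamma>)"
        by (auto simp: tangent_space_def)
      then have "velocity N \<delta> = velocity N (\<pi> \<circ> \<gamma>)"
        using tangent_map_velocity[OF M N \<pi> \<gamma>(1)] by simp
      from velocity_eqD[OF N d mW \<delta>c curve_at_smooth_map[OF M N \<pi> \<gamma>(1)] this]
      have "t = A (vector_derivative (\<phi> \<circ> \<gamma>) (at 0))"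
        using vector_derivative_at[OF der] vector_derivative_at[OF push[OF mZ A \<gamma>(1)]] by simp
      then show "t \<in> A ` model M"
        using vector_derivative_in_model[OF M c mV \<gamma>(1)] by blast
    qed
  qed
  \<comment> \<open>otherwise \<open>\<pi> \<circ> \<gamma>\<close> would have the velocity of a constant curve, and \<open>X m\<close> would be vertical\<close>
  have ne: "A (f ?x) \<noteq> 0"
  proof
    assume "A (f ?x) = 0"
    obtain \<gamma> where \<gamma>: "curve_at M m \<gamma>" "X m = velocity M \<gamma>" using Xcurve[OF m] by blast
    have "((\<psi> \<circ> (\<pi> \<circ> \<gamma>)) has_vector_derivative 0) (at 0)"
      using push[OF mZ A \<gamma>(1)] fX[OF mV \<gamma>] \<open>A (f ?x) = 0\<close> by simp
    then have v0: "vector_derivative (\<psi> \<circ> (\<pi> \<circ> \<gamma>)) (at 0) = 0" by (rule vector_derivative_at)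
    have dc: "((\<psi> \<circ> (\<lambda>_::real. \<pi> m)) has_vector_derivative 0) (at 0)" by (simp add: o_def)
    have "curve_at N (\<pi> m) (\<lambda>_. \<pi> m)"
      by (rule curve_atI[OF N d mW _ _ dc]) (use mW in simp_all)
    then have "velocity N (\<pi> \<circ> \<gamma>) = velocity N (\<lambda>_. \<pi> m)"
      by (rule velocity_eqI[OF N d mW curve_at_smooth_map[OF M N \<pi> \<gamma>(1)]])
        (simp only: v0 vector_derivative_at[OF dc])
    then have "tangent_map N \<pi> (X m) = zero_vector N (\<pi> m)"
      using tangent_map_velocity[OF M N \<pi> \<gamma>(1)] \<gamma>(2) by (simp add: zero_vector_def)
    moreover have "X m \<in> tangent_space M m" using X m by (simp add: vector_field_def)
    ultimately show False using ker m by (auto simp: ker_tangent_map_def)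
  qed
  obtain U\<^sub>0 V\<^sub>0 F \<Theta> R where U: "open U\<^sub>0" "?x \<in> U\<^sub>0" "U\<^sub>0 \<subseteq> D" "open V\<^sub>0" "F ` U\<^sub>0 = V\<^sub>0" "\<Theta> ` V\<^sub>0 = U\<^sub>0"
    and inv: "\<And>x. x \<in> U\<^sub>0 \<Longrightarrow> \<Theta> (F x) = x" "\<And>z. z \<in> V\<^sub>0 \<Longrightarrow> F (\<Theta> z) = z"
    and smooth: "smooth_on U\<^sub>0 F" "smooth_on V\<^sub>0 \<Theta>"
    and R: "linear R" "\<And>t. R t \<in> model M" "\<And>t. t \<in> model N \<Longrightarrow> A (R t) = t"
    and FS: "\<And>x. x \<in> U\<^sub>0 \<Longrightarrow> F x \<in> model M \<longleftrightarrow> x \<in> model M"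
    and AF: "\<And>x. x \<in> U\<^sub>0 \<Longrightarrow> x \<in> model M \<Longrightarrow> A (F x) = g x"
    and DF: "\<And>x D E. x \<in> U\<^sub>0 \<Longrightarrow> (F has_derivative D) (at x) \<Longrightarrow> (g has_derivative E) (at x) \<Longrightarrow> D (f x) = R (E (f x))"
    by (rule transversal_normal_form[OF \<open>open D\<close> f g xD S T _ _ A surj ne], erule fS, erule gT, rule that)
  show ?thesis
  proof (rule that[OF c d Z mZ ZV ZW U(1,2,4-6) inv smooth _ FS _ R(1) surj R(2,3)])
    show "x \<in> \<phi> ` Z" if "x \<in> U\<^sub>0" "x \<in> model M" for x
      using PD[of x] P(3)[OF that(2)] that(1) U(3) by auto
    show "linear A" by (rule bounded_linear.linear[OF has_derivative_bounded_linear[OF A]])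
    show "A (F (\<phi> p)) = \<psi> (\<pi> p)" if "p \<in> Z" "\<phi> p \<in> U\<^sub>0" for p
    proof -
      have "p \<in> V" using that ZV by blast
      then show ?thesis using AF[OF that(2) chart_in_model[OF M c]] g\<phi> by simp
    qed
    show "\<exists>b. ((\<psi> \<circ> (\<pi> \<circ> \<gamma>)) has_vector_derivative b) (at 0) \<and> ((F \<circ> (\<phi> \<circ> \<gamma>)) has_vector_derivative R b) (at 0)"
      if p: "p \<in> Z" "\<phi> p \<in> U\<^sub>0" and \<gamma>: "curve_at M p \<gamma>" "X p = velocity M \<gamma>" for p \<gamma>
    proof -
      have pV: "p \<in> V" using p ZV by blast
      obtain E where E: "(g has_derivative blinfun_apply E) (at (\<phi> p))"
        using smooth_on_openE[OF \<open>open D\<close> g] \<phi>D[OF p(1)] by metis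
      obtain F' where F': "(F has_derivative blinfun_apply F') (at (\<phi> p))"
        using smooth_on_openE[OF U(1) smooth(1)] p(2) by metis
      let ?w = "vector_derivative (\<phi> \<circ> \<gamma>) (at 0)"
      note \<gamma>D = curve_atD[OF M c pV \<gamma>(1)]
      have "((F \<circ> (\<phi> \<circ> \<gamma>)) has_vector_derivative F' ?w) (at 0)"
        by (rule has_vector_derivative_compose_derivative[OF \<gamma>D(3)]) (use F' \<gamma>D(1) in simp)
      moreover have "F' ?w = R (E ?w)"
        using DF[OF p(2) F' E] fX[OF pV \<gamma>] by simp
      ultimately show ?thesis using push[OF p(1) E \<gamma>(1)] by auto
    qed
  qed
qed

text \<open>The space \<open>S\<close> is the direct sum of the kernel and of the image of the right inverse.\<close>

lemma dim_kernel_of_split_surjection: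
  fixes A :: "'e::euclidean_space \<Rightarrow> 'f::euclidean_space"
  assumes "subspace S" "subspace T" "linear A" "linear R" "A ` S = T"
    and "\<And>t. R t \<in> S" "\<And>t. t \<in> T \<Longrightarrow> A (R t) = t"
  shows "dim {v \<in> S. A v = 0} = dim S - dim T"
proof -
  let ?K = "{v \<in> S. A v = 0}"
  have K: "subspace ?K"
    using assms(1,3) by (auto simp: subspace_def linear_add linear_scale linear_0)
  have RT: "subspace (R ` T)" by (rule linear_subspace_image[OF assms(4,2)])
  have "inj_on R (span T)"
    unfolding span_eq_iff[THEN iffD2, OF assms(2)] by (rule inj_on_inverseI[of _ A]) (rule assms(7))
  then have "dim (R ` T) = dim T" by (rule dim_image_eq[OF assms(4)])
  moreover have "?K \<inter> R ` T = {0}"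
    using assms(7) linear_0[OF assms(4)] linear_0[OF assms(3)] subspace_0[OF assms(1)] subspace_0[OF assms(2)]
    by force
  moreover have "{x + y |x y. x \<in> ?K \<and> y \<in> R ` T} = S"
  proof (intro subset_antisym subsetI)
    show "v \<in> S" if "v \<in> {x + y |x y. x \<in> ?K \<and> y \<in> R ` T}" for v
      using that assms(6) subspace_add[OF assms(1)] by auto
    fix v assume v: "v \<in> S"
    then have AT: "A v \<in> T" using assms(5) by blast
    have "v - R (A v) \<in> ?K"
      using v assms(6) subspace_diff[OF assms(1)] linear_diff[OF assms(3)] assms(7)[OF AT] by auto
    moreover have "v = (v - R (A v)) + R (A v)" by simp
    ultimately show "v \<in> {x + y |x y. x \<in> ?K \<and> y \<in> R ` T}" using AT by blast
  qed
  ultimately have "dim S = dim ?K + dim T"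
    using dim_sums_Int[OF K RT] by simp
  then show ?thesis by simp
qed

text \<open>
  The set \<open>U\<close> is the part of the straightening chart over a product \<open>B \<times> C\<close>, where \<open>B\<close> bounds the
  coordinates of the projection and \<open>C\<close> those in the kernel \<open>K\<close> of \<open>A\<close>. Accordingly \<open>\<pi> ` U\<close>
  is all of the coordinate domain \<open>D\<close> given by \<open>B\<close>, \<open>\<Lambda>\<close> is \<open>K \<inter> C\<close>, and every section \<open>\<Sigma> (\<cdot>, l)\<close> is
  defined on all of \<open>\<pi> ` U\<close>.
\<close>

theorem theorem4p15:
  fixes M :: "('a, 'e::euclidean_space) manifold"
    and X :: "'a \<Rightarrow> 'a tangent_vector"
    and N :: "('b, 'f::euclidean_space) manifold"
    and \<pi> :: "'a \<Rightarrow> 'b"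
    and m :: 'a
  assumes "dynamical_system M X"
    and "fibration M N \<pi>"
    and "m \<in> carrier_of M"
    and "X m \<notin> ker_tangent_map M N \<pi>"
  shows "\<exists>U (\<Lambda> :: ('e, 'e) manifold) (\<Sigma> :: 'b \<times> 'e \<Rightarrow> 'a).
           openin (mtop M) U \<and> m \<in> U \<and>
           openin (mtop N) (\<pi> ` U) \<and>
           smooth_manifold \<Lambda> \<and> mdim \<Lambda> = mdim M - mdim N \<and>
           complete_HJE_solution (open_submanifold M U) X (open_submanifold N (\<pi> ` U)) \<pi> \<Lambda> \<Sigma>"
proof -
  have X: "vector_field M X" and sM: "smooth_manifold M" and sN: "smooth_manifold N"
    and \<pi>: "smooth_map M N \<pi>"
    using assms(1,2) by (auto simp: dynamical_system_def fibration_def submersion_def)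
  then have M: "charted_space M" and N: "charted_space N" by (simp_all add: smooth_manifold_iff)
  have S: "subspace (model M)" and T: "subspace (model N)"
    using M N by (simp_all add: charted_space_def)
  obtain V \<phi> W \<psi> Z U\<^sub>0 V\<^sub>0 F \<Theta> R A where
    c: "(V, \<phi>) \<in> atlas M" and d: "(W, \<psi>) \<in> atlas N"
    and Z: "openin (mtop M) Z" "m \<in> Z" "Z \<subseteq> V" "\<pi> ` Z \<subseteq> W"
    and U\<^sub>0: "open U\<^sub>0" "\<phi> m \<in> U\<^sub>0" and V\<^sub>0: "open V\<^sub>0"
    and im: "F ` U\<^sub>0 = V\<^sub>0" "\<Theta> ` V\<^sub>0 = U\<^sub>0"
    and \<Theta>F: "\<And>x. x \<in> U\<^sub>0 \<Longrightarrow> \<Theta> (F x) = x" and F\<Theta>: "\<And>z. z \<in> V\<^sub>0 \<Longrightarrow> F (\<Theta> z) = z"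
    and sF: "smooth_on U\<^sub>0 F" and s\<Theta>: "smooth_on V\<^sub>0 \<Theta>"
    and inZ: "\<And>x. x \<in> U\<^sub>0 \<Longrightarrow> x \<in> model M \<Longrightarrow> x \<in> \<phi> ` Z"
    and FS: "\<And>x. x \<in> U\<^sub>0 \<Longrightarrow> F x \<in> model M \<longleftrightarrow> x \<in> model M"
    and A: "linear A" and R: "linear R" and surj: "A ` model M = model N"
    and RS: "\<And>t. R t \<in> model M" and AR: "\<And>t. t \<in> model N \<Longrightarrow> A (R t) = t"
    and AF: "\<And>p. p \<in> Z \<Longrightarrow> \<phi> p \<in> U\<^sub>0 \<Longrightarrow> A (F (\<phi> p)) = \<psi> (\<pi> p)"
    and horizontal: "\<And>p \<gamma>. p \<in> Z \<Longrightarrow> \<phi> p \<in> U\<^sub>0 \<Longrightarrow> curve_at M p \<gamma> \<Longrightarrow> X p = velocity M \<gamma> \<Longrightarrow>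
      \<exists>b. ((\<psi> \<circ> (\<pi> \<circ> \<gamma>)) has_vector_derivative b) (at 0) \<and>
          ((F \<circ> (\<phi> \<circ> \<gamma>)) has_vector_derivative R b) (at 0)"
    by (rule straightening_chart[OF assms], rule that)
  have blA: "bounded_linear A" and blR: "bounded_linear R"
    using A R by (simp_all add: linear_conv_bounded_linear)
  define K where "K = {v \<in> model M. A v = 0}"
  have K: "subspace K"
    using S A by (auto simp: K_def subspace_def linear_add linear_scale linear_0)
  \<comment> \<open>\<open>A z\<close> is the coordinate along the images of the sections, \<open>\<kappa> z\<close> tells these images apart\<close>
  define \<kappa> where "\<kappa> = (\<lambda>z. z - R (A z))"
  have bl\<kappa>: "bounded_linear \<kappa>"
    unfolding \<kappa>_def by (intro bounded_linear_sub bounded_linear_ident bounded_linear_compose[OF blR blA])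
  have AK: "A (R a + l) = a" "\<kappa> (R a + l) = l" "R a + l \<in> model M" if "a \<in> model N" "l \<in> K" for a l
    using that AR[OF that(1)] subspace_add[OF S RS] by (simp_all add: \<kappa>_def K_def linear_add[OF A])
  have \<kappa>K: "\<kappa> z \<in> K" if "z \<in> model M" for z
  proof -
    have "A z \<in> model N" using that surj by blast
    then show ?thesis
      using that AR RS subspace_diff[OF S] by (simp add: \<kappa>_def K_def linear_diff[OF A])
  qed
  have mV: "m \<in> V" and \<phi>mS: "\<phi> m \<in> model M" using Z chart_in_model[OF M c] by blast+
  define z\<^sub>0 where "z\<^sub>0 = F (\<phi> m)"
  have z\<^sub>0: "z\<^sub>0 \<in> V\<^sub>0" "z\<^sub>0 \<in> model M" using im(1) U\<^sub>0(2) FS \<phi>mS by (auto simp: z\<^sub>0_def)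
  have "open ((\<lambda>(a, l). R a + l) -` V\<^sub>0)"
    unfolding split_beta
    by (intro open_vimage V\<^sub>0 continuous_intros linear_continuous_on_compose[OF _ R])
  moreover have "(A z\<^sub>0, \<kappa> z\<^sub>0) \<in> (\<lambda>(a, l). R a + l) -` V\<^sub>0" using z\<^sub>0 by (simp add: \<kappa>_def)
  ultimately obtain B C where B: "open B" "A z\<^sub>0 \<in> B" and C: "open C" "\<kappa> z\<^sub>0 \<in> C"
    and BC: "B \<times> C \<subseteq> (\<lambda>(a, l). R a + l) -` V\<^sub>0"
    by (rule open_prod_elim) blast
  have box: "R a + l \<in> V\<^sub>0" if "a \<in> B" "l \<in> C" for a l using BC that by auto
  define D where "D = {q \<in> W. \<psi> q \<in> B}"
  define L where "L = K \<inter> C"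
  define U where "U = {p \<in> Z. \<phi> p \<in> U\<^sub>0 \<and> \<psi> (\<pi> p) \<in> B \<and> \<kappa> (F (\<phi> p)) \<in> C}"
  define \<Sigma> where "\<Sigma> = (\<lambda>(q, l). inv_into V \<phi> (\<Theta> (R (\<psi> q) + l)))"
  define g where "g = (\<lambda>p. (\<pi> p, \<kappa> (F (\<phi> p))))"
  define \<Lambda> :: "('e, 'e) manifold" where "\<Lambda> = \<lparr> mtop = top_of_set L, model = K, atlas = {(L, \<lambda>x. x)} \<rparr>"
  have \<psi>N: "\<psi> q \<in> model N" if "q \<in> W" for q by (rule chart_in_model[OF N d that])
  have \<Sigma>: "\<phi> (\<Sigma> (q, l)) = \<Theta> (R (\<psi> q) + l)" "\<Sigma> (q, l) \<in> U" "\<pi> (\<Sigma> (q, l)) = q" "\<kappa> (F (\<phi> (\<Sigma> (q, l)))) = l"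
    "\<phi> (\<Sigma> (q, l)) \<in> U\<^sub>0" "\<Sigma> (q, l) \<in> Z"
    if "q \<in> D" "l \<in> L" for q l
  proof -
    let ?z = "R (\<psi> q) + l"
    have q: "q \<in> W" "\<psi> q \<in> B" and l: "l \<in> K" "l \<in> C" using that by (auto simp: D_def L_def)
    have z: "?z \<in> V\<^sub>0" by (rule box[OF q(2) l(2)])
    have x: "\<Theta> ?z \<in> U\<^sub>0" "F (\<Theta> ?z) = ?z" using im(2) F\<Theta> z by auto
    have "\<Theta> ?z \<in> model M" using FS[OF x(1)] x(2) AK(3)[OF \<psi>N[OF q(1)] l(1)] by simp
    then have "\<Theta> ?z \<in> \<phi> ` Z" by (rule inZ[OF x(1)])
    then obtain p where p: "p \<in> Z" "\<Theta> ?z = \<phi> p" by blast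
    have \<Sigma>p: "\<Sigma> (q, l) = p" using chart_inv[OF M c] p Z(3) by (auto simp: \<Sigma>_def)
    show 1: "\<phi> (\<Sigma> (q, l)) = \<Theta> ?z" using p \<Sigma>p by simp
    show 2: "\<kappa> (F (\<phi> (\<Sigma> (q, l)))) = l" unfolding 1 x(2) by (rule AK(2)[OF \<psi>N[OF q(1)] l(1)])
    show 3: "\<phi> (\<Sigma> (q, l)) \<in> U\<^sub>0" "\<Sigma> (q, l) \<in> Z" using 1 x(1) p(1) \<Sigma>p by simp_all
    have "\<psi> (\<pi> p) = \<psi> q"
      using AF[OF p(1)] p(2) x AK(1)[OF \<psi>N[OF q(1)] l(1)] by simp
    then have "\<pi> p = q" using inj_onD[OF chart_inj[OF N d], of "\<pi> p" q] p(1) Z(4) q(1) by blast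
    then show 4: "\<pi> (\<Sigma> (q, l)) = q" by (simp add: \<Sigma>p)
    show "\<Sigma> (q, l) \<in> U" unfolding U_def using 2 3 4 q(2) l(2) by simp
  qed
  have g: "\<pi> p \<in> D" "\<kappa> (F (\<phi> p)) \<in> L" "\<Sigma> (g p) = p" if "p \<in> U" for p
  proof -
    have p: "p \<in> Z" "\<phi> p \<in> U\<^sub>0" "p \<in> V" using that Z(3) by (auto simp: U_def)
    show "\<pi> p \<in> D" using that Z(4) by (auto simp: U_def D_def)
    have "F (\<phi> p) \<in> model M" using FS[OF p(2)] chart_in_model[OF M c p(3)] by simp
    then show "\<kappa> (F (\<phi> p)) \<in> L" using that \<kappa>K by (simp add: U_def L_def)
    have "R (\<psi> (\<pi> p)) + \<kappa> (F (\<phi> p)) = F (\<phi> p)" using AF[OF p(1,2)] by (simp add: \<kappa>_def)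
    then show "\<Sigma> (g p) = p" using \<Theta>F[OF p(2)] chart_inv[OF M c p(3)] by (simp add: g_def \<Sigma>_def)
  qed
  have mU: "m \<in> U"
    unfolding U_def using Z(2) U\<^sub>0(2) B(2) C(2) AF[OF Z(2) U\<^sub>0(2)] by (simp add: z\<^sub>0_def)
  have \<pi>U: "\<pi> ` U = D"
  proof (intro subset_antisym subsetI)
    show "q \<in> D" if "q \<in> \<pi> ` U" for q using that g(1) by blast
    have "\<kappa> (F (\<phi> m)) \<in> L" by (rule g(2)[OF mU])
    then show "q \<in> \<pi> ` U" if "q \<in> D" for q using \<Sigma>(2,3)[OF that] by (metis image_eqI)
  qed
  have D: "openin (mtop N) D" unfolding D_def by (rule chart_preimage_open[OF N d B(1)])
  have U: "openin (mtop M) U"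
  proof -
    have "open (U\<^sub>0 \<inter> (\<lambda>x. (A (F x), \<kappa> (F x))) -` (B \<times> C))"
    proof (rule continuous_open_preimage[OF _ U\<^sub>0(1) open_Times[OF B(1) C(1)]])
      show "continuous_on U\<^sub>0 (\<lambda>x. (A (F x), \<kappa> (F x)))"
        by (intro continuous_on_Pair bounded_linear.continuous_on[OF blA] bounded_linear.continuous_on[OF bl\<kappa>]
            smooth_on_imp_continuous_on[OF sF])
    qed
    from openin_Int[OF Z(1) chart_preimage_open[OF M c this]]
    have "openin (mtop M) (Z \<inter> {p \<in> V. \<phi> p \<in> U\<^sub>0 \<inter> (\<lambda>x. (A (F x), \<kappa> (F x))) -` (B \<times> C)})" .
    also have "Z \<inter> {p \<in> V. \<phi> p \<in> U\<^sub>0 \<inter> (\<lambda>x. (A (F x), \<kappa> (F x))) -` (B \<times> C)} = U"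
      using Z(3) AF by (auto simp: U_def)
    finally show ?thesis .
  qed
  have UZ: "U \<subseteq> Z" "U \<subseteq> V" "\<And>p. p \<in> U \<Longrightarrow> \<phi> p \<in> U\<^sub>0" using Z(3) by (auto simp: U_def)
  have DW: "D \<subseteq> W" by (auto simp: D_def)
  have UM: "U \<subseteq> carrier_of M" and DN: "D \<subseteq> carrier_of N" using openin_subset U D by blast+
  have L: "openin (top_of_set K) L" unfolding L_def using C(1) by (auto simp: openin_open)
  have s\<Lambda>: "smooth_manifold \<Lambda>" unfolding \<Lambda>_def by (rule smooth_manifold_open_subset[OF K L])
  then have c\<Lambda>: "charted_space \<Lambda>" by (simp add: smooth_manifold_iff)
  have dim\<Lambda>: "mdim \<Lambda> = mdim M - mdim N"
    using dim_kernel_of_split_surjection[OF S T A R surj RS AR] by (simp add: mdim_def \<Lambda>_def K_def)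
  let ?M = "open_submanifold M U" and ?N = "open_submanifold N D"
  have cM: "charted_space ?M" and cN: "charted_space ?N"
    by (rule charted_space_open_submanifold[OF M U], rule charted_space_open_submanifold[OF N D])
  have carM: "carrier_of ?M = U" and carN: "carrier_of ?N = D" and car\<Lambda>: "carrier_of \<Lambda> = L"
    using UM DN by (auto simp: \<Lambda>_def)
  have cU: "(V \<inter> U, \<phi>) \<in> atlas ?M" and dD: "(W \<inter> D, \<psi>) \<in> atlas ?N" and cL: "(L, \<lambda>x. x) \<in> atlas \<Lambda>"
    using c d by (auto simp: \<Lambda>_def)
  have chart\<Sigma>: "smooth_on (\<psi> ` (W \<inter> D) \<times> L) (\<lambda>y. \<Theta> (R (fst y) + snd y))"
    by (rule smooth_on_compose[OF smooth_on_add[OF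
          smooth_on_linear[OF bounded_linear_compose[OF blR bounded_linear_fst]]
          smooth_on_linear[OF bounded_linear_snd]] s\<Theta>])
      (use box in \<open>auto simp: D_def L_def\<close>)
  have sol: "HJE_solution ?M X ?N \<pi> (\<lambda>q. \<Sigma> (q, l))" if l: "l \<in> L" for l
  proof -
    let ?\<sigma> = "\<lambda>q. \<Sigma> (q, l)"
    have \<sigma>: "smooth_map ?N ?M ?\<sigma>"
    proof (rule smooth_map_from_single_chart[OF cN cM dD _ cU])
      show "carrier_of ?N \<subseteq> W \<inter> D" using carN DW by blast
      show "?\<sigma> q \<in> V \<inter> U" if "q \<in> carrier_of ?N" for q using \<Sigma>(2)[OF _ l] that carN UZ by blast
      show "\<phi> (?\<sigma> q) = (\<lambda>a. \<Theta> (R a + l)) (\<psi> q)" if "q \<in> carrier_of ?N" for q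
        using \<Sigma>(1)[OF _ l] that carN by blast
      have "smooth_on (\<psi> ` (W \<inter> D)) (\<lambda>a. (a, l))"
        unfolding smooth_on_def by (intro allI Ck_on_Pair Ck_on_ident Ck_on_const)
      from smooth_on_compose[OF this chart\<Sigma>] show "smooth_on (\<psi> ` (W \<inter> D)) (\<lambda>a. \<Theta> (R a + l))"
        using l by auto
    qed
    have \<pi>': "smooth_map ?M ?N \<pi>"
      by (rule smooth_map_restrict[OF M \<pi>]) (simp add: \<pi>U)
    have "tangent_map ?M ?\<sigma> (tangent_map ?N \<pi> (X (?\<sigma> q))) = X (?\<sigma> q)" if q: "q \<in> D" for q
    proof -
      let ?p = "?\<sigma> q"
      have p: "?p \<in> U" "\<pi> ?p = q" using \<Sigma>[OF q l] by simp_all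
      then have "X ?p \<in> tangent_space M ?p" using X UM by (auto simp: vector_field_def)
      then obtain \<gamma> where \<gamma>: "curve_at M ?p \<gamma>" "X ?p = velocity M \<gamma>" by (auto simp: tangent_space_def)
      have \<gamma>0: "\<gamma> 0 = ?p" using curve_at_carrier[OF \<gamma>(1)] by blast
      have \<gamma>': "curve_at ?M ?p \<gamma>" using curve_at_open_submanifold[OF M U p(1)] \<gamma>(1) by blast
      have Xv: "X ?p = velocity ?M \<gamma>" using velocity_open_submanifold[OF M U] \<gamma>0 p(1) \<gamma>(2) by simp
      have \<pi>\<gamma>: "curve_at ?N q (\<pi> \<circ> \<gamma>)" using curve_at_smooth_map[OF cM cN \<pi>' \<gamma>'] p(2) by simp
      have \<sigma>\<pi>\<gamma>: "curve_at ?M ?p (?\<sigma> \<circ> (\<pi> \<circ> \<gamma>))" using curve_at_smooth_map[OF cN cM \<sigma> \<pi>\<gamma>] by simp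
      have pVU: "?p \<in> V \<inter> U" and qWD: "q \<in> W \<inter> D" using p(1) UZ q DW by blast+
      obtain b where b: "((\<psi> \<circ> (\<pi> \<circ> \<gamma>)) has_vector_derivative b) (at 0)"
        "((F \<circ> (\<phi> \<circ> \<gamma>)) has_vector_derivative R b) (at 0)"
        using horizontal[OF \<Sigma>(6)[OF q l] \<Sigma>(5)[OF q l] \<gamma>] by blast
      let ?z = "R (\<psi> q) + l"
      have zV: "?z \<in> V\<^sub>0" using box q l by (auto simp: D_def L_def)
      obtain \<Theta>' where \<Theta>': "(\<Theta> has_derivative blinfun_apply \<Theta>') (at ?z)"
        using smooth_on_openE[OF V\<^sub>0 s\<Theta>] zV by metis
      have Fp: "F (\<phi> ?p) = ?z" using \<Sigma>(1)[OF q l] F\<Theta>[OF zV] by simp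
      have evU: "\<forall>\<^sub>F t in at 0. \<gamma> t \<in> V \<inter> U" by (rule curve_atD(2)[OF cM cU pVU \<gamma>'])
      have evD: "\<forall>\<^sub>F t in at 0. (\<pi> \<circ> \<gamma>) t \<in> W \<inter> D" by (rule curve_atD(2)[OF cN dD qWD \<pi>\<gamma>])
      \<comment> \<open>both curves have velocity \<open>\<Theta>' (R b)\<close> in the chart\<close>
      have "((\<phi> \<circ> \<gamma>) has_vector_derivative \<Theta>' (R b)) (at 0)"
      proof (rule has_vector_derivative_eventually_eq)
        show "((\<Theta> \<circ> (F \<circ> (\<phi> \<circ> \<gamma>))) has_vector_derivative \<Theta>' (R b)) (at 0)"
          by (rule has_vector_derivative_compose_derivative[OF b(2)]) (simp add: \<gamma>0 Fp \<Theta>')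
        show "\<forall>\<^sub>F t in at 0. (\<Theta> \<circ> (F \<circ> (\<phi> \<circ> \<gamma>))) t = (\<phi> \<circ> \<gamma>) t"
          using evU by eventually_elim (simp add: \<Theta>F UZ(3))
      qed (simp add: \<gamma>0 \<Theta>F UZ(3) p(1))
      moreover have "((\<phi> \<circ> (?\<sigma> \<circ> (\<pi> \<circ> \<gamma>))) has_vector_derivative \<Theta>' (R b)) (at 0)"
      proof (rule has_vector_derivative_eventually_eq)
        have "((\<lambda>a. R a + l) has_derivative R) (at a)" for a
          using has_derivative_add[OF bounded_linear_imp_has_derivative[OF blR] has_derivative_const] by simp
        then have "(((\<lambda>a. R a + l) \<circ> (\<psi> \<circ> (\<pi> \<circ> \<gamma>))) has_vector_derivative R b) (at 0)"
          by (rule has_vector_derivative_compose_derivative[OF b(1)])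
        then show "((\<Theta> \<circ> ((\<lambda>a. R a + l) \<circ> (\<psi> \<circ> (\<pi> \<circ> \<gamma>)))) has_vector_derivative \<Theta>' (R b)) (at 0)"
          by (rule has_vector_derivative_compose_derivative) (simp add: \<gamma>0 p(2) \<Theta>')
        show "\<forall>\<^sub>F t in at 0. (\<Theta> \<circ> ((\<lambda>a. R a + l) \<circ> (\<psi> \<circ> (\<pi> \<circ> \<gamma>)))) t = (\<phi> \<circ> (?\<sigma> \<circ> (\<pi> \<circ> \<gamma>))) t"
          using evD by eventually_elim (simp add: \<Sigma>(1)[OF _ l])
      qed (simp add: \<gamma>0 p(2) \<Sigma>(1)[OF q l])
      ultimately have "vector_derivative (\<phi> \<circ> (?\<sigma> \<circ> (\<pi> \<circ> \<gamma>))) (at 0) = vector_derivative (\<phi> \<circ> \<gamma>) (at 0)"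
        by (simp add: vector_derivative_at)
      from velocity_eqI[OF cM cU pVU \<sigma>\<pi>\<gamma> \<gamma>' this]
      have "velocity ?M (?\<sigma> \<circ> (\<pi> \<circ> \<gamma>)) = X ?p" by (simp add: Xv)
      then show ?thesis
        using tangent_map_velocity[OF cM cN \<pi>' \<gamma>'] tangent_map_velocity[OF cN cM \<sigma> \<pi>\<gamma>] Xv by simp
    qed
    then show ?thesis
      unfolding HJE_solution_def is_section_def carN using \<sigma> \<Sigma>(3)[OF _ l] by blast
  qed
  let ?P = "product_manifold ?N \<Lambda>"
  have cP: "charted_space ?P" by (rule charted_space_product[OF cN c\<Lambda>])
  have "carrier_of ?P = carrier_of ?N \<times> carrier_of \<Lambda>"
    by (simp only: product_manifold_def manifold.simps topspace_prod_topology)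
  then have carP: "carrier_of ?P = D \<times> L" unfolding carN car\<Lambda> .
  have cDL: "((W \<inter> D) \<times> L, map_prod \<psi> (\<lambda>x. x)) \<in> atlas ?P"
    unfolding product_manifold_def manifold.simps mem_Collect_eq using dD cL by blast
  have im\<Sigma>: "\<Sigma> ` (D \<times> L) = U"
  proof (intro subset_antisym subsetI)
    show "p \<in> U" if "p \<in> \<Sigma> ` (D \<times> L)" for p using that \<Sigma>(2) by blast
    show "p \<in> \<Sigma> ` (D \<times> L)" if "p \<in> U" for p
      by (rule image_eqI[of _ _ "g p"]) (use g[OF that] in \<open>simp_all add: g_def\<close>)
  qed
  have diffeo: "local_diffeomorphism ?P ?M \<Sigma>"
    unfolding local_diffeomorphism_def
  proof (intro ballI exI conjI)
    let ?PP = "open_submanifold ?P (D \<times> L)" and ?MM = "open_submanifold ?M (\<Sigma> ` (D \<times> L))"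
    show P: "openin (mtop ?P) (D \<times> L)" using openin_topspace[of "mtop ?P"] by (simp add: carP)
    show MM: "openin (mtop ?M) (\<Sigma> ` (D \<times> L))" using openin_topspace[of "mtop ?M"] by (simp only: im\<Sigma> carM)
    show "p \<in> D \<times> L" if "p \<in> carrier_of ?P" for p using that carP by simp
    have cPP: "charted_space ?PP" and cMM: "charted_space ?MM"
      by (rule charted_space_open_submanifold[OF cP P], rule charted_space_open_submanifold[OF cM MM])
    have carPP: "carrier_of ?PP = D \<times> L" and carMM: "carrier_of ?MM = U"
      using carP carM by (auto simp: im\<Sigma>)
    have dPP: "((W \<inter> D) \<times> L \<inter> D \<times> L, map_prod \<psi> (\<lambda>x. x)) \<in> atlas ?PP" by (rule open_submanifold_chart[OF cDL])
    have dMM: "(V \<inter> U \<inter> \<Sigma> ` (D \<times> L), \<phi>) \<in> atlas ?MM" by (rule open_submanifold_chart[OF cU])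
    have "smooth_map ?PP ?MM \<Sigma>"
    proof (rule smooth_map_from_single_chart[OF cPP cMM dPP _ dMM])
      show "carrier_of ?PP \<subseteq> (W \<inter> D) \<times> L \<inter> D \<times> L" unfolding carPP using DW by blast
      show "\<Sigma> x \<in> V \<inter> U \<inter> \<Sigma> ` (D \<times> L)" if "x \<in> carrier_of ?PP" for x
        using that UZ(2) unfolding carPP im\<Sigma>[symmetric] by blast
      show "\<phi> (\<Sigma> x) = (\<lambda>y. \<Theta> (R (fst y) + snd y)) (map_prod \<psi> (\<lambda>x. x) x)" if "x \<in> carrier_of ?PP" for x
        using that \<Sigma>(1) unfolding carPP by auto
      show "smooth_on (map_prod \<psi> (\<lambda>x. x) ` ((W \<inter> D) \<times> L \<inter> D \<times> L)) (\<lambda>y. \<Theta> (R (fst y) + snd y))"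
        by (rule smooth_on_subset[OF chart\<Sigma>]) auto
    qed
    moreover have "smooth_map ?MM ?PP g"
    proof (rule smooth_map_from_single_chart[OF cMM cPP dMM _ dPP])
      show "carrier_of ?MM \<subseteq> V \<inter> U \<inter> \<Sigma> ` (D \<times> L)" unfolding carMM unfolding im\<Sigma> using UZ(2) by blast
      show "g p \<in> (W \<inter> D) \<times> L \<inter> D \<times> L" if "p \<in> carrier_of ?MM" for p
        using that g(1,2) DW unfolding carMM by (auto simp: g_def)
      show "map_prod \<psi> (\<lambda>x. x) (g p) = (\<lambda>x. (A (F x), \<kappa> (F x))) (\<phi> p)" if "p \<in> carrier_of ?MM" for p
        using that AF UZ unfolding carMM by (auto simp: g_def)
      have "smooth_on U\<^sub>0 (\<lambda>x. (A (F x), \<kappa> (F x)))"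
        by (intro smooth_on_Pair smooth_on_compose[OF sF smooth_on_linear[OF blA] subset_UNIV]
            smooth_on_compose[OF sF smooth_on_linear[OF bl\<kappa>] subset_UNIV])
      then show "smooth_on (\<phi> ` (V \<inter> U \<inter> \<Sigma> ` (D \<times> L))) (\<lambda>x. (A (F x), \<kappa> (F x)))"
        by (rule smooth_on_subset) (use UZ(3) in auto)
    qed
    moreover have "g (\<Sigma> x) = x" if "x \<in> D \<times> L" for x
      using that \<Sigma>(3,4) by (auto simp: g_def)
    ultimately show "diffeomorphism ?PP ?MM \<Sigma>"
      unfolding diffeomorphism_def carPP carMM using g(3) by blast
  qed
  have "complete_HJE_solution ?M X ?N \<pi> \<Lambda> \<Sigma>"
    unfolding complete_HJE_solution_def
  proof (intro conjI)
    show "dynamical_system ?M X"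
      unfolding dynamical_system_def
      using smooth_manifold_open_submanifold[OF sM U] vector_field_open_submanifold[OF M X U] by blast
    show "fibration ?M ?N \<pi>" using fibration_restrict[OF assms(2) U] D by (simp only: \<pi>U)
    show "mdim \<Lambda> = mdim ?M - mdim ?N" using dim\<Lambda> by (simp add: mdim_def)
    show "\<Sigma> ` (carrier_of ?N \<times> carrier_of \<Lambda>) = carrier_of ?M"
      by (simp only: carN car\<Lambda> carM im\<Sigma>)
    show "\<forall>l\<in>carrier_of \<Lambda>. HJE_solution ?M X ?N \<pi> (\<lambda>q. \<Sigma> (q, l))" using sol by (simp only: car\<Lambda>) blast
  qed (rule s\<Lambda>, rule diffeo)
  then show ?thesis
    using U mU D s\<Lambda> dim\<Lambda> unfolding \<pi>U[symmetric] by blast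
qed

end
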